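(* For all integers $m\ge 2$ and $n\ge 1$, the algebra $A(n,m,m-1)$ is geometrically irreducible.
   Context: $\Bbbk$ is an algebraically closed field of arbitrary characteristic. Paths are composed right to left. For $n\ge 1$, $Q(n)$ is the quiver with vertices $0,1$, a loop $\varepsilon_0$ at $0$, a loop $\varepsilon_1$ at $1$, and $n$ arrows $\alpha_1,\dots,\alpha_n\colon 1\to 0$. $A(n,m,m-1)$ is the path algebra $\Bbbk Q(n)$ modulo the ideal generated by $\varepsilon_0^m$, $\varepsilon_1^m$ and $\sum_{i=0}^{m-1}\varepsilon_0^{\,m-1-i}\alpha_1\varepsilon_1^{\,i}$. For a bound quiver algebra $A=\Bbbk Q/I$ and a dimension vector $\mathbf d\in\mathbb N^{Q_0}$, $\mathrm{rep}_A(\mathbf d)$ is the affine variety of tuples $(V_\alpha)_{\alpha\in Q_1}$, $V_\alpha\in M_{d_{t\alpha}\times d_{s\alpha}}(\Bbbk)$, satisfying all relations in $I$. $A$ is geometrically irreducible if $\mathrm{rep}_A(\mathbf d)$ is irreducible for every dimension vector $\mathbf d$. *)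

theory Defs
  imports "HOL-Computational_Algebra.Polynomial"
begin

text \<open>Affine space with coordinates indexed by a type 'c is the function space 'c \<Rightarrow> 'k.
  Polynomial functions are generated by constants and coordinate functions under + and *.
  (Each such function only involves finitely many coordinates.)\<close>

inductive_set poly_fun :: "(('c \<Rightarrow> 'k::comm_ring_1) \<Rightarrow> 'k) set" where
  pf_const: "(\<lambda>x. c) \<in> poly_fun"
| pf_coord: "(\<lambda>x. x i) \<in> poly_fun"
| pf_add: "p \<in> poly_fun \<Longrightarrow> q \<in> poly_fun \<Longrightarrow> (\<lambda>x. p x + q x) \<in> poly_fun"
| pf_mult: "p \<in> poly_fun \<Longrightarrow> q \<in> poly_fun \<Longrightarrow> (\<lambda>x. p x * q x) \<in> poly_fun"

definition zariski_closed :: "('c \<Rightarrow> 'k::comm_ring_1) set \<Rightarrow> bool" where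
  "zariski_closed Z \<longleftrightarrow> (\<exists>P \<subseteq> poly_fun. Z = {x. \<forall>p\<in>P. p x = 0})"

definition zariski_irreducible :: "('c \<Rightarrow> 'k::comm_ring_1) set \<Rightarrow> bool" where
  "zariski_irreducible X \<longleftrightarrow> X \<noteq> {} \<and>
     (\<forall>Z1 Z2. zariski_closed Z1 \<longrightarrow> zariski_closed Z2 \<longrightarrow> X \<subseteq> Z1 \<union> Z2 \<longrightarrow>
        X \<subseteq> Z1 \<or> X \<subseteq> Z2)"

definition mmul :: "nat \<Rightarrow> (nat \<Rightarrow> nat \<Rightarrow> 'k::comm_ring_1) \<Rightarrow> (nat \<Rightarrow> nat \<Rightarrow> 'k) \<Rightarrow> nat \<Rightarrow> nat \<Rightarrow> 'k"
  where "mmul k A B = (\<lambda>i j. \<Sum>l<k. A i l * B l j)"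

fun mpow :: "nat \<Rightarrow> (nat \<Rightarrow> nat \<Rightarrow> 'k::comm_ring_1) \<Rightarrow> nat \<Rightarrow> nat \<Rightarrow> nat \<Rightarrow> 'k" where
  "mpow d A 0 = (\<lambda>i j. if i = j then 1 else 0)"
| "mpow d A (Suc e) = mmul d A (mpow d A e)"

definition mzero :: "nat \<Rightarrow> nat \<Rightarrow> (nat \<Rightarrow> nat \<Rightarrow> 'k::zero) \<Rightarrow> bool" where
  "mzero r c A \<longleftrightarrow> (\<forall>i<r. \<forall>j<c. A i j = 0)"

text \<open>Arrows of Q(n): the loops Eps0 (at 0), Eps1 (at 1) and Alpha i : 1 \<rightarrow> 0 for 1 \<le> i \<le> n.\<close>
datatype arrow = Eps0 | Eps1 | Alpha nat

definition arrow_of_Q :: "nat \<Rightarrow> arrow \<Rightarrow> bool" where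
  "arrow_of_Q n a = (case a of Alpha i \<Rightarrow> 1 \<le> i \<and> i \<le> n | _ \<Rightarrow> True)"

text \<open>Matrix size (rows = dim of target, cols = dim of source) for dimension vector (d0,d1).\<close>
fun arrow_rows :: "nat \<Rightarrow> nat \<Rightarrow> arrow \<Rightarrow> nat" where
  "arrow_rows d0 d1 Eps0 = d0"
| "arrow_rows d0 d1 Eps1 = d1"
| "arrow_rows d0 d1 (Alpha i) = d0"

fun arrow_cols :: "nat \<Rightarrow> nat \<Rightarrow> arrow \<Rightarrow> nat" where
  "arrow_cols d0 d1 Eps0 = d0"
| "arrow_cols d0 d1 Eps1 = d1"
| "arrow_cols d0 d1 (Alpha i) = d1"

text \<open>A point of the ambient affine space: all entries of all matrices V_a, coordinate (a,i,j).
  Entries outside the matrix sizes, or for non-arrows, are forced to be 0, so the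
  ambient space is the affine space of dimension sum over arrows of rows*cols.\<close>
definition rep_space :: "nat \<Rightarrow> nat \<Rightarrow> nat \<Rightarrow> (arrow \<times> nat \<times> nat \<Rightarrow> 'k::comm_ring_1) set" where
  "rep_space n d0 d1 = {x. \<forall>a i j. \<not> (arrow_of_Q n a \<and> i < arrow_rows d0 d1 a \<and> j < arrow_cols d0 d1 a)
       \<longrightarrow> x (a, i, j) = 0}"

definition mat_of :: "(arrow \<times> nat \<times> nat \<Rightarrow> 'k) \<Rightarrow> arrow \<Rightarrow> nat \<Rightarrow> nat \<Rightarrow> 'k" where
  "mat_of x a = (\<lambda>i j. x (a, i, j))"

text \<open>rep_{A(n,m,m-1)}(d0,d1): representations satisfying the generating relations
  eps0^m, eps1^m and \<Sum>_{i=0}^{m-1} eps0^(m-1-i) alpha1 eps1^i (paths composed right to left,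
  so the path eps0^a alpha1 eps1^b acts as the matrix product V_eps0^a V_alpha1 V_eps1^b).\<close>
definition rep_A :: "nat \<Rightarrow> nat \<Rightarrow> nat \<Rightarrow> nat \<Rightarrow> (arrow \<times> nat \<times> nat \<Rightarrow> 'k::comm_ring_1) set" where
  "rep_A n m d0 d1 = {x \<in> rep_space n d0 d1.
      mzero d0 d0 (mpow d0 (mat_of x Eps0) m) \<and>
      mzero d1 d1 (mpow d1 (mat_of x Eps1) m) \<and>
      mzero d0 d1 (\<lambda>r c. \<Sum>i<m.
          mmul d1 (mmul d0 (mpow d0 (mat_of x Eps0) (m - 1 - i)) (mat_of x (Alpha 1)))
                  (mpow d1 (mat_of x Eps1) i) r c)}"

definition geom_irreducible_A :: "nat \<Rightarrow> nat \<Rightarrow> 'k::comm_ring_1 itself \<Rightarrow> bool" where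
  "geom_irreducible_A n m (TYPE('k)) \<longleftrightarrow>
     (\<forall>d0 d1. zariski_irreducible (rep_A n m d0 d1 :: (arrow \<times> nat \<times> nat \<Rightarrow> 'k) set))"

end

theory Submission
  imports Defs "HOL-Library.Function_Algebras" "Jordan_Normal_Form.Determinant"
begin

text \<open>
  Apart from the arrows \<open>\<alpha>\<^sub>2, \<dots>, \<alpha>\<^sub>n\<close>, which are free, a representation is a block upper triangular matrix
  \<open>N\<close> with diagonal blocks \<open>\<epsilon>\<^sub>0, \<epsilon>\<^sub>1\<close>, corner \<open>\<alpha>\<^sub>1\<close> and \<open>N\<^sup>m = 0\<close>: the last relation is the
  vanishing of the corner of \<open>N\<^sup>m\<close>. So it is a nilpotent operator on \<open>V = k\<^sup>d\<close> with an invariant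
  coordinate subspace \<open>U\<close>. Call \<open>N\<close> generic if it has at most one Jordan block of size less than \<open>m\<close>.

  Generic points are dense: a point that is not generic lies on a line \<open>N + t B\<close> of such operators
  along which the ranks of powers of \<open>N\<close> on \<open>V\<close>, \<open>U\<close> and \<open>V / U\<close> go up for almost all \<open>t\<close>, or on a line
  whose general point lies on a line of that kind.

  Any two generic points are joined by a rational curve of points \<open>h(t) J h(t)\<^sup>-\<^sup>1\<close>, where \<open>J\<close> is the
  Jordan form shared by all generic operators. Indeed, in a basis of \<open>V / U\<close> adapted to a suitable
  flag the operator induced on \<open>V / U\<close> has zeros at places depending only on \<open>m\<close> and \<open>dim V / U\<close>, so
  that the admissible \<open>h\<close> are parametrised by an open subset of an affine space.
\<close>

section \<open>Coordinate subspaces and matrices\<close>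

text \<open>The subspace \<open>U\<close> is the obstacle in both halves. The number of Jordan
  blocks of size below m is \<open>dim (ker N^(m-1)) - dim (N V)\<close>: the first term is d minus
  the number of full blocks, the second d minus the number of all blocks. Two short blocks can be
  merged by a rank one change, but the change must keep \<open>U\<close> stable, so its vector has
  to lie in \<open>U\<close> or its functional has to kill \<open>U\<close>. This fails only in a
  rigid configuration: exactly two short blocks, one of them visible in \<open>U\<close> modulo
  \<open>N V\<close>. There, conjugation and changes of the off-diagonal block supply further moves,
  and a dimension count that includes the dual situation shows that one of them works. For the
  second half, the generic operators form one conjugacy class if \<open>U\<close> is ignored, but
  the h for which \<open>h J h^-1\<close> preserves \<open>U\<close> satisfy nonlinear equations. A
  flag on \<open>V / U\<close> whose dimensions are known in advance turns these into the vanishing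
  of coordinates, so that two parameter points can be joined by a straight line. Closed sets enter
  only through polynomials in one variable that vanish almost everywhere.\<close>

definition sc :: "'k::field \<Rightarrow> (nat \<Rightarrow> 'k) \<Rightarrow> nat \<Rightarrow> 'k" where
  "sc c v = (\<lambda>i. c * v i)"

lemma sc_apply: "sc c v i = c * v i"
  by (simp add: sc_def)

lemma fun_diff_apply: "(f - g) x = f x - g x" for f g :: "'a \<Rightarrow> 'b::ab_group_add"
  by (simp add: fun_diff_def)

text \<open>Vectors are functions, but \<open>0\<close> and \<open>+\<close> have to stay opaque to
  the simplifier for the vector space lemmas to apply; pointwise evaluation is requested through
  \<open>fun_simps\<close>.\<close>

declare plus_fun_apply [simp del] zero_fun_apply [simp del] times_fun_apply [simp del]
  one_fun_apply [simp del]

lemmas fun_simps = plus_fun_apply zero_fun_apply sc_apply fun_diff_apply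

interpretation vs: vector_space "sc :: 'k::field \<Rightarrow> _"
  by unfold_locales (auto simp: fun_simps fun_eq_iff algebra_simps)

interpretation fs: vector_space "(*) :: 'k::field \<Rightarrow> 'k \<Rightarrow> 'k"
  by unfold_locales (auto simp: algebra_simps)

interpretation vv: vector_space_pair "sc :: 'k::field \<Rightarrow> _" "sc :: 'k::field \<Rightarrow> _"
  by unfold_locales

interpretation vf: vector_space_pair "sc :: 'k::field \<Rightarrow> _" "(*) :: 'k::field \<Rightarrow> 'k \<Rightarrow> 'k"
  by unfold_locales

abbreviation lin :: "((nat \<Rightarrow> 'k::field) \<Rightarrow> nat \<Rightarrow> 'k) \<Rightarrow> bool" where
  "lin \<equiv> Vector_Spaces.linear sc sc"

definition ssum :: "(nat \<Rightarrow> 'k::field) set \<Rightarrow> (nat \<Rightarrow> 'k) set \<Rightarrow> (nat \<Rightarrow> 'k) set" where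
  "ssum A B = {x + y |x y. x \<in> A \<and> y \<in> B}"

definition line :: "(nat \<Rightarrow> 'k::field) \<Rightarrow> (nat \<Rightarrow> 'k) set" where
  "line v = range (\<lambda>c. sc c v)"

definition unitv :: "nat \<Rightarrow> nat \<Rightarrow> 'k::field" where
  "unitv k = (\<lambda>i. if i = k then 1 else 0)"

text \<open>Vectors of length \<open>d\<close> are functions vanishing outside \<open>{..<d}\<close>; \<open>supp_sp d Q\<close> is the coordinate
  subspace spanned by the unit vectors with index in \<open>Q\<close>.\<close>

definition supp_sp :: "nat \<Rightarrow> nat set \<Rightarrow> (nat \<Rightarrow> 'k::field) set" where
  "supp_sp d Q = {v. \<forall>i. v i \<noteq> 0 \<longrightarrow> i < d \<and> i \<in> Q}"

abbreviation "V d \<equiv> supp_sp d UNIV"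

definition ip :: "nat \<Rightarrow> (nat \<Rightarrow> 'k::field) \<Rightarrow> (nat \<Rightarrow> 'k) \<Rightarrow> 'k" where
  "ip d f v = (\<Sum>i<d. f i * v i)"

definition app :: "nat \<Rightarrow> (nat \<Rightarrow> nat \<Rightarrow> 'k::field) \<Rightarrow> (nat \<Rightarrow> 'k) \<Rightarrow> nat \<Rightarrow> 'k" where
  "app d A v = (\<lambda>i. if i < d then \<Sum>j<d. A i j * v j else 0)"

definition perp :: "nat \<Rightarrow> (nat \<Rightarrow> 'k::field) set \<Rightarrow> (nat \<Rightarrow> 'k) set" where
  "perp d S = {f \<in> V d. \<forall>v\<in>S. ip d f v = 0}"

lemma sum_fun_apply: "(\<Sum>a\<in>S. f a) i = (\<Sum>a\<in>S. f a i)"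
  for f :: "'a \<Rightarrow> nat \<Rightarrow> 'k::comm_monoid_add"
  by (induction S rule: infinite_finite_induct) (auto simp: fun_simps)

lemma subspace_iff: "vs.subspace S \<longleftrightarrow> 0 \<in> S \<and> (\<forall>x\<in>S. \<forall>y\<in>S. x + y \<in> S) \<and> (\<forall>c. \<forall>x\<in>S. sc c x \<in> S)"
  by (auto simp: vs.subspace_def)

lemma subspace_supp_sp [simp, intro]: "vs.subspace (supp_sp d Q)"
  unfolding subspace_iff supp_sp_def by (auto simp: fun_simps; metis add_0)

lemma supp_sp_V: "v \<in> supp_sp d Q \<Longrightarrow> v \<in> V d"
  by (auto simp: supp_sp_def)

lemma supp_sp_subset_V [simp, intro]: "supp_sp d Q \<subseteq> V d"
  by (auto simp: supp_sp_def)

lemma V_out: "v \<in> V d \<Longrightarrow> \<not> i < d \<Longrightarrow> v i = 0"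
  by (auto simp: supp_sp_def)

lemma unitv_supp_sp: "k < d \<Longrightarrow> k \<in> Q \<Longrightarrow> unitv k \<in> supp_sp d Q"
  by (auto simp: supp_sp_def unitv_def)

lemma V_expand:
  assumes "v \<in> V d" shows "v = (\<Sum>i<d. sc (v i) (unitv i))"
proof
  fix j
  have "(\<Sum>i<d. sc (v i) (unitv i)) j = (\<Sum>i<d. if i = j then v i else 0)"
    unfolding sum_fun_apply by (rule sum.cong) (auto simp: unitv_def fun_simps)
  also have "\<dots> = (if j < d then v j else 0)" by simp
  finally show "v j = (\<Sum>i<d. sc (v i) (unitv i)) j" using V_out[OF assms, of j] by auto
qed

lemma subspace_ssum [intro]: "vs.subspace A \<Longrightarrow> vs.subspace B \<Longrightarrow> vs.subspace (ssum A B)"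
  unfolding ssum_def by (rule vs.subspace_sums)

lemma subspace_line [simp, intro]: "vs.subspace (line v)"
proof -
  have "line v = vs.span {v}" unfolding line_def by (auto simp: vs.span_singleton)
  then show ?thesis by simp
qed

lemma in_ssumI1: "x \<in> A \<Longrightarrow> vs.subspace B \<Longrightarrow> x \<in> ssum A B"
  unfolding ssum_def by (metis (mono_tags, lifting) add.right_neutral mem_Collect_eq vs.subspace_0)

lemma in_ssumI2: "y \<in> B \<Longrightarrow> vs.subspace A \<Longrightarrow> y \<in> ssum A B"
  unfolding ssum_def by (metis (mono_tags, lifting) add.left_neutral mem_Collect_eq vs.subspace_0)

lemma in_ssumI: "x \<in> A \<Longrightarrow> y \<in> B \<Longrightarrow> x + y \<in> ssum A B"
  unfolding ssum_def by blast

lemma in_ssumE: assumes "z \<in> ssum A B" obtains x y where "x \<in> A" "y \<in> B" "z = x + y"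
  using assms unfolding ssum_def by blast

lemma ssum_least: "A \<subseteq> C \<Longrightarrow> B \<subseteq> C \<Longrightarrow> vs.subspace C \<Longrightarrow> ssum A B \<subseteq> C"
  unfolding ssum_def by (auto intro: vs.subspace_add)

lemma self_in_line [simp]: "v \<in> line v"
  unfolding line_def by (rule range_eqI[of _ _ 1]) (auto simp: fun_eq_iff fun_simps)

lemma line_subset: "v \<in> S \<Longrightarrow> vs.subspace S \<Longrightarrow> line v \<subseteq> S"
  unfolding line_def by (auto intro: vs.subspace_scale)

lemma subspace_inter': "vs.subspace A \<Longrightarrow> vs.subspace B \<Longrightarrow> vs.subspace (A \<inter> B)"
  by (simp add: subspace_iff)

lemma lin_add: "lin L \<Longrightarrow> L (x + y) = L x + L y"
  and lin_sc: "lin L \<Longrightarrow> L (sc c x) = sc c (L x)"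
  and lin_0: "lin L \<Longrightarrow> L 0 = 0"
  and lin_diff: "lin L \<Longrightarrow> L (x - y) = L x - L y"
  and lin_sum: "lin L \<Longrightarrow> L (sum g S) = (\<Sum>a\<in>S. L (g a))"
  by (fact vv.linear_add vv.linear_scale vv.linear_0 vv.linear_diff vv.linear_sum)+

lemma linI: "(\<And>x y. L (x + y) = L x + L y) \<Longrightarrow> (\<And>c x. L (sc c x) = sc c (L x)) \<Longrightarrow> lin L"
  by unfold_locales (auto simp: fun_simps)

lemma subspace_image: "lin L \<Longrightarrow> vs.subspace S \<Longrightarrow> vs.subspace (L ` S)"
  by (rule vv.linear_subspace_image)

lemma subspace_ker: "lin L \<Longrightarrow> vs.subspace S \<Longrightarrow> vs.subspace {v \<in> S. L v = 0}"
  unfolding subspace_iff by (auto simp: lin_add lin_sc lin_0)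

lemma lin_comp: "lin L \<Longrightarrow> lin M \<Longrightarrow> lin (\<lambda>x. L (M x))"
  by (rule linI) (metis lin_add lin_sc)+

lemma lin_funpow: "lin L \<Longrightarrow> lin (L ^^ b)"
proof (induction b)
  case 0 show ?case by (rule linI) auto
next
  case (Suc b) then show ?case using lin_comp[of L "L ^^ b"] by (simp add: comp_def)
qed

lemma sum_mult_left_commute: "(\<Sum>j<n. f j * (c * g j)) = c * (\<Sum>j<n. f j * g j)"
  for c :: "'k::comm_semiring_1" and n :: nat
  unfolding sum_distrib_left by (rule sum.cong) (auto simp only: mult.left_commute)

lemma lin_app [simp, intro]: "lin (app d A)"
proof (rule linI)
  show "app d A (x + y) = app d A x + app d A y" for x y
    by (simp add: app_def fun_eq_iff fun_simps distrib_left sum.distrib)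
  show "app d A (sc c x) = sc c (app d A x)" for c x
    using sum_mult_left_commute[of "A _" c x] by (simp add: app_def fun_eq_iff fun_simps)
qed

lemma lin_app_pow [simp, intro]: "lin (app d A ^^ b)"
  by (intro lin_funpow lin_app)

lemma app_add: "app d A (x + y) = app d A x + app d A y"
  and app_sc: "app d A (sc c x) = sc c (app d A x)"
  and app_0 [simp]: "app d A 0 = 0"
  and app_diff: "app d A (x - y) = app d A x - app d A y"
  and app_sum: "app d A (sum g S) = (\<Sum>a\<in>S. app d A (g a))"
  by (fact lin_add[OF lin_app] lin_sc[OF lin_app] lin_0[OF lin_app]
      lin_diff[OF lin_app] lin_sum[OF lin_app])+

lemma apow_add: "(app d A ^^ b) (x + y) = (app d A ^^ b) x + (app d A ^^ b) y"
  and apow_sc: "(app d A ^^ b) (sc c x) = sc c ((app d A ^^ b) x)"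
  and apow_0 [simp]: "(app d A ^^ b) 0 = 0"
  and apow_diff: "(app d A ^^ b) (x - y) = (app d A ^^ b) x - (app d A ^^ b) y"
  and apow_sum: "(app d A ^^ b) (sum g S) = (\<Sum>a\<in>S. (app d A ^^ b) (g a))"
  by (fact lin_add[OF lin_app_pow] lin_sc[OF lin_app_pow] lin_0[OF lin_app_pow]
      lin_diff[OF lin_app_pow] lin_sum[OF lin_app_pow])+

lemma app_V [simp]: "app d A v \<in> V d"
  by (auto simp: app_def supp_sp_def)

lemma ip_commute: "ip d f v = ip d v f"
  by (simp add: ip_def mult.commute)

lemma ip_add: "ip d f (x + y) = ip d f x + ip d f y"
  and ip_0: "ip d f 0 = 0"
  and ip_diff: "ip d f (x - y) = ip d f x - ip d f y"
  by (simp_all add: ip_def fun_simps distrib_left right_diff_distrib sum.distrib sum_subtractf)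

lemma ip_sc: "ip d f (sc c x) = c * ip d f x"
  unfolding ip_def sc_apply by (rule sum_mult_left_commute)

lemma ip_add': "ip d (f + g) x = ip d f x + ip d g x"
  and ip_sc': "ip d (sc c f) x = c * ip d f x"
  and ip_0': "ip d 0 x = 0"
  and ip_diff': "ip d (f - g) x = ip d f x - ip d g x"
  using ip_add[of d x f g] ip_sc[of d x c f] ip_0[of d x] ip_diff[of d x f g]
  by (simp_all only: ip_commute[of d x])

lemma subspace_perp [simp, intro]: "vs.subspace (perp d S)"
proof -
  have "vs.subspace (V d :: (nat \<Rightarrow> 'a) set)" by simp
  then show ?thesis unfolding perp_def subspace_iff by (auto simp: ip_add' ip_sc' ip_0')
qed

lemma perp_V: "perp d S \<subseteq> V d" by (auto simp: perp_def)

lemma subspace_orth: "vs.subspace S \<Longrightarrow> vs.subspace {v \<in> S. ip d f v = 0}"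
  by (auto simp: subspace_iff ip_add ip_sc ip_0)

section \<open>Dimension\<close>

lemma V_span: "(V d :: (nat \<Rightarrow> 'k::field) set) \<subseteq> vs.span (unitv ` {..<d})"
proof
  fix v :: "nat \<Rightarrow> 'k" assume "v \<in> V d"
  then have "v = (\<Sum>i<d. sc (v i) (unitv i))" by (rule V_expand)
  moreover have "(\<Sum>i<d. sc (v i) (unitv i)) \<in> vs.span (unitv ` {..<d})"
    by (intro vs.span_sum vs.span_scale vs.span_base) auto
  ultimately show "v \<in> vs.span (unitv ` {..<d})" by metis
qed

lemma indep_V_finite:
  assumes "vs.independent B" "B \<subseteq> V d" shows "finite B" "card B \<le> d"
proof -
  have "finite B \<and> card B \<le> card ((unitv :: nat \<Rightarrow> nat \<Rightarrow> 'a) ` {..<d})"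
    by (rule vs.independent_span_bound) (use assms V_span in auto)
  moreover have "card ((unitv :: nat \<Rightarrow> nat \<Rightarrow> 'a) ` {..<d}) \<le> d"
    by (metis card_image_le card_lessThan finite_lessThan)
  ultimately show "finite B" "card B \<le> d" by auto
qed

lemma basis_in_V:
  assumes "S \<subseteq> V d"
  obtains B where "B \<subseteq> S" "vs.independent B" "S \<subseteq> vs.span B" "finite B" "card B = vs.dim S"
proof -
  obtain B where "B \<subseteq> S" "vs.independent B" "S \<subseteq> vs.span B" "card B = vs.dim S"
    using vs.basis_exists by blast
  then show ?thesis using that indep_V_finite(1)[of B d] assms by blast
qed

lemma indep_card_le_dim:
  assumes "vs.independent C" "C \<subseteq> S" "S \<subseteq> V d" shows "card C \<le> vs.dim S"
proof -
  obtain B where B: "B \<subseteq> S" "vs.independent B" "S \<subseteq> vs.span B" "finite B" "card B = vs.dim S"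
    using basis_in_V[OF assms(3)] by blast
  have "finite C \<and> card C \<le> card B"
    by (rule vs.independent_span_bound) (use B assms in auto)
  then show ?thesis using B by simp
qed

lemma dim_mono_V: assumes "S \<subseteq> S'" "S' \<subseteq> V d" shows "vs.dim S \<le> vs.dim S'"
proof -
  obtain B where B: "B \<subseteq> S" "vs.independent B" "card B = vs.dim S"
    using basis_in_V[of S d] assms by (metis order_trans)
  show ?thesis using indep_card_le_dim[OF B(2) _ assms(2)] B assms(1) by auto
qed

lemma dim_insert_V:
  assumes "vs.subspace S" "S \<subseteq> V d" "z \<in> V d" "z \<notin> S"
  shows "vs.dim (ssum S (line z)) = Suc (vs.dim S)"
proof -
  obtain B where B: "B \<subseteq> S" "vs.independent B" "S \<subseteq> vs.span B" "finite B" "card B = vs.dim S"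
    using basis_in_V[OF assms(2)] by blast
  have spB: "vs.span B = S" using B assms(1) by (metis vs.span_minimal subset_antisym)
  have ind: "vs.independent (insert z B)" by (rule vs.independent_insertI) (use B assms(4) spB in auto)
  have "ssum S (line z) = vs.span (insert z B)"
  proof (rule subset_antisym)
    show "ssum S (line z) \<subseteq> vs.span (insert z B)"
    proof (rule ssum_least)
      show "S \<subseteq> vs.span (insert z B)" using spB vs.span_mono[of B "insert z B"] by blast
      show "line z \<subseteq> vs.span (insert z B)" by (rule line_subset) (auto intro: vs.span_base)
    qed simp
    have "insert z B \<subseteq> ssum S (line z)"
      using B(1) in_ssumI1[of _ S "line z"] in_ssumI2[OF self_in_line assms(1)] by auto
    then show "vs.span (insert z B) \<subseteq> ssum S (line z)"
      using assms(1) by (intro vs.span_minimal) auto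
  qed
  then have "vs.dim (ssum S (line z)) = card (insert z B)" using ind by (metis vs.dim_span_eq_card_independent)
  moreover have "z \<notin> B" using B assms(4) by auto
  ultimately show ?thesis using B by simp
qed

lemma dim_psubset_V:
  assumes "vs.subspace S" "S \<subset> S'" "S' \<subseteq> V d" "vs.subspace S'" shows "vs.dim S < vs.dim S'"
proof -
  obtain z where z: "z \<in> S'" "z \<notin> S" using assms by auto
  have "vs.dim (ssum S (line z)) = Suc (vs.dim S)"
    by (rule dim_insert_V[of _ d]) (use assms z in auto)
  moreover have "ssum S (line z) \<subseteq> S'"
    by (rule ssum_least) (use assms z line_subset in auto)
  then have "vs.dim (ssum S (line z)) \<le> vs.dim S'" using assms dim_mono_V by blast
  ultimately show ?thesis by simp
qed

lemma dim_eq_V: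
  assumes "vs.subspace S" "S \<subseteq> S'" "S' \<subseteq> V d" "vs.subspace S'" "vs.dim S' \<le> vs.dim S" shows "S = S'"
  using dim_psubset_V[OF assms(1) _ assms(3,4)] assms(2,5) by (metis leD psubsetI)

text \<open>Coordinates with respect to \<open>C\<close> are unique, and those of a common vector
  are supported in \<open>B\<close> and in \<open>C - B\<close> at once.\<close>

lemma indep_span_Int:
  assumes "B \<subseteq> C" "vs.independent C" shows "vs.span B \<inter> vs.span (C - B) = {0}"
proof -
  have "v = 0" if v: "v \<in> vs.span B" "v \<in> vs.span (C - B)" for v
  proof -
    have vC: "v \<in> vs.span C" using v(1) assms(1) vs.span_mono by blast
    have "vs.representation C v = vs.representation B v"
      using vs.representation_extend[OF assms(2) v(1) assms(1)] .
    moreover have "vs.representation C v = vs.representation (C - B) v"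
      using vs.representation_extend[OF assms(2) v(2)] by auto
    ultimately have "vs.representation C v b = 0" for b
      by (metis Diff_iff vs.representation_ne_zero)
    then show "v = 0"
      using vs.sum_nonzero_representation_eq[OF assms(2) vC] by simp
  qed
  then show ?thesis using vs.span_zero by blast
qed

lemma rank_nullity:
  assumes L: "lin L" and S: "vs.subspace S" "S \<subseteq> V d"
  shows "vs.dim S = vs.dim {v \<in> S. L v = 0} + vs.dim (L ` S)"
proof -
  let ?K = "{v \<in> S. L v = 0}"
  have sK: "vs.subspace ?K" using subspace_ker L S by blast
  obtain B where B: "B \<subseteq> ?K" "vs.independent B" "?K \<subseteq> vs.span B" "finite B" "card B = vs.dim ?K"
  proof -
    have "?K \<subseteq> V d" using S by blast
    from basis_in_V[OF this] show ?thesis using that by blast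
  qed
  have spB: "vs.span B = ?K" using B sK by (metis vs.span_minimal subset_antisym)
  obtain C where C: "B \<subseteq> C" "C \<subseteq> S" "vs.independent C" "S \<subseteq> vs.span C"
  proof -
    have "B \<subseteq> S" using B(1) by blast
    from vs.maximal_independent_subset_extend[OF this B(2)] show ?thesis using that by blast
  qed
  have fC: "finite C" using indep_V_finite(1)[of C d] C(2,3) S by blast
  have spC: "vs.span C = S" using C(2,4) S(1) by (metis vs.span_minimal subset_antisym)
  have dS: "card C = vs.dim S" using vs.dim_span_eq_card_independent[OF C(3)] spC by simp
  let ?D = "C - B"
  \<comment> \<open>The part \<open>?D\<close> of a basis of \<open>S\<close> that completes a basis
    of the kernel spans a complement of the kernel, so \<open>L\<close> maps it to a basis of the
    image.\<close>
  have ex: "\<And>v. v \<in> vs.span ?D \<Longrightarrow> L v = 0 \<Longrightarrow> v = 0"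
  proof -
    fix v assume v: "v \<in> vs.span ?D" "L v = 0"
    have "v \<in> S" using v(1) vs.span_mono[of ?D C] spC by blast
    then have "v \<in> {v \<in> S. L v = 0}" using v by blast
    then have "v \<in> vs.span B" unfolding spB .
    show "v = 0" using indep_span_Int[OF C(1,3)] v(1) \<open>v \<in> vs.span B\<close> by auto
  qed
  have inj: "inj_on L (vs.span ?D)"
  proof (rule inj_onI)
    fix x y assume xy: "x \<in> vs.span ?D" "y \<in> vs.span ?D" "L x = L y"
    have "L (x - y) = 0" using lin_diff[OF L, of x y] xy(3) by (metis diff_self)
    then have "x - y = 0" using ex[OF vs.span_diff[OF xy(1,2)]] by blast
    then show "x = y" by (metis eq_iff_diff_eq_0)
  qed
  have indD: "vs.independent ?D" using C(3) by (metis Diff_subset vs.independent_mono)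
  have indL: "vs.independent (L ` ?D)"
    by (rule vv.linear_independent_injective_image[OF L indD inj])
  have "L ` S = vs.span (L ` ?D)"
  proof -
    have "L ` S = L ` vs.span C" using spC by simp
    also have "\<dots> = vs.span (L ` C)" by (rule vv.linear_span_image[OF L, symmetric])
    also have "L ` C = L ` B \<union> L ` ?D" using C(1) by blast
    also have "vs.span (L ` B \<union> L ` ?D) = vs.span (L ` ?D)"
    proof (rule subset_antisym)
      show "vs.span (L ` B \<union> L ` ?D) \<subseteq> vs.span (L ` ?D)"
      proof (rule vs.span_minimal)
        have "L ` B \<subseteq> vs.span (L ` ?D)"
        proof
          fix y assume "y \<in> L ` B"
          then have "y = 0" using B(1) by blast
          then show "y \<in> vs.span (L ` ?D)" by (simp only: vs.span_zero)
        qed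
        then show "L ` B \<union> L ` ?D \<subseteq> vs.span (L ` ?D)"
          by (rule Un_least) (rule vs.span_superset)
      qed (rule vs.subspace_span)
      show "vs.span (L ` ?D) \<subseteq> vs.span (L ` B \<union> L ` ?D)" by (rule vs.span_mono) (rule Un_upper2)
    qed
    finally show ?thesis .
  qed
  then have "vs.dim (L ` S) = card (L ` ?D)" using indL by (metis vs.dim_span_eq_card_independent)
  also have "\<dots> = card ?D" by (rule card_image) (rule inj_on_subset[OF inj vs.span_superset])
  also have "\<dots> = card C - card B" using C(1) fC B(4) by (simp add: card_Diff_subset)
  finally show ?thesis using dS B C fC by (metis add_diff_inverse_nat card_mono not_less)
qed

section \<open>Duality\<close>

definition tr :: "(nat \<Rightarrow> nat \<Rightarrow> 'k) \<Rightarrow> nat \<Rightarrow> nat \<Rightarrow> 'k" where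
  "tr A = (\<lambda>i j. A j i)"

lemma tr_tr [simp]: "tr (tr A) = A" by (simp add: tr_def)

lemma ip_app: "ip d f (app d A v) = ip d (app d (tr A) f) v"
proof -
  have "ip d f (app d A v) = (\<Sum>i<d. \<Sum>j<d. f i * (A i j * v j))"
    unfolding ip_def app_def by (rule sum.cong) (simp_all add: sum_distrib_left)
  also have "\<dots> = (\<Sum>j<d. \<Sum>i<d. f i * (A i j * v j))" by (rule sum.swap)
  also have "\<dots> = (\<Sum>j<d. (\<Sum>i<d. A i j * f i) * v j)"
    unfolding sum_distrib_right by (intro sum.cong refl) (simp only: mult_ac)
  also have "\<dots> = ip d (app d (tr A) f) v"
    unfolding ip_def app_def tr_def by (rule sum.cong) simp_all
  finally show ?thesis .
qed

lemma ip_apow: "ip d f ((app d A ^^ b) v) = ip d ((app d (tr A) ^^ b) f) v"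
proof (induction b arbitrary: f)
  case (Suc b)
  show ?case unfolding funpow.simps(2)[of b "app d A"] comp_apply ip_app Suc.IH
    by (simp only: funpow_Suc_right comp_apply)
qed simp

lemma apow_V: "v \<in> V d \<Longrightarrow> (app d A ^^ b) v \<in> V d"
  by (cases b) simp_all

lemma ip_unitv: "i < d \<Longrightarrow> ip d f (unitv i) = f i"
proof -
  assume "i < d"
  have "ip d f (unitv i) = (\<Sum>j<d. if j = i then f i else 0)"
    unfolding ip_def unitv_def by (rule sum.cong) auto
  then show ?thesis using \<open>i < d\<close> by simp
qed

text \<open>A basis of \<open>S\<close> stays independent when z is added, so a functional may be
  prescribed as 0 on the one and 1 on the other; its values on unit vectors make it a vector
  f.\<close>

lemma separation:
  assumes "vs.subspace S" "S \<subseteq> V d" "z \<in> V d" "z \<notin> S"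
  obtains f where "f \<in> V d" "\<And>v. v \<in> S \<Longrightarrow> ip d f v = 0" "ip d f z = 1"
proof -
  obtain B where B: "B \<subseteq> S" "vs.independent B" "S \<subseteq> vs.span B" "finite B" "card B = vs.dim S"
    using basis_in_V[OF assms(2)] by blast
  have spB: "vs.span B = S" using B assms(1) by (metis vs.span_minimal subset_antisym)
  have ind: "vs.independent (insert z B)"
    by (rule vs.independent_insertI) (use B assms(4) spB in auto)
  obtain g where g: "Vector_Spaces.linear sc (*) g" "\<And>x. x \<in> insert z B \<Longrightarrow> g x = (if x = z then 1 else 0)"
    using vf.linear_independent_extend[OF ind, of "\<lambda>x. if x = z then 1 else 0"] by blast
  define f where "f = (\<lambda>i. if i < d then g (unitv i) else 0)"
  have fV: "f \<in> V d" unfolding f_def supp_sp_def by simp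
  have fg: "ip d f v = g v" if "v \<in> V d" for v
  proof -
    have "g v = g (\<Sum>i<d. sc (v i) (unitv i))" using V_expand[OF that] by (rule arg_cong)
    also have "\<dots> = (\<Sum>i<d. v i * g (unitv i))"
      unfolding vf.linear_sum[OF g(1)] vf.linear_scale[OF g(1)] ..
    also have "\<dots> = ip d f v" unfolding ip_def f_def by (rule sum.cong) (simp_all add: mult.commute)
    finally show ?thesis ..
  qed
  have "g v = 0" if "v \<in> S" for v
  proof -
    have "v \<in> vs.span B" using that B(3) by blast
    moreover have "g x = 0" if "x \<in> B" for x
      using g(2)[of x] that assms(4) B(1) by auto
    ultimately show ?thesis using vf.linear_eq_0_on_span[OF g(1)] by blast
  qed
  then have "ip d f v = 0" if "v \<in> S" for v
    using fg[OF subsetD[OF assms(2) that]] that by simp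
  moreover have "ip d f z = 1" using fg[OF assms(3)] g(2)[of z] by simp
  ultimately show ?thesis using that[OF fV] by simp
qed

lemma perpD: "f \<in> perp d S \<Longrightarrow> v \<in> S \<Longrightarrow> ip d f v = 0"
  by (simp add: perp_def)

lemma perpI: "f \<in> V d \<Longrightarrow> (\<And>v. v \<in> S \<Longrightarrow> ip d f v = 0) \<Longrightarrow> f \<in> perp d S"
  by (simp add: perp_def)

lemma perp_perp:
  assumes "vs.subspace S" "S \<subseteq> V d" shows "perp d (perp d S) = S"
proof
  show "S \<subseteq> perp d (perp d S)"
  proof
    fix v assume v: "v \<in> S"
    have "ip d v f = 0" if "f \<in> perp d S" for f
      using perpD[OF that v] by (simp only: ip_commute)
    then show "v \<in> perp d (perp d S)" using v assms(2) by (intro perpI) auto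
  qed
  show "perp d (perp d S) \<subseteq> S"
  proof
    fix z assume z: "z \<in> perp d (perp d S)"
    show "z \<in> S"
    proof (rule ccontr)
      assume "z \<notin> S"
      then obtain f where f: "f \<in> V d" "\<And>v. v \<in> S \<Longrightarrow> ip d f v = 0" "ip d f z = 1"
        using separation[OF assms subsetD[OF perp_V z]] by blast
      then have "f \<in> perp d S" by (intro perpI)
      then show False using perpD[OF z] f(3) ip_commute[of d z f] by simp
    qed
  qed
qed

lemma perp_antimono: "S \<subseteq> S' \<Longrightarrow> perp d S' \<subseteq> perp d S"
  by (auto simp: perp_def)

lemma dim_line: "v \<in> V d \<Longrightarrow> v \<noteq> 0 \<Longrightarrow> vs.dim (line v) = 1"
proof -
  assume v: "v \<in> V d" "v \<noteq> 0"
  have "line v = vs.span {v}" unfolding line_def by (auto simp: vs.span_singleton)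
  then show ?thesis
    using v vs.dim_span_eq_card_independent[of "{v}"] by (simp add: vs.dependent_single)
qed

lemma dim_functional_ker:
  assumes "vs.subspace S" "S \<subseteq> V d" "u \<in> S" "ip d u z \<noteq> 0"
  shows "vs.dim S = Suc (vs.dim {f \<in> S. ip d f z = 0})"
proof -
  \<comment> \<open>\<open>rank_nullity\<close> is stated for vector-valued maps, so the functional
    is turned into a map onto the line of \<open>unitv 0\<close>.\<close>
  define L where "L = (\<lambda>f. sc (ip d f z) (unitv 0 :: nat \<Rightarrow> 'a))"
  have L: "lin L" unfolding L_def
    by (rule linI) (simp_all add: ip_add' ip_sc' vs.scale_left_distrib)
  have u0: "unitv 0 \<noteq> (0 :: nat \<Rightarrow> 'a)"
    by (metis unitv_def zero_fun_apply zero_neq_one)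
  have eq: "L f = 0 \<longleftrightarrow> ip d f z = 0" for f
    unfolding L_def using u0 vs.scale_eq_0_iff by blast
  have "L ` S = line (unitv 0)"
  proof
    show "L ` S \<subseteq> line (unitv 0)" unfolding L_def line_def by blast
    show "line (unitv 0) \<subseteq> L ` S"
    proof
      fix y :: "nat \<Rightarrow> 'a" assume "y \<in> line (unitv 0)"
      then obtain c where c: "y = sc c (unitv 0)" unfolding line_def by blast
      have "ip d (sc (c / ip d u z) u) z = c" using assms(4) by (simp add: ip_sc')
      then have "y = L (sc (c / ip d u z) u)" unfolding L_def c by simp
      then show "y \<in> L ` S" using assms(1,3) vs.subspace_scale by blast
    qed
  qed
  moreover have "vs.dim (line (unitv 0 :: nat \<Rightarrow> 'a)) = 1"
    using dim_line[OF _ u0, of 1] unitv_supp_sp[of 0 1 UNIV] by simp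
  ultimately have "vs.dim (L ` S) = 1" by simp
  then show ?thesis using rank_nullity[OF L assms(1,2)] unfolding eq by simp
qed

lemma independent_unitv: "vs.independent (unitv ` {..<d} :: (nat \<Rightarrow> 'k::field) set)"
  and card_unitv: "card (unitv ` {..<d} :: (nat \<Rightarrow> 'k::field) set) = d"
proof -
  have inj: "inj (unitv :: nat \<Rightarrow> nat \<Rightarrow> 'k)"
    by (rule injI) (metis unitv_def zero_neq_one)
  show "card (unitv ` {..<d} :: (nat \<Rightarrow> 'k::field) set) = d"
    using card_image[of unitv "{..<d}"] inj inj_on_subset by (metis card_lessThan subset_UNIV)
  show "vs.independent (unitv ` {..<d} :: (nat \<Rightarrow> 'k::field) set)"
  proof (induction d)
    case (Suc d)
    have "unitv d \<notin> vs.span (unitv ` {..<d} :: (nat \<Rightarrow> 'k) set)"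
    proof
      assume a: "unitv d \<in> vs.span (unitv ` {..<d} :: (nat \<Rightarrow> 'k) set)"
      have "vs.span (unitv ` {..<d} :: (nat \<Rightarrow> 'k) set) \<subseteq> V d"
        by (rule vs.span_minimal) (auto intro: unitv_supp_sp)
      then have "unitv d \<in> (V d :: (nat \<Rightarrow> 'k) set)" using a by blast
      then show False unfolding supp_sp_def unitv_def by (auto dest: spec[of _ d])
    qed
    then show ?case unfolding lessThan_Suc image_insert by (rule vs.independent_insertI) (rule Suc.IH)
  qed (simp add: vs.independent_empty)
qed

lemma dim_V: "vs.dim (V d :: (nat \<Rightarrow> 'k::field) set) = d"
  by (rule vs.dim_unique[of "unitv ` {..<d}"])
    (use independent_unitv card_unitv V_span in \<open>auto intro: unitv_supp_sp\<close>)

text \<open>Each further basis vector cuts the annihilator by one linear condition, and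
  \<open>separation\<close> shows that this condition is not implied by the earlier ones.\<close>

lemma dim_perp:
  assumes "vs.subspace S" "S \<subseteq> V d" shows "vs.dim (perp d S) + vs.dim S = d"
proof -
  obtain B where B: "B \<subseteq> S" "vs.independent B" "S \<subseteq> vs.span B" "finite B" "card B = vs.dim S"
    using basis_in_V[OF assms(2)] by blast
  have spB: "vs.span B = S" using B assms(1) by (metis vs.span_minimal subset_antisym)
  have psp: "perp d (vs.span C) = perp d C" for C :: "(nat \<Rightarrow> 'a) set"
  proof
    show "perp d (vs.span C) \<subseteq> perp d C" by (rule perp_antimono) (rule vs.span_superset)
    show "perp d C \<subseteq> perp d (vs.span C)"
    proof
      fix f assume f: "f \<in> perp d C"
      have "vs.subspace {v. ip d f v = 0}"
        using subspace_orth[of UNIV d f] by (simp add: vs.subspace_UNIV)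
      moreover have "C \<subseteq> {v. ip d f v = 0}" using f perpD by blast
      ultimately have "vs.span C \<subseteq> {v. ip d f v = 0}" by (intro vs.span_minimal)
      then show "f \<in> perp d (vs.span C)" using f perp_V by (intro perpI) blast+
    qed
  qed
  have "finite C \<Longrightarrow> C \<subseteq> V d \<Longrightarrow> vs.independent C \<Longrightarrow> vs.dim (perp d C) + card C = d" for C :: "(nat \<Rightarrow> 'a) set"
  proof (induction C rule: finite_induct)
    case empty
    have "perp d {} = (V d :: (nat \<Rightarrow> 'a) set)" by (auto simp: perp_def)
    then show ?case by (simp add: dim_V)
  next
    case (insert z C)
    have ind: "vs.independent C" "z \<notin> vs.span C"
      using insert.prems(2) insert.hyps(2) vs.independent_insert[of z C] by metis+
    have IH: "vs.dim (perp d C) + card C = d" using insert ind by blast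
    have sub: "vs.span C \<subseteq> V d" using insert.prems(1) by (intro vs.span_minimal) auto
    obtain f where f: "f \<in> V d" "\<And>v. v \<in> vs.span C \<Longrightarrow> ip d f v = 0" "ip d f z = 1"
      using separation[OF _ sub, of z] ind insert.prems(1) by auto
    have "f \<in> perp d C" using f vs.span_base by (intro perpI) auto
    then have "vs.dim (perp d C) = Suc (vs.dim {f \<in> perp d C. ip d f z = 0})"
      using f(3) by (intro dim_functional_ker[of _ d f]) (auto simp: perp_V[THEN subsetD])
    moreover have "perp d (insert z C) = {f \<in> perp d C. ip d f z = 0}" by (auto simp: perp_def)
    ultimately show ?case using IH insert.hyps by simp
  qed
  from this[of B] show ?thesis using B assms(2) psp[of B] spB by auto
qed

lemma perp_ssum:
  assumes "vs.subspace S" "vs.subspace T" shows "perp d (ssum S T) = perp d S \<inter> perp d T"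
proof
  show "perp d (ssum S T) \<subseteq> perp d S \<inter> perp d T"
    using assms by (auto simp: perp_def in_ssumI1 in_ssumI2)
  show "perp d S \<inter> perp d T \<subseteq> perp d (ssum S T)"
    by (auto simp: perp_def ssum_def ip_add)
qed

lemma ssum_V: "S \<subseteq> V d \<Longrightarrow> T \<subseteq> V d \<Longrightarrow> ssum S T \<subseteq> V d"
  by (rule ssum_least) auto

lemma perp_Int:
  assumes "vs.subspace S" "vs.subspace T" "S \<subseteq> V d" "T \<subseteq> V d"
  shows "perp d (S \<inter> T) = ssum (perp d S) (perp d T)"
proof -
  have "perp d (ssum (perp d S) (perp d T)) = S \<inter> T"
    using perp_ssum[OF subspace_perp subspace_perp] perp_perp assms by metis
  then show ?thesis
    using perp_perp[of "ssum (perp d S) (perp d T)" d] ssum_V perp_V subspace_perp by (metis subspace_ssum)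
qed

lemma dim_ssum:
  assumes S: "vs.subspace S" "S \<subseteq> V d" and T: "vs.subspace T" "T \<subseteq> V d"
  shows "vs.dim (ssum S T) + vs.dim (S \<inter> T) = vs.dim S + vs.dim T"
proof -
  obtain B where B: "B \<subseteq> perp d T" "perp d T \<subseteq> vs.span B" "finite B"
    by (rule basis_in_V[OF perp_V[of d T]])
  obtain g where "bij_betw g {0..<card B} B"
    using ex_bij_betw_nat_finite[OF B(3)] by (rule exE)
  then have g: "B = g ` {..<card B}"
    unfolding atLeast0LessThan by (simp only: bij_betw_imp_surj_on)
  define n where "n = card B"
  note g = g[folded n_def]
  \<comment> \<open>Pairing with a basis of the annihilator of \<open>T\<close> is a linear map with
    kernel \<open>T\<close> on \<open>V d\<close>. It plays the role of the projection modulo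
    \<open>T\<close>, under which \<open>S\<close> and \<open>ssum S T\<close> have the same
    image.\<close>
  define L where "L = (\<lambda>v i. if i < n then ip d (g i) v else 0)"
  have L: "lin L" unfolding L_def
    by (rule linI) (auto simp: fun_eq_iff fun_simps ip_add ip_sc)
  have ker: "L v = 0 \<longleftrightarrow> v \<in> T" if "v \<in> V d" for v
  proof
    assume "v \<in> T"
    have "ip d (g i) v = 0" if "i < n" for i
    proof -
      have "g i \<in> B" using that g by blast
      then show ?thesis using B(1) perpD \<open>v \<in> T\<close> by blast
    qed
    then show "L v = 0" unfolding L_def by (auto simp: fun_eq_iff fun_simps)
  next
    assume L0: "L v = 0"
    have "ip d (g i) v = 0" if "i < n" for i
    proof -
      have "L v i = 0" unfolding L0 by (simp only: zero_fun_apply)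
      then show ?thesis using that unfolding L_def by simp
    qed
    then have "B \<subseteq> {f. ip d f v = 0}" unfolding g by auto
    moreover have "vs.subspace {f. ip d f v = 0}"
      by (auto simp: subspace_iff ip_add' ip_sc' ip_0')
    ultimately have "vs.span B \<subseteq> {f. ip d f v = 0}" by (intro vs.span_minimal)
    then have "v \<in> perp d (perp d T)"
      using that B(2) ip_commute[of d v] by (intro perpI) auto
    then show "v \<in> T" using perp_perp[OF T] by simp
  qed
  have sV: "ssum S T \<subseteq> V d" using S T ssum_V by blast
  have "vs.dim (ssum S T) = vs.dim {v \<in> ssum S T. L v = 0} + vs.dim (L ` ssum S T)"
    using S T sV by (intro rank_nullity[OF L]) auto
  also have "{v \<in> ssum S T. L v = 0} = T"
    using ker sV T S in_ssumI2[OF _ S(1)] by blast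
  also have "L ` ssum S T = L ` S"
  proof
    show "L ` S \<subseteq> L ` ssum S T" using in_ssumI1[OF _ T(1)] by blast
    show "L ` ssum S T \<subseteq> L ` S"
    proof
      fix y assume "y \<in> L ` ssum S T"
      then obtain a b where ab: "a \<in> S" "b \<in> T" "y = L (a + b)" by (auto elim: in_ssumE)
      have "L b = 0" using ker[of b] ab(2) T(2) by blast
      then have "y = L a" using ab(3) lin_add[OF L, of a b] by simp
      then show "y \<in> L ` S" using ab(1) by blast
    qed
  qed
  finally have 1: "vs.dim (ssum S T) = vs.dim T + vs.dim (L ` S)" .
  have "vs.dim S = vs.dim {v \<in> S. L v = 0} + vs.dim (L ` S)" by (rule rank_nullity[OF L S])
  moreover have "{v \<in> S. L v = 0} = S \<inter> T" using ker S(2) by blast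
  ultimately show ?thesis using 1 by simp
qed

lemma perp_supp_sp: "perp d (supp_sp d Q) = (supp_sp d (- Q) :: (nat \<Rightarrow> 'k::field) set)"
proof
  show "perp d (supp_sp d Q) \<subseteq> (supp_sp d (- Q) :: (nat \<Rightarrow> 'k) set)"
  proof
    fix f :: "nat \<Rightarrow> 'k" assume f: "f \<in> perp d (supp_sp d Q)"
    have "f i = 0" if "i < d" "i \<in> Q" for i
      using perpD[OF f unitv_supp_sp[OF that]] ip_unitv[OF that(1)] by metis
    moreover have "f i = 0" if "\<not> i < d" for i using V_out[OF _ that] f perp_V by blast
    ultimately show "f \<in> supp_sp d (- Q)" unfolding supp_sp_def by blast
  qed
  show "(supp_sp d (- Q) :: (nat \<Rightarrow> 'k) set) \<subseteq> perp d (supp_sp d Q)"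
  proof
    fix f :: "nat \<Rightarrow> 'k" assume f: "f \<in> supp_sp d (- Q)"
    have "ip d f v = 0" if "v \<in> supp_sp d Q" for v
      unfolding ip_def by (rule sum.neutral) (use f that in \<open>auto simp: supp_sp_def\<close>)
    then show "f \<in> perp d (supp_sp d Q)" using supp_sp_V[OF f] by (intro perpI)
  qed
qed

section \<open>Images and kernels of powers\<close>

abbreviation Img :: "nat \<Rightarrow> (nat \<Rightarrow> nat \<Rightarrow> 'k::field) \<Rightarrow> nat \<Rightarrow> (nat \<Rightarrow> 'k) set \<Rightarrow> (nat \<Rightarrow> 'k) set" where
  "Img d A b X \<equiv> (app d A ^^ b) ` X"

definition Kr :: "nat \<Rightarrow> (nat \<Rightarrow> nat \<Rightarrow> 'k::field) \<Rightarrow> nat \<Rightarrow> (nat \<Rightarrow> 'k) set \<Rightarrow> (nat \<Rightarrow> 'k) set" where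
  "Kr d A b X = {v \<in> X. (app d A ^^ b) v = 0}"

lemma subspace_Img [intro]: "vs.subspace X \<Longrightarrow> vs.subspace (Img d A b X)"
  by (rule subspace_image[OF lin_app_pow])

lemma subspace_Kr [intro]: "vs.subspace X \<Longrightarrow> vs.subspace (Kr d A b X)"
  unfolding Kr_def by (rule subspace_ker[OF lin_app_pow])

lemma Img_V: "X \<subseteq> V d \<Longrightarrow> Img d A b X \<subseteq> V d" using apow_V by blast

lemma Kr_sub: "Kr d A b X \<subseteq> X" by (auto simp: Kr_def)

lemma dim_Kr_Img: "vs.subspace X \<Longrightarrow> X \<subseteq> V d \<Longrightarrow> vs.dim X = vs.dim (Kr d A b X) + vs.dim (Img d A b X)"
  unfolding Kr_def by (rule rank_nullity[OF lin_app_pow])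

text \<open>Adjointness of powers (\<open>ip_apow\<close>). Counted by dimensions, it gives equal
  ranks for the powers of a matrix and of its transpose.\<close>

lemma Kr_tr: "Kr d (tr A) b (V d) = perp d (Img d A b (V d))"
proof
  show "Kr d (tr A) b (V d) \<subseteq> perp d (Img d A b (V d))"
  proof
    fix f assume f: "f \<in> Kr d (tr A) b (V d)"
    have "ip d f ((app d A ^^ b) v) = 0" for v
      using f unfolding ip_apow Kr_def by (simp add: ip_0')
    then show "f \<in> perp d (Img d A b (V d))" using f unfolding Kr_def by (intro perpI) auto
  qed
  show "perp d (Img d A b (V d)) \<subseteq> Kr d (tr A) b (V d)"
  proof
    fix f assume f: "f \<in> perp d (Img d A b (V d))"
    have fV: "f \<in> V d" using f perp_V by blast
    have "((app d (tr A) ^^ b) f) i = 0" for i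
    proof (cases "i < d")
      case True
      have "ip d ((app d (tr A) ^^ b) f) (unitv i) = 0"
        unfolding ip_apow[symmetric] by (rule perpD[OF f]) (use unitv_supp_sp[OF True] in auto)
      then show ?thesis using ip_unitv[OF True] by metis
    next
      case False then show ?thesis using V_out[OF apow_V[OF fV]] by blast
    qed
    then have "(app d (tr A) ^^ b) f = 0" by (simp add: fun_eq_iff zero_fun_apply)
    then show "f \<in> Kr d (tr A) b (V d)" using fV by (simp add: Kr_def)
  qed
qed

lemma dim_Img_tr: "vs.dim (Img d (tr A) b (V d)) = vs.dim (Img d A b (V d))"
proof -
  have "vs.dim (V d :: (nat \<Rightarrow> 'a) set) = vs.dim (Kr d (tr A) b (V d)) + vs.dim (Img d (tr A) b (V d))"
    by (rule dim_Kr_Img) auto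
  moreover have "vs.dim (perp d (Img d A b (V d))) + vs.dim (Img d A b (V d)) = d"
    by (rule dim_perp) (auto intro: Img_V[THEN subsetD])
  ultimately show ?thesis unfolding Kr_tr dim_V by linarith
qed

section \<open>Lines of matrices and semicontinuity of ranks\<close>

definition lnm :: "(nat \<Rightarrow> nat \<Rightarrow> 'k::field) \<Rightarrow> (nat \<Rightarrow> nat \<Rightarrow> 'k) \<Rightarrow> 'k \<Rightarrow> nat \<Rightarrow> nat \<Rightarrow> 'k" where
  "lnm A B t = (\<lambda>i j. A i j + t * B i j)"

lemma lnm_0 [simp]: "lnm A B 0 = A" by (simp add: lnm_def)

lemma tr_lnm: "tr (lnm A B t) = lnm (tr A) (tr B) t" by (simp add: lnm_def tr_def)

lemma app_lnm: "app d (lnm A B t) v = app d A v + sc t (app d B v)"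
proof
  fix i
  have "(\<Sum>j<d. (A i j + t * B i j) * v j) = (\<Sum>j<d. A i j * v j) + (\<Sum>j<d. t * (B i j * v j))"
    unfolding sum.distrib[symmetric] by (rule sum.cong) (simp_all only: distrib_right mult.assoc)
  then show "app d (lnm A B t) v i = (app d A v + sc t (app d B v)) i"
    by (simp add: app_def fun_simps lnm_def sum_distrib_left)
qed

definition pcurve :: "('k::field \<Rightarrow> nat \<Rightarrow> 'k) \<Rightarrow> bool" where
  "pcurve c \<longleftrightarrow> (\<forall>i. \<exists>p. \<forall>t. c t i = poly p t)"

lemma pcurve_const: "pcurve (\<lambda>t. v)"
  unfolding pcurve_def by (intro allI exI[of _ "[:v _:]"]) simp

lemma pcurve_app: assumes "pcurve c" shows "pcurve (\<lambda>t. app d (lnm A B t) (c t))"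
proof -
  obtain p where p: "\<And>i t. c t i = poly (p i) t" using assms unfolding pcurve_def by metis
  have "poly [:a, b:] t = a + t * b" for a b t :: 'a by simp
  then have "app d (lnm A B t) (c t) i = poly (if i < d then \<Sum>j<d. [:A i j, B i j:] * p j else 0) t" for i t
    unfolding app_def lnm_def p if_distrib[of "\<lambda>q. poly q t"] poly_sum poly_mult poly_0 by simp
  then show ?thesis unfolding pcurve_def by blast
qed

lemma pcurve_apow: "pcurve (\<lambda>t. (app d (lnm A B t) ^^ b) v)"
proof (induction b)
  case 0 show ?case by (simp add: pcurve_const)
next
  case (Suc b) show ?case unfolding funpow.simps comp_apply by (rule pcurve_app[OF Suc.IH])
qed

text \<open>Independence of a family rather than of a set: a repeated member makes the family
  dependent, and members that collide at special parameters need no separate treatment.\<close>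

definition indepf :: "nat \<Rightarrow> (nat \<Rightarrow> nat \<Rightarrow> 'k::field) \<Rightarrow> bool" where
  "indepf k c \<longleftrightarrow> (\<forall>\<alpha>. (\<forall>x. (\<Sum>i<k. \<alpha> i * c i x) = 0) \<longrightarrow> (\<forall>i<k. \<alpha> i = 0))"

lemma indepfD: "indepf k c \<Longrightarrow> (\<And>x. (\<Sum>i<k. \<alpha> i * c i x) = 0) \<Longrightarrow> i < k \<Longrightarrow> \<alpha> i = 0"
  unfolding indepf_def by blast

lemma elim_step: "\<beta> * (p * q - r * s) = p * (\<beta> * q) - \<beta> * r * s" for p :: "'k::field"
  by (simp only: right_diff_distrib mult_ac)

text \<open>Gaussian elimination without division: the pivot \<open>c k t j\<close> multiplies
  instead of dividing, so the eliminated vectors are again polynomial curves, and each step excludes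
  only the zeros of one nonzero polynomial.\<close>

lemma indepf_semicont:
  assumes "\<forall>i<k. pcurve (c i)" "indepf k (\<lambda>i. c i t0)"
  shows "finite {t. \<not> indepf k (\<lambda>i. c i t)}"
  using assms
proof (induction k arbitrary: c)
  case 0 show ?case by (simp add: indepf_def)
next
  case (Suc k)
  have "\<exists>j. c k t0 j \<noteq> 0"
  proof (rule ccontr)
    assume a: "\<not> ?thesis"
    have "(\<Sum>i<Suc k. (if i = k then 1 else 0) * c i t0 x) = 0" for x
      using a by simp
    from indepfD[OF Suc.prems(2) this, of k] show False by simp
  qed
  then obtain j where j: "c k t0 j \<noteq> 0" by blast
  define c' where "c' = (\<lambda>i t x. c k t j * c i t x - c i t j * c k t x)"
  have eq: "(\<Sum>i<k. \<beta> i * c' i t x) = c k t j * (\<Sum>i<k. \<beta> i * c i t x) - (\<Sum>i<k. \<beta> i * c i t j) * c k t x" for \<beta> t x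
    unfolding c'_def sum_distrib_left sum_distrib_right sum_subtractf[symmetric]
    by (rule sum.cong) (simp_all only: elim_step)
  obtain p where p: "\<And>i x t. i \<le> k \<Longrightarrow> c i t x = poly (p i x) t"
    using Suc.prems(1) unfolding pcurve_def less_Suc_eq_le by metis
  have "\<forall>i<k. pcurve (c' i)"
  proof (intro allI impI)
    fix i assume "i < k"
    then have "c' i t x = poly (p k j * p i x - p i j * p k x) t" for t x
      by (simp add: c'_def p)
    then show "pcurve (c' i)" unfolding pcurve_def by blast
  qed
  moreover have "indepf k (\<lambda>i. c' i t0)"
    unfolding indepf_def
  proof (intro allI impI)
    fix \<alpha> i assume a: "\<forall>x. (\<Sum>i<k. \<alpha> i * c' i t0 x) = 0" and i: "i < k"
    \<comment> \<open>The relation among the original vectors into which the relation \<alpha> among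
      the eliminated ones unfolds.\<close>
    define \<gamma> where "\<gamma> = (\<lambda>i. if i = k then - (\<Sum>i<k. \<alpha> i * c i t0 j) else c k t0 j * \<alpha> i)"
    have "(\<Sum>i<Suc k. \<gamma> i * c i t0 x) = 0" for x
    proof -
      have "(\<Sum>i<k. \<gamma> i * c i t0 x) = (\<Sum>i<k. c k t0 j * (\<alpha> i * c i t0 x))"
        by (rule sum.cong) (auto simp: \<gamma>_def)
      then show ?thesis using a eq[of \<alpha> t0 x]
        unfolding sum.lessThan_Suc by (simp add: \<gamma>_def sum_distrib_left)
    qed
    from indepfD[OF Suc.prems(2) this, of i] i j show "\<alpha> i = 0" by (simp add: \<gamma>_def)
  qed
  ultimately have fin: "finite {t. \<not> indepf k (\<lambda>i. c' i t)}" by (rule Suc.IH)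
  have "p k j \<noteq> 0" using j p[of k t0 j] by auto
  then have "finite {t. c k t j = 0}" unfolding p[OF order_refl] by (rule poly_roots_finite)
  moreover have "indepf (Suc k) (\<lambda>i. c i t)" if nz: "c k t j \<noteq> 0" and ind: "indepf k (\<lambda>i. c' i t)" for t
    unfolding indepf_def
  proof (intro allI impI)
    fix \<beta> i assume a: "\<forall>x. (\<Sum>i<Suc k. \<beta> i * c i t x) = 0" and i: "i < Suc k"
    have s: "(\<Sum>i<k. \<beta> i * c i t x) = - (\<beta> k * c k t x)" for x
      using a unfolding sum.lessThan_Suc by (metis add_eq_0_iff2)
    have "(\<Sum>i<k. \<beta> i * c' i t x) = 0" for x
      unfolding eq s by (simp only: mult_minus_left mult_minus_right minus_diff_minus mult_ac) simp
    then have z: "\<beta> i = 0" if "i < k" for i using indepfD[OF ind _ that] by blast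
    then have "\<beta> k * c k t j = 0" using s[of j] by simp
    then have "\<beta> k = 0" using nz by simp
    then show "\<beta> i = 0" using z i less_Suc_eq by auto
  qed
  ultimately show ?case
    using finite_subset[of "{t. \<not> indepf (Suc k) (\<lambda>i. c i t)}" "{t. c k t j = 0} \<union> {t. \<not> indepf k (\<lambda>i. c' i t)}"] fin
    by blast
qed

lemma indepf_le_dim:
  assumes "indepf k c" "\<And>i. i < k \<Longrightarrow> c i \<in> S" "S \<subseteq> V d" shows "k \<le> vs.dim S"
proof -
  have inj: "inj_on c {..<k}"
  proof (rule inj_onI, rule ccontr)
    fix i j assume ij: "i \<in> {..<k}" "j \<in> {..<k}" "c i = c j" "i \<noteq> j"
    define \<alpha> where "\<alpha> l = (if l = i then 1 else 0) - (if l = j then 1 else (0::'a))" for l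
    have "(\<Sum>l<k. \<alpha> l * c l x) = 0" for x
    proof -
      have "(\<Sum>l<k. \<alpha> l * c l x) = (\<Sum>l<k. if l = i then c l x else 0) - (\<Sum>l<k. if l = j then c l x else 0)"
        unfolding sum_subtractf[symmetric] by (rule sum.cong) (auto simp: \<alpha>_def)
      then show ?thesis using ij by simp
    qed
    then have "\<alpha> i = 0" using indepfD[OF assms(1)] ij by blast
    then show False using ij(4) by (simp add: \<alpha>_def)
  qed
  have "vs.independent (c ` {..<k})"
  proof (rule vs.independent_if_scalars_zero)
    fix f x assume s: "(\<Sum>x\<in>c ` {..<k}. sc (f x) x) = 0" and x: "x \<in> c ` {..<k}"
    have "(\<Sum>i<k. f (c i) * c i y) = 0" for y
    proof -
      have "(\<Sum>x\<in>c ` {..<k}. sc (f x) x) = (\<Sum>i<k. sc (f (c i)) (c i))"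
        unfolding sum.reindex[OF inj] comp_def ..
      then have "(\<Sum>i<k. sc (f (c i)) (c i)) y = 0" using s by (simp only: zero_fun_apply)
      then show ?thesis unfolding sum_fun_apply sc_apply .
    qed
    then have "f (c i) = 0" if "i < k" for i
      using indepfD[OF assms(1), of "\<lambda>i. f (c i)" i] that by simp
    then show "f x = 0" using x by auto
  qed simp
  then have "card (c ` {..<k}) \<le> vs.dim S"
    by (rule indep_card_le_dim[OF _ _ assms(3)]) (use assms(2) in auto)
  then show ?thesis using card_image[OF inj] by simp
qed

lemma dim_indepf:
  assumes "S \<subseteq> V d"
  obtains c where "indepf (vs.dim S) c" "\<And>i. i < vs.dim S \<Longrightarrow> c i \<in> S"
proof -
  obtain B where B: "B \<subseteq> S" "vs.independent B" "S \<subseteq> vs.span B" "finite B" "card B = vs.dim S"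
    by (rule basis_in_V[OF assms])
  obtain c where c: "bij_betw c {0..<card B} B"
    using ex_bij_betw_nat_finite[OF B(4)] by (rule exE)
  have im: "c ` {..<vs.dim S} = B" and inj: "inj_on c {..<vs.dim S}"
    using c unfolding atLeast0LessThan B(5) bij_betw_def by auto
  have "indepf (vs.dim S) c"
    unfolding indepf_def
  proof (intro allI impI)
    fix \<alpha> i assume a: "\<forall>x. (\<Sum>i<vs.dim S. \<alpha> i * c i x) = 0" and i: "i < vs.dim S"
    define u where "u v = \<alpha> (the_inv_into {..<vs.dim S} c v)" for v
    have u: "u (c i) = \<alpha> i" if "i < vs.dim S" for i
      unfolding u_def using the_inv_into_f_f[OF inj] that by simp
    have "(\<Sum>v\<in>B. sc (u v) v) = (\<Sum>i<vs.dim S. sc (u (c i)) (c i))"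
      unfolding im[symmetric] sum.reindex[OF inj] comp_def ..
    also have "\<dots> = (\<Sum>i<vs.dim S. sc (\<alpha> i) (c i))" by (rule sum.cong) (simp_all add: u)
    also have "\<dots> = 0"
      using a by (simp add: fun_eq_iff sum_fun_apply sc_apply zero_fun_apply)
    finally have "u (c i) = 0"
      using vs.independentD[OF B(2) B(4) order_refl, of u "c i"] i im by blast
    then show "\<alpha> i = 0" using u[OF i] by simp
  qed
  moreover have "c i \<in> S" if "i < vs.dim S" for i using that im B(1) by blast
  ultimately show ?thesis using that by blast
qed

text \<open>Preimages \<open>v i\<close> of a basis of the image at t0 are kept fixed; their images
  at t are polynomial curves, and independence at t0 persists for almost all t.\<close>

lemma dim_semicont:
  assumes "X \<subseteq> V d"
  shows "finite {t. vs.dim (Img d (lnm A B t) b X) < vs.dim (Img d (lnm A B t0) b X)}"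
proof -
  let ?k = "vs.dim (Img d (lnm A B t0) b X)"
  obtain c where c: "indepf ?k c" "\<And>i. i < ?k \<Longrightarrow> c i \<in> Img d (lnm A B t0) b X"
    by (rule dim_indepf[OF Img_V[OF assms]]) blast
  have "\<forall>i. \<exists>v. i < ?k \<longrightarrow> v \<in> X \<and> c i = (app d (lnm A B t0) ^^ b) v" using c(2) by blast
  then obtain v where v: "\<And>i. i < ?k \<Longrightarrow> v i \<in> X \<and> c i = (app d (lnm A B t0) ^^ b) (v i)" by metis
  define e where "e i t = (app d (lnm A B t) ^^ b) (v i)" for i t
  have "indepf ?k (\<lambda>i. e i t0)"
    using c(1) v unfolding indepf_def e_def by simp
  moreover have "\<forall>i<?k. pcurve (e i)" unfolding e_def by (simp add: pcurve_apow)
  ultimately have "finite {t. \<not> indepf ?k (\<lambda>i. e i t)}" by (intro indepf_semicont)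
  moreover have "?k \<le> vs.dim (Img d (lnm A B t) b X)" if "indepf ?k (\<lambda>i. e i t)" for t
    by (rule indepf_le_dim[OF that _ Img_V[OF assms]]) (use v in \<open>simp add: e_def\<close>)
  ultimately show ?thesis
    by (rule_tac finite_subset[of _ "{t. \<not> indepf ?k (\<lambda>i. e i t)}"]) (auto simp: not_less[symmetric])
qed

section \<open>Admissible operators, the rank measure and improving lines\<close>

definition ok :: "nat \<Rightarrow> nat \<Rightarrow> nat set \<Rightarrow> (nat \<Rightarrow> nat \<Rightarrow> 'k::field) \<Rightarrow> bool" where
  "ok d m Q A \<longleftrightarrow> (\<forall>u\<in>supp_sp d Q. app d A u \<in> supp_sp d Q) \<and> (\<forall>v\<in>V d. (app d A ^^ m) v = 0)"

text \<open>The dual of the quotient by \<open>supp_sp d Q\<close> is \<open>supp_sp d (- Q)\<close> with the transposed matrix. Replacing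
  \<open>(Q, A)\<close> by \<open>(- Q, tr A)\<close> is therefore a symmetry of the whole situation.\<close>

definition meas :: "nat \<Rightarrow> nat \<Rightarrow> nat set \<Rightarrow> (nat \<Rightarrow> nat \<Rightarrow> 'k::field) \<Rightarrow> nat" where
  "meas d m Q A = (\<Sum>b\<le>m. vs.dim (Img d A b (V d)) + vs.dim (Img d A b (supp_sp d Q)) +
      vs.dim (Img d (tr A) b (supp_sp d (- Q))))"

definition improvable :: "nat \<Rightarrow> nat \<Rightarrow> nat set \<Rightarrow> (nat \<Rightarrow> nat \<Rightarrow> 'k::field) \<Rightarrow> bool" where
  "improvable d m Q A \<longleftrightarrow> (\<exists>B. (\<forall>t. ok d m Q (lnm A B t)) \<and> finite {t. \<not> meas d m Q A < meas d m Q (lnm A B t)})"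

definition semi_improvable :: "nat \<Rightarrow> nat \<Rightarrow> nat set \<Rightarrow> (nat \<Rightarrow> nat \<Rightarrow> 'k::field) \<Rightarrow> bool" where
  "semi_improvable d m Q A \<longleftrightarrow> (\<exists>B. (\<forall>t. ok d m Q (lnm A B t)) \<and> finite {t. \<not> improvable d m Q (lnm A B t)})"

lemma ok_tr: assumes "ok d m Q A" shows "ok d m (- Q) (tr A)"
  unfolding ok_def
proof (intro conjI ballI)
  fix f :: "nat \<Rightarrow> 'a" assume f: "f \<in> supp_sp d (- Q)"
  have "ip d (app d (tr A) f) u = 0" if "u \<in> supp_sp d Q" for u
    unfolding ip_app[symmetric]
    by (rule perpD[of _ _ "supp_sp d Q"]) (use assms that f in \<open>auto simp: ok_def perp_supp_sp\<close>)
  then have "app d (tr A) f \<in> perp d (supp_sp d Q)" by (intro perpI) auto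
  then show "app d (tr A) f \<in> supp_sp d (- Q)" by (simp only: perp_supp_sp)
next
  fix f :: "nat \<Rightarrow> 'a" assume f: "f \<in> V d"
  have "f \<in> perp d (Img d A m (V d))"
    by (rule perpI[OF f]) (use assms in \<open>auto simp: ok_def ip_0\<close>)
  then show "(app d (tr A) ^^ m) f = 0" unfolding Kr_tr[symmetric] Kr_def by blast
qed

lemma ok_tr_iff: "ok d m (- Q) (tr A) \<longleftrightarrow> ok d m Q A"
  using ok_tr[of d m Q A] ok_tr[of d m "- Q" "tr A"] by auto

lemma meas_tr: "meas d m (- Q) (tr A) = meas d m Q A"
  unfolding meas_def dim_Img_tr double_complement tr_tr by (intro sum.cong) simp_all

lemma improvable_tr: assumes "improvable d m (- Q) (tr A)" shows "improvable d m Q A"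
proof -
  obtain B where "\<forall>t. ok d m (- Q) (lnm (tr A) B t)"
    "finite {t. \<not> meas d m (- Q) (tr A) < meas d m (- Q) (lnm (tr A) B t)}"
    using assms unfolding improvable_def by blast
  moreover have "lnm (tr A) B t = tr (lnm A (tr B) t)" for t by (simp add: tr_lnm)
  ultimately have "\<forall>t. ok d m Q (lnm A (tr B) t)" "finite {t. \<not> meas d m Q A < meas d m Q (lnm A (tr B) t)}"
    by (simp_all only: ok_tr_iff meas_tr simp_thms)
  then show ?thesis unfolding improvable_def by blast
qed

lemma semi_improvable_tr: assumes "semi_improvable d m (- Q) (tr A)" shows "semi_improvable d m Q A"
proof -
  obtain B where B: "\<forall>t. ok d m (- Q) (lnm (tr A) B t)"
    "finite {t. \<not> improvable d m (- Q) (lnm (tr A) B t)}"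
    using assms unfolding semi_improvable_def by blast
  have eq: "lnm (tr A) B t = tr (lnm A (tr B) t)" for t by (simp add: tr_lnm)
  have "\<forall>t. ok d m Q (lnm A (tr B) t)" using B(1) by (simp only: eq ok_tr_iff simp_thms)
  moreover have "finite {t. \<not> improvable d m Q (lnm A (tr B) t)}"
    using B(2) unfolding eq by (rule rev_finite_subset) (use improvable_tr in blast)
  ultimately show ?thesis unfolding semi_improvable_def by blast
qed

lemma meas_semicont: "finite {t. meas d m Q (lnm A B t) < meas d m Q A}"
proof -
  let ?bad = "\<lambda>b. {t. vs.dim (Img d (lnm A B t) b (V d)) < vs.dim (Img d (lnm A B 0) b (V d))} \<union>
    {t. vs.dim (Img d (lnm A B t) b (supp_sp d Q)) < vs.dim (Img d (lnm A B 0) b (supp_sp d Q))} \<union>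
    {t. vs.dim (Img d (lnm (tr A) (tr B) t) b (supp_sp d (- Q))) < vs.dim (Img d (lnm (tr A) (tr B) 0) b (supp_sp d (- Q)))}"
  have "finite (\<Union>b\<in>{..m}. ?bad b)"
    by (intro finite_UN_I finite_UnI dim_semicont) auto
  moreover have "{t. meas d m Q (lnm A B t) < meas d m Q A} \<subseteq> (\<Union>b\<in>{..m}. ?bad b)"
  proof (rule subsetI, rule ccontr)
    fix t assume "t \<in> {t. meas d m Q (lnm A B t) < meas d m Q A}" and n: "t \<notin> (\<Union>b\<in>{..m}. ?bad b)"
    then have lt: "meas d m Q (lnm A B t) < meas d m Q A" by simp
    have "meas d m Q A \<le> meas d m Q (lnm A B t)"
      unfolding meas_def
    proof (rule sum_mono)
      fix b assume "b \<in> {..m}"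
      then show "vs.dim (Img d A b (V d)) + vs.dim (Img d A b (supp_sp d Q)) + vs.dim (Img d (tr A) b (supp_sp d (- Q)))
        \<le> vs.dim (Img d (lnm A B t) b (V d)) + vs.dim (Img d (lnm A B t) b (supp_sp d Q)) +
          vs.dim (Img d (tr (lnm A B t)) b (supp_sp d (- Q)))"
        using n by (auto simp: tr_lnm not_less intro!: add_mono)
    qed
    then show False using lt by simp
  qed
  ultimately show ?thesis by (rule rev_finite_subset)
qed

text \<open>Semicontinuity is applied from two base points: for almost all t no summand of
  \<open>meas\<close> is smaller than at 0 or at t1, so a strict gain seen at t1 persists. Gains on
  the dual side are reached through \<open>improvable_tr\<close>.\<close>

lemma improvableI:
  assumes ok: "\<And>t. ok d m Q (lnm A B t)" and b: "b \<le> m"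
    and gain: "vs.dim (Img d (lnm A B t1) b (V d)) > vs.dim (Img d A b (V d)) \<or>
      vs.dim (Img d (lnm A B t1) b (supp_sp d Q)) > vs.dim (Img d A b (supp_sp d Q))"
  shows "improvable d m Q A"
proof -
  let ?bad = "\<lambda>s b. {t. vs.dim (Img d (lnm A B t) b (V d)) < vs.dim (Img d (lnm A B s) b (V d))} \<union>
    {t. vs.dim (Img d (lnm A B t) b (supp_sp d Q)) < vs.dim (Img d (lnm A B s) b (supp_sp d Q))} \<union>
    {t. vs.dim (Img d (lnm (tr A) (tr B) t) b (supp_sp d (- Q))) < vs.dim (Img d (lnm (tr A) (tr B) s) b (supp_sp d (- Q)))}"
  have "finite (\<Union>s\<in>{0,t1}. \<Union>b\<in>{..m}. ?bad s b)"
    by (intro finite_UN_I finite_UnI dim_semicont) auto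
  moreover have "{t. \<not> meas d m Q A < meas d m Q (lnm A B t)} \<subseteq> (\<Union>s\<in>{0,t1}. \<Union>b\<in>{..m}. ?bad s b)"
  proof (rule subsetI, rule ccontr)
    fix t assume "t \<in> {t. \<not> meas d m Q A < meas d m Q (lnm A B t)}"
      and n: "t \<notin> (\<Union>s\<in>{0,t1}. \<Union>b\<in>{..m}. ?bad s b)"
    then have nlt: "\<not> meas d m Q A < meas d m Q (lnm A B t)" by simp
    have n0: "t \<notin> ?bad s b" if "b \<le> m" "s \<in> {0, t1}" for b s using n that by blast
    have "meas d m Q A < meas d m Q (lnm A B t)"
      unfolding meas_def
    proof (rule sum_strict_mono_ex1)
      show "\<forall>b\<in>{..m}. vs.dim (Img d A b (V d)) + vs.dim (Img d A b (supp_sp d Q)) + vs.dim (Img d (tr A) b (supp_sp d (- Q)))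
        \<le> vs.dim (Img d (lnm A B t) b (V d)) + vs.dim (Img d (lnm A B t) b (supp_sp d Q)) +
          vs.dim (Img d (tr (lnm A B t)) b (supp_sp d (- Q)))"
      proof
        fix b assume "b \<in> {..m}"
        then show "vs.dim (Img d A b (V d)) + vs.dim (Img d A b (supp_sp d Q)) + vs.dim (Img d (tr A) b (supp_sp d (- Q)))
          \<le> vs.dim (Img d (lnm A B t) b (V d)) + vs.dim (Img d (lnm A B t) b (supp_sp d Q)) +
            vs.dim (Img d (tr (lnm A B t)) b (supp_sp d (- Q)))"
          using n0[of b 0] by (auto simp: tr_lnm not_less intro!: add_mono)
      qed
      show "\<exists>b\<in>{..m}. vs.dim (Img d A b (V d)) + vs.dim (Img d A b (supp_sp d Q)) + vs.dim (Img d (tr A) b (supp_sp d (- Q)))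
        < vs.dim (Img d (lnm A B t) b (V d)) + vs.dim (Img d (lnm A B t) b (supp_sp d Q)) +
          vs.dim (Img d (tr (lnm A B t)) b (supp_sp d (- Q)))"
        using n0[OF b, of 0] n0[OF b, of t1] gain b
        by (intro bexI[of _ b]) (auto simp: tr_lnm not_less)
    qed simp
    then show False using nlt by simp
  qed
  ultimately show ?thesis unfolding improvable_def using ok rev_finite_subset by blast
qed

lemma meas_le: "meas d m Q A \<le> (m + 1) * (3 * d)"
proof -
  have le: "vs.dim (Img d A' b X) \<le> d" if "X \<subseteq> V d" for A' :: "nat \<Rightarrow> nat \<Rightarrow> 'a" and b X
    using dim_mono_V[OF Img_V[OF that] order_refl] by (simp add: dim_V)
  have "meas d m Q A \<le> (\<Sum>b\<le>m. 3 * d)"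
    unfolding meas_def
  proof (rule sum_mono)
    fix b
    show "vs.dim (Img d A b (V d)) + vs.dim (Img d A b (supp_sp d Q)) + vs.dim (Img d (tr A) b (supp_sp d (- Q))) \<le> 3 * d"
      using le[where X="V d" and A'=A and b=b] le[where X="supp_sp d Q" and A'=A and b=b]
        le[where X="supp_sp d (- Q)" and A'="tr A" and b=b] by auto
  qed
  then show ?thesis by simp
qed

abbreviation NI :: "nat \<Rightarrow> (nat \<Rightarrow> nat \<Rightarrow> 'k::field) \<Rightarrow> (nat \<Rightarrow> 'k) set \<Rightarrow> (nat \<Rightarrow> 'k) set" where
  "NI d A X \<equiv> app d A ` X"

lemma subspace_NI [intro]: "vs.subspace X \<Longrightarrow> vs.subspace (NI d A X)"
  by (rule subspace_image[OF lin_app])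

lemma NI_V: "NI d A X \<subseteq> V d" using app_V by blast

lemma Kr_mono: "b \<le> b' \<Longrightarrow> Kr d A b X \<subseteq> Kr d A b' X"
proof
  fix v assume "b \<le> b'" "v \<in> Kr d A b X"
  moreover have "(app d A ^^ b') v = (app d A ^^ (b' - b)) ((app d A ^^ b) v)"
    using \<open>b \<le> b'\<close> by (metis comp_apply funpow_add le_add_diff_inverse2)
  ultimately show "v \<in> Kr d A b' X" by (simp add: Kr_def)
qed

lemma apow_stable: "(\<And>v. v \<in> X \<Longrightarrow> app d A v \<in> X) \<Longrightarrow> v \<in> X \<Longrightarrow> (app d A ^^ b) v \<in> X"
  by (induction b) auto

section \<open>Rank one perturbations\<close>

text \<open>In the expanded power, every word in which f is applied to the result of another factor
  vanishes, as f kills \<open>A X\<close> and s; only the word with f applied first survives.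
  \<open>L\<close> is required to have this form on \<open>X\<close> alone because conjugation
  produces it only on \<open>U\<close>.\<close>

lemma rank_one_pow:
  assumes L: "\<And>v. v \<in> X \<Longrightarrow> L v = app d A v + sc (t * ip d f v) s"
    and X: "vs.subspace X" "\<And>v. v \<in> X \<Longrightarrow> app d A v \<in> X" "s \<in> X"
    and f: "\<And>v. v \<in> X \<Longrightarrow> ip d f (app d A v) = 0" "ip d f s = 0"
    and v: "v \<in> X"
  shows "(L ^^ Suc b) v = (app d A ^^ Suc b) v + sc (t * ip d f v) ((app d A ^^ b) s)"
proof (induction b)
  case 0 show ?case using L[OF v] by simp
next
  case (Suc b)
  let ?w = "(app d A ^^ Suc b) v + sc (t * ip d f v) ((app d A ^^ b) s)"
  have wX: "?w \<in> X"
    by (intro vs.subspace_add[OF X(1)] vs.subspace_scale[OF X(1)] apow_stable X(2,3) v)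
  have f1: "ip d f ((app d A ^^ Suc b) v) = 0"
    unfolding funpow.simps comp_apply by (intro f(1) apow_stable X(2) v)
  have f2: "ip d f ((app d A ^^ b) s) = 0"
  proof (cases b)
    case 0 then show ?thesis using f(2) by simp
  next
    case (Suc b')
    show ?thesis unfolding Suc funpow.simps comp_apply by (intro f(1) apow_stable X(2,3))
  qed
  have "ip d f ?w = 0" by (simp only: ip_add ip_sc f1 f2 mult_zero_right add_0_left)
  then have "L ?w = app d A ?w" using L[OF wX] by simp
  then show ?case
    unfolding funpow.simps(2)[of "Suc b" L] funpow.simps(2)[of "Suc b" "app d A"] comp_apply Suc.IH
    by (simp only: app_add app_sc) simp
qed

lemma in_ssum_lineE:
  assumes "w \<in> ssum H (line s)" obtains h c where "h \<in> H" "w = h + sc c s"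
proof -
  from in_ssumE[OF assms] obtain h y where "h \<in> H" "y \<in> line s" "w = h + y" .
  then show ?thesis using that unfolding line_def by auto
qed

text \<open>As f does not vanish at w in the kernel of \<open>P\<close>, the value of
  \<open>P\<close> and the coefficient of z can be adjusted independently, so the new image contains
  the old one and z.\<close>

lemma dim_rank_one:
  assumes X: "vs.subspace X" and P: "lin P" "P ` X \<subseteq> V d" and z: "z \<in> V d" "z \<notin> P ` X"
    and M: "\<And>v. v \<in> X \<Longrightarrow> M v = P v + sc (t * ip d f v) z" and MV: "M ` X \<subseteq> V d"
    and w: "w \<in> X" "P w = 0" "ip d f w \<noteq> 0" and t: "t \<noteq> 0"
  shows "vs.dim (M ` X) > vs.dim (P ` X)"
proof -
  have "ssum (P ` X) (line z) \<subseteq> M ` X"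
  proof
    fix y assume "y \<in> ssum (P ` X) (line z)"
    then obtain p c where "p \<in> P ` X" "y = p + sc c z" by (rule in_ssum_lineE)
    then obtain x where x: "x \<in> X" "y = P x + sc c z" by auto
    \<comment> \<open>Adding this multiple of w leaves \<open>P x\<close> alone and makes the
      coefficient of z equal to c.\<close>
    define l where "l = (c - t * ip d f x) / (t * ip d f w)"
    let ?v = "x + sc l w"
    have vX: "?v \<in> X" using X x w by (intro vs.subspace_add vs.subspace_scale) auto
    have "t * ip d f w \<noteq> 0" using w(3) t by simp
    then have "l * (t * ip d f w) = c - t * ip d f x" unfolding l_def by (rule nonzero_eq_divide_eq[THEN iffD1]) simp
    moreover have "t * ip d f ?v = t * ip d f x + l * (t * ip d f w)"
      unfolding ip_add ip_sc by (simp only: distrib_left mult_ac)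
    ultimately have "t * ip d f ?v = c" by (metis add.commute diff_add_cancel)
    moreover have "P ?v = P x" using w(2) by (simp only: lin_add[OF P(1)] lin_sc[OF P(1)] vs.scale_zero_right add_0_right)
    ultimately have "M ?v = y" using M[OF vX] x(2) by simp
    then show "y \<in> M ` X" using vX by blast
  qed
  then have "vs.dim (ssum (P ` X) (line z)) \<le> vs.dim (M ` X)" using MV by (rule dim_mono_V)
  moreover have "vs.dim (ssum (P ` X) (line z)) = Suc (vs.dim (P ` X))"
    by (rule dim_insert_V[OF subspace_image[OF P(1) X] P(2) z])
  ultimately show ?thesis by simp
qed

text \<open>Levels replace Jordan bases. For nilpotent \<open>A\<close>, the image of
  \<open>ker A^b\<close> in \<open>X / A X\<close> is spanned by the tops of the blocks of size at
  most b, so the level found here is the largest block size that \<open>H\<close> involves modulo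
  \<open>A X\<close>.\<close>

lemma exact_level:
  assumes "H \<subseteq> ssum (NI d A X) (Kr d A k X)" "\<not> H \<subseteq> NI d A X" "0 \<in> X"
  obtains b where "1 \<le> b" "b \<le> k" "H \<subseteq> ssum (NI d A X) (Kr d A b X)"
    "\<not> H \<subseteq> ssum (NI d A X) (Kr d A (b - 1) X)"
proof -
  define b where "b = (LEAST b. H \<subseteq> ssum (NI d A X) (Kr d A b X))"
  have 1: "H \<subseteq> ssum (NI d A X) (Kr d A b X)" unfolding b_def by (rule LeastI) (rule assms(1))
  have 2: "b \<le> k" unfolding b_def by (rule Least_le) (rule assms(1))
  have "ssum (NI d A X) (Kr d A 0 X) = NI d A X"
    using assms(3) by (auto simp: ssum_def Kr_def)
  then have "b \<noteq> 0" using 1 assms(2) by metis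
  then have "\<not> H \<subseteq> ssum (NI d A X) (Kr d A (b - 1) X)"
    using not_less_Least[of "b - 1" "\<lambda>b. H \<subseteq> ssum (NI d A X) (Kr d A b X)"] unfolding b_def[symmetric] by simp
  then show ?thesis using that[of b] 1 2 \<open>b \<noteq> 0\<close> by simp
qed

text \<open>If \<open>A^b s = A^(b+1) v\<close>, then \<open>s - A v\<close> lies in the kernel of
  \<open>A^b\<close>, which makes the level of s too small.\<close>

lemma not_in_image:
  assumes "s \<in> X" "s \<notin> ssum (NI d A X) (Kr d A b X)" "vs.subspace X"
    "\<And>v. v \<in> X \<Longrightarrow> app d A v \<in> X"
  shows "(app d A ^^ b) s \<notin> Img d A (Suc b) X"
proof
  assume "(app d A ^^ b) s \<in> Img d A (Suc b) X"
  then obtain v where v: "v \<in> X" "(app d A ^^ b) s = (app d A ^^ b) (app d A v)"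
    by (auto simp only: funpow_Suc_right comp_apply image_iff)
  have True: "app d A v \<in> X" using v(1) assms(4) by simp
  have "(app d A ^^ b) (s - app d A v) = 0" using v(2) by (simp add: apow_diff)
  then have "s - app d A v \<in> Kr d A b X" using assms(1,3) True by (simp add: Kr_def vs.subspace_diff)
  then have "app d A v + (s - app d A v) \<in> ssum (NI d A X) (Kr d A b X)"
    using v(1) by (intro in_ssumI) auto
  then show False using assms(2) by simp
qed

definition outer :: "(nat \<Rightarrow> 'k::field) \<Rightarrow> (nat \<Rightarrow> 'k) \<Rightarrow> nat \<Rightarrow> nat \<Rightarrow> 'k" where
  "outer s f = (\<lambda>i j. s i * f j)"

lemma tr_outer: "tr (outer s f) = outer f s"
  by (simp add: tr_def outer_def mult.commute)

lemma app_outer: "s \<in> V d \<Longrightarrow> app d (outer s f) v = sc (ip d f v) s"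
proof
  fix i assume s: "s \<in> V d"
  have "(\<Sum>j<d. s i * f j * v j) = (\<Sum>j<d. f j * v j) * s i"
    unfolding sum_distrib_right by (rule sum.cong) (simp_all only: mult_ac)
  then show "app d (outer s f) v i = sc (ip d f v) s i"
    using V_out[OF s, of i] by (simp add: app_def outer_def sc_apply ip_def)
qed

lemma ok_U: "ok d m Q A \<Longrightarrow> u \<in> supp_sp d Q \<Longrightarrow> app d A u \<in> supp_sp d Q"
  by (simp add: ok_def)

lemma ok_nil: "ok d m Q A \<Longrightarrow> v \<in> V d \<Longrightarrow> (app d A ^^ m) v = 0"
  by (simp add: ok_def)

lemma ip_supp_sp: "f \<in> supp_sp d (- Q) \<Longrightarrow> u \<in> supp_sp d Q \<Longrightarrow> ip d f u = 0"
  unfolding perp_supp_sp[symmetric] by (rule perpD)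

lemma NI_Kr: 
  assumes "\<And>v. v \<in> X \<Longrightarrow> app d A v \<in> X" "\<And>v. v \<in> X \<Longrightarrow> (app d A ^^ m) v = 0" "m \<ge> 1"
  shows "NI d A X \<subseteq> Kr d A (m - 1) X"
proof
  fix y assume "y \<in> NI d A X"
  then obtain v where v: "v \<in> X" "y = app d A v" by blast
  have "(app d A ^^ (m - 1)) (app d A v) = (app d A ^^ m) v"
    using assms(3) by (metis Suc_diff_1 comp_apply funpow_Suc_right less_eq_Suc_le One_nat_def)
  then show "y \<in> Kr d A (m - 1) X" using assms(1,2) v by (simp add: Kr_def)
qed

text \<open>The line is \<open>A + t (outer s f)\<close>. As f kills \<open>A V\<close> and s, the
  m-th power changes only by a multiple of \<open>A^(m-1) s = 0\<close>, and the b-th by a multiple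
  of \<open>A^(b-1) s\<close>, which is new to the image. The alternative \<open>sf\<close> is what
  keeps \<open>U\<close> stable.\<close>

lemma improvable_top_rank_one:
  assumes ok: "ok d m Q A" and m: "m \<ge> 1"
    and s: "s \<in> Kr d A (m - 1) (V d)" and f: "f \<in> V d" "\<And>v. v \<in> NI d A (V d) \<Longrightarrow> ip d f v = 0" "ip d f s = 0"
    and sf: "s \<in> supp_sp d Q \<or> f \<in> supp_sp d (- Q)"
    and b: "1 \<le> b" "b \<le> m" and sb: "s \<notin> ssum (NI d A (V d)) (Kr d A (b - 1) (V d))"
    and w: "w \<in> Kr d A b (V d)" "ip d f w \<noteq> 0"
  shows "improvable d m Q A"
proof -
  have sV: "s \<in> V d" using s Kr_sub by blast
  have L: "app d (lnm A (outer s f) t) v = app d A v + sc (t * ip d f v) s" for t v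
    by (simp add: app_lnm app_outer[OF sV])
  have pw: "(app d (lnm A (outer s f) t) ^^ Suc k) v = (app d A ^^ Suc k) v + sc (t * ip d f v) ((app d A ^^ k) s)"
    if "v \<in> V d" for t v k
    by (rule rank_one_pow[of "V d"]) (use that L f sV in auto)
  have "ok d m Q (lnm A (outer s f) t)" for t
    unfolding ok_def
  proof (intro conjI ballI)
    fix u :: "nat \<Rightarrow> 'a" assume u: "u \<in> supp_sp d Q"
    have "sc (t * ip d f u) s \<in> supp_sp d Q"
      using sf
    proof
      assume "s \<in> supp_sp d Q" then show ?thesis by (intro vs.subspace_scale) auto
    next
      assume "f \<in> supp_sp d (- Q)"
      then show ?thesis using ip_supp_sp[OF _ u] by (simp add: vs.subspace_0)
    qed
    then show "app d (lnm A (outer s f) t) u \<in> supp_sp d Q"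
      unfolding L using ok_U[OF ok u] by (intro vs.subspace_add) auto
  next
    fix v :: "nat \<Rightarrow> 'a" assume v: "v \<in> V d"
    have "(app d (lnm A (outer s f) t) ^^ Suc (m - 1)) v = (app d A ^^ Suc (m - 1)) v + sc (t * ip d f v) ((app d A ^^ (m - 1)) s)"
      by (rule pw[OF v])
    moreover have "Suc (m - 1) = m" using m by simp
    moreover have "(app d A ^^ (m - 1)) s = 0" using s by (simp add: Kr_def)
    ultimately show "(app d (lnm A (outer s f) t) ^^ m) v = 0" using ok_nil[OF ok v] by simp
  qed
  moreover have "vs.dim (Img d (lnm A (outer s f) 1) b (V d)) > vs.dim (Img d A b (V d))"
  proof (rule dim_rank_one[where z = "(app d A ^^ (b - 1)) s" and t = 1 and f = f and w = w])
    have bb: "Suc (b - 1) = b" using b by simp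
    show "(app d A ^^ (b - 1)) s \<notin> Img d A b (V d)"
      using not_in_image[OF sV sb] bb by simp
    show "(app d (lnm A (outer s f) 1) ^^ b) v = (app d A ^^ b) v + sc (1 * ip d f v) ((app d A ^^ (b - 1)) s)"
      if "v \<in> V d" for v using pw[OF that, where t=1 and k="b - 1"] bb by simp
  qed (use w sV apow_V Img_V in \<open>auto simp: Kr_def\<close>)
  ultimately show ?thesis using improvableI[OF _ b(2)] by blast
qed

text \<open>The line consists of conjugates: with the rank one operator \<open>H = s \<otimes> f\<close>, \<open>H\<^sup>2 = 0\<close>, it is
  \<open>(1 - t H) A (1 + t H)\<close>.\<close>

lemma improvable_conjugation:
  assumes ok: "ok d m Q A"
    and y: "y \<in> supp_sp d Q" "y = app d A s" "s \<in> V d"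
    and b: "1 \<le> b" "b \<le> m"
    and yb: "y \<notin> ssum (NI d A (supp_sp d Q)) (Kr d A (b - 1) (supp_sp d Q))"
    and w: "w \<in> Kr d A b (supp_sp d Q)" "w \<notin> ssum (NI d A (supp_sp d Q)) (line y)"
  shows "improvable d m Q A"
proof -
  let ?U = "supp_sp d Q :: (nat \<Rightarrow> 'a) set"
  have sU: "vs.subspace ?U" by simp
  have sN: "vs.subspace (NI d A ?U)" by auto
  have NU: "NI d A ?U \<subseteq> ?U" using ok_U[OF ok] by blast
  have yV: "y \<in> V d" using y(2) by simp
  have wU: "w \<in> ?U" using w(1) Kr_sub by blast
  have yN: "y \<notin> NI d A ?U" using yb in_ssumI1[OF _ subspace_Kr[OF sU]] by blast
  then have snU: "s \<notin> ?U" using y(2) by blast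
  let ?H = "ssum (NI d A ?U) (line y)"
  have HU: "?H \<subseteq> ?U" by (rule ssum_least[OF NU line_subset[OF y(1) sU] sU])
  \<comment> \<open>The functional must kill s too, so that the rank one operator squares to zero.
    It can, because s lies outside \<open>U\<close> while \<open>?H\<close> and w lie
    inside.\<close>
  have "w \<notin> ssum ?H (line s)"
  proof
    assume "w \<in> ssum ?H (line s)"
    then obtain h c where h: "h \<in> ?H" "w = h + sc c s" by (rule in_ssum_lineE)
    have "w - h \<in> ?U" using h(1) HU wU by (intro vs.subspace_diff) auto
    then have "sc c s \<in> ?U" using h(2) by simp
    have "c = 0"
    proof (rule ccontr)
      assume "c \<noteq> 0"
      then have "sc (1 / c) (sc c s) = s" by simp
      then show False using vs.subspace_scale[OF sU \<open>sc c s \<in> ?U\<close>, of "1 / c"] snU by simp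
    qed
    then show False using h w(2) by simp
  qed
  moreover have "ssum ?H (line s) \<subseteq> V d"
    by (intro ssum_V[OF subset_trans[OF HU supp_sp_subset_V] line_subset[OF y(3)]]) simp
  moreover have "vs.subspace (ssum ?H (line s))" using sN by auto
  ultimately obtain f where f: "f \<in> V d" "\<And>v. v \<in> ssum ?H (line s) \<Longrightarrow> ip d f v = 0" "ip d f w = 1"
    using separation[of "ssum ?H (line s)" d w] supp_sp_V[OF wU] by blast
  have sH: "vs.subspace ?H" using sN by auto
  have fH: "ip d f v = 0" if "v \<in> ?H" for v using f(2) in_ssumI1[OF that] by blast
  have fs: "ip d f s = 0" using f(2) in_ssumI2[OF self_in_line sH] by blast
  have fy: "ip d f y = 0" using fH in_ssumI2[OF self_in_line sN] by blast
  have fN: "ip d f (app d A u) = 0" if "u \<in> ?U" for u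
    using fH in_ssumI1[of "app d A u" "NI d A ?U" "line y"] that by blast
  \<comment> \<open>The commutator of \<open>A\<close> with \<open>outer s f\<close>, where
    \<open>A s = y\<close>; the term of the conjugation quadratic in t vanishes because f kills
    y.\<close>
  define B where "B = (\<lambda>i j. outer y f i j + (-1) * outer s (app d (tr A) f) i j)"
  have B: "app d B v = sc (ip d f v) y - sc (ip d f (app d A v)) s" for v
    using app_lnm[of d "outer y f" "outer s (app d (tr A) f)" "-1" v]
    unfolding lnm_def B_def[symmetric] app_outer[OF yV] app_outer[OF y(3)] ip_app[symmetric]
    by (simp add: vs.scale_minus_left)
  let ?L = "\<lambda>t. app d (lnm A B t)"
  \<comment> \<open>On \<open>U\<close> the second term disappears, as f kills \<open>A U\<close>.
    There the line is a rank one perturbation in direction y, although s is outside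
    \<open>U\<close>.\<close>
  have LU: "?L t u = app d A u + sc (t * ip d f u) y" if "u \<in> ?U" for t u
    using fN[OF that] by (simp add: app_lnm B)
  define P where "P t v = v + sc (t * ip d f v) s" for t v
  have PV: "P t v \<in> V d" if "v \<in> V d" for t v
    unfolding P_def using that y(3) by (intro vs.subspace_add vs.subspace_scale) auto
  have PP: "P t (P (- t) v) = v" for t v
    unfolding P_def by (simp add: ip_add ip_diff ip_sc fs vs.scale_minus_left)
  have conj: "?L t v = P (- t) (app d A (P t v))" for t v
    unfolding P_def app_add app_sc y(2)[symmetric] ip_add ip_sc fy app_lnm B
    by (simp add: vs.scale_minus_left vs.scale_right_diff_distrib)
  have conjb: "(?L t ^^ k) v = P (- t) ((app d A ^^ k) (P t v))" for t k v
  proof (induction k)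
    case 0 show ?case using PP[of "- t" v] by simp
  next
    case (Suc k)
    then show ?case by (simp add: conj PP)
  qed
  have "ok d m Q (lnm A B t)" for t
    unfolding ok_def
  proof (intro conjI ballI)
    fix u assume u: "u \<in> ?U"
    show "?L t u \<in> ?U" unfolding LU[OF u]
      using ok_U[OF ok u] y(1) by (intro vs.subspace_add vs.subspace_scale) auto
  next
    fix v :: "nat \<Rightarrow> 'a" assume v: "v \<in> V d"
    show "(?L t ^^ m) v = 0"
      unfolding conjb ok_nil[OF ok PV[OF v]] by (simp add: P_def ip_0)
  qed
  moreover have "vs.dim (Img d (lnm A B 1) b ?U) > vs.dim (Img d A b ?U)"
  proof (rule dim_rank_one[where z = "(app d A ^^ (b - 1)) y" and t = 1 and f = f and w = w])
    have bb: "Suc (b - 1) = b" using b by simp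
    show "(app d A ^^ (b - 1)) y \<notin> Img d A b ?U"
      using not_in_image[OF y(1) yb sU] ok_U[OF ok] bb by simp
    have "(?L 1 ^^ Suc (b - 1)) v = (app d A ^^ Suc (b - 1)) v + sc (1 * ip d f v) ((app d A ^^ (b - 1)) y)"
      if "v \<in> ?U" for v
      by (rule rank_one_pow[of ?U]) (use that LU fN fy y(1) ok_U[OF ok] in auto)
    then show "(?L 1 ^^ b) v = (app d A ^^ b) v + sc (1 * ip d f v) ((app d A ^^ (b - 1)) y)"
      if "v \<in> ?U" for v using that bb by simp
    show "Img d A b ?U \<subseteq> V d" "Img d (lnm A B 1) b ?U \<subseteq> V d" by (rule Img_V, simp)+
  qed (use w wU f(3) yV apow_V in \<open>auto simp: Kr_def\<close>)
  ultimately show ?thesis using improvableI[OF _ b(2)] by blast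
qed

section \<open>Operators that resist these two moves\<close>

lemma dim_ssum_line_le:
  assumes "vs.subspace S" "S \<subseteq> V d" "z \<in> V d" shows "vs.dim (ssum S (line z)) \<le> Suc (vs.dim S)"
proof (cases "z \<in> S")
  case True
  have "ssum S (line z) \<subseteq> S" by (rule ssum_least[OF order_refl line_subset[OF True assms(1)] assms(1)])
  then show ?thesis using dim_mono_V[OF _ assms(2)] le_SucI by blast
next
  case False then show ?thesis using dim_insert_V[OF assms False] by simp
qed

lemma V_subspaces [simp]: "Kr d A b (V d) \<subseteq> V d" "Kr d A b (supp_sp d Q) \<subseteq> V d"
  using Kr_sub supp_sp_subset_V by blast+

text \<open>\<open>G\<close> collects what the functional must kill: \<open>A V\<close>, the vector
  s, and also \<open>U\<close> unless s lies in \<open>U\<close>. A vector outside \<open>G\<close>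
  of level at most b then provides the functional.\<close>

lemma improvable_top:
  assumes ok: "ok d m Q A" and m: "m \<ge> 1" and s: "s \<in> Kr d A (m - 1) (V d)"
    and G: "vs.subspace G" "G \<subseteq> V d" "NI d A (V d) \<subseteq> G" "s \<in> G" "s \<in> supp_sp d Q \<or> supp_sp d Q \<subseteq> G"
    and b: "1 \<le> b" "b \<le> m" and sb: "s \<notin> ssum (NI d A (V d)) (Kr d A (b - 1) (V d))"
    and v: "v \<in> ssum (NI d A (V d)) (Kr d A b (V d))" "v \<notin> G"
  shows "improvable d m Q A"
proof -
  have "ssum (NI d A (V d)) (Kr d A b (V d)) \<subseteq> V d" by (intro ssum_V NI_V) simp
  then have vV: "v \<in> V d" using v(1) by blast
  obtain f where f: "f \<in> V d" "\<And>v. v \<in> G \<Longrightarrow> ip d f v = 0" "ip d f v = 1"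
    using separation[OF G(1,2) vV v(2)] by blast
  obtain n w where nw: "n \<in> NI d A (V d)" "w \<in> Kr d A b (V d)" "v = n + w"
    using v(1) by (rule in_ssumE)
  have "ip d f n = 0" using nw(1) G(3) f(2) by blast
  then have fw: "ip d f w \<noteq> 0" using f(3) nw(3) ip_add[of d f n w] by simp
  show ?thesis
  proof (rule improvable_top_rank_one[OF ok m s f(1) _ _ _ b sb nw(2) fw])
    show "ip d f v = 0" if "v \<in> NI d A (V d)" for v using that G(3) f(2) by blast
    show "ip d f s = 0" using G(4) f(2) by blast
    show "s \<in> supp_sp d Q \<or> f \<in> supp_sp d (- Q)"
    proof (cases "s \<in> supp_sp d Q")
      case False
      then have "supp_sp d Q \<subseteq> G" using G(5) by blast
      then have "f \<in> perp d (supp_sp d Q)" using f(1,2) by (intro perpI) blast+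
      then show ?thesis by (simp only: perp_supp_sp) simp
    qed simp
  qed
qed

text \<open>The excess of \<open>ker A^(m-1)\<close> over \<open>A V\<close> counts the short
  blocks. A vector of the highest level is combined with a second, independent one. The stability of
  \<open>U\<close> obstructs this only if there are two short blocks and \<open>U\<close> supplies
  just the one of lower level.\<close>

lemma nongeneric_top:
  assumes ok: "ok d m Q A" and m: "m \<ge> 1"
    and ng: "vs.dim (Kr d A (m - 1) (V d)) \<ge> vs.dim (NI d A (V d)) + 2"
  shows "improvable d m Q A \<or> vs.dim (Kr d A (m - 1) (V d)) = vs.dim (NI d A (V d)) + 2 \<and>
    vs.dim (ssum (Kr d A (m - 1) (supp_sp d Q)) (NI d A (V d))) = vs.dim (NI d A (V d)) + 1"
proof -
  let ?V = "V d :: (nat \<Rightarrow> 'a) set" and ?U = "supp_sp d Q :: (nat \<Rightarrow> 'a) set"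
  let ?N = "NI d A ?V" and ?Vm = "Kr d A (m - 1) ?V" and ?Um = "Kr d A (m - 1) ?U"
  have sN: "vs.subspace ?N" and sVm: "vs.subspace ?Vm" and sUm: "vs.subspace ?Um" by auto
  have NVm: "?N \<subseteq> ?Vm" by (rule NI_Kr[OF _ ok_nil[OF ok] m]) simp_all
  have UmVm: "?Um \<subseteq> ?Vm" unfolding Kr_def using supp_sp_V by blast
  have NV: "?N \<subseteq> ?V" by (rule NI_V)
  have dG: "vs.dim (ssum ?N (line s)) \<le> Suc (vs.dim ?N)" if "s \<in> ?V" for s
    by (rule dim_ssum_line_le[OF sN NV that])
  have "\<not> ?Vm \<subseteq> ?N" using dim_mono_V[of ?Vm ?N d] NV ng by auto
  moreover have "?Vm \<subseteq> ssum ?N ?Vm" using in_ssumI2[OF _ sN] by blast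
  ultimately obtain b where b: "1 \<le> b" "b \<le> m - 1" "?Vm \<subseteq> ssum ?N (Kr d A b ?V)"
    "\<not> ?Vm \<subseteq> ssum ?N (Kr d A (b - 1) ?V)"
    using exact_level[of ?Vm d A ?V "m - 1"] vs.subspace_0[OF subspace_supp_sp[of d UNIV]] by blast
  \<comment> \<open>The quotient \<open>?Vm / H\<close> stands for the short blocks of the maximal
    size b.\<close>
  define H where "H = ssum ?N (Kr d A (b - 1) ?V)"
  have sH: "vs.subspace H" unfolding H_def using sN by auto
  have HVm: "H \<subseteq> ?Vm" unfolding H_def
    by (rule ssum_least[OF NVm Kr_mono sVm]) (use b in simp)
  have NH: "?N \<subseteq> H" unfolding H_def using in_ssumI1 subspace_Kr[OF subspace_supp_sp] by blast
  have VmH: "\<not> ?Vm \<subseteq> H" using b(4) unfolding H_def .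
  have dimH: "vs.dim H < vs.dim ?Vm"
    by (rule dim_psubset_V[OF sH _ _ sVm, where d=d]) (use HVm VmH in auto)
  have bm: "b \<le> m" using b(2) by simp
  show ?thesis
  proof (cases "?Um \<subseteq> H")
    case False
    then obtain s where s: "s \<in> ?Um" "s \<notin> H" by blast
    have sV: "s \<in> ?V" using s(1) UmVm Kr_sub by blast
    have GV: "ssum ?N (line s) \<subseteq> ?V" using NV line_subset[OF sV] by (intro ssum_V) auto
    have "\<not> ?Vm \<subseteq> ssum ?N (line s)" using dim_mono_V[OF _ GV, of ?Vm] dG[OF sV] ng by linarith
    then obtain v where v: "v \<in> ?Vm" "v \<notin> ssum ?N (line s)" by blast
    have "improvable d m Q A"
    proof (rule improvable_top[OF ok m _ _ GV _ _ _ b(1) bm _ _ v(2)])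
      show "s \<in> ?Vm" using s(1) UmVm by blast
      show "vs.subspace (ssum ?N (line s))" using sN by auto
      show "?N \<subseteq> ssum ?N (line s)" using in_ssumI1 by blast
      show "s \<in> ssum ?N (line s)" by (rule in_ssumI2[OF self_in_line sN])
      show "s \<in> ?U \<or> ?U \<subseteq> ssum ?N (line s)" using s(1) Kr_sub by blast
      show "s \<notin> ssum ?N (Kr d A (b - 1) ?V)" using s(2) unfolding H_def .
      show "v \<in> ssum ?N (Kr d A b ?V)" using v(1) b(3) by blast
    qed
    then show ?thesis ..
  next
    case True
    define K where "K = ssum ?Um ?N"
    have sK: "vs.subspace K" unfolding K_def using sUm sN by auto
    have KH: "K \<subseteq> H" unfolding K_def by (rule ssum_least[OF True NH sH])
    have KV: "K \<subseteq> ?V" using KH HVm Kr_sub by blast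
    obtain s where s: "s \<in> ?Vm" "s \<notin> H" using VmH by blast
    have sV: "s \<in> ?V" using s(1) Kr_sub by blast
    show ?thesis
    \<comment> \<open>No vector of the highest level lies in \<open>U\<close>, so the functional has
      to kill \<open>U\<close>. A suitable one exists unless s and \<open>K\<close> together fill
      \<open>?Vm\<close>.\<close>
    proof (cases "?Vm \<subseteq> ssum K (line s)")
      case False
      then obtain v where v: "v \<in> ?Vm" "v \<notin> ssum K (line s)" by blast
      let ?G = "ssum (ssum ?U ?N) (line s)"
      have sUN: "vs.subspace (ssum ?U ?N)" using sN by auto
      have vG: "v \<notin> ?G"
      proof
        assume "v \<in> ?G"
        then obtain g c where g: "g \<in> ssum ?U ?N" "v = g + sc c s" by (rule in_ssum_lineE)
        from g(1) obtain u n where un: "u \<in> ?U" "n \<in> ?N" "g = u + n" by (rule in_ssumE)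
        have "v - n - sc c s \<in> ?Vm"
          using v(1) un(2) NVm s(1) by (intro vs.subspace_diff[OF sVm] vs.subspace_scale[OF sVm]) auto
        moreover have "v - n - sc c s = u" using g(2) un(3) by simp
        ultimately have "u \<in> ?Um" using un(1) by (simp add: Kr_def)
        then have "g \<in> K" unfolding K_def un(3) using un(2) by (rule in_ssumI)
        then have "v \<in> ssum K (line s)" unfolding g(2) by (intro in_ssumI) (auto simp: line_def)
        then show False using v(2) by blast
      qed
      have "improvable d m Q A"
      proof (rule improvable_top[OF ok m s(1) _ _ _ _ _ b(1) bm _ _ vG])
        show "vs.subspace ?G" using sUN by auto
        show "?G \<subseteq> ?V" by (intro ssum_V NV line_subset[OF sV]) auto
        show "?N \<subseteq> ?G" using in_ssumI1[OF in_ssumI2] by blast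
        show "s \<in> ?G" by (rule in_ssumI2[OF self_in_line sUN])
        show "s \<in> ?U \<or> ?U \<subseteq> ?G" using in_ssumI1[OF in_ssumI1[OF _ sN]] by blast
        show "s \<notin> ssum ?N (Kr d A (b - 1) ?V)" using s(2) unfolding H_def .
        show "v \<in> ssum ?N (Kr d A b ?V)" using v(1) b(3) by blast
      qed
      then show ?thesis ..
    next
      case 3: True
      have "ssum K (line s) \<subseteq> ?V" by (intro ssum_V KV line_subset[OF sV]) simp
      then have "vs.dim ?Vm \<le> vs.dim (ssum K (line s))" using dim_mono_V[OF 3] by blast
      also have "\<dots> \<le> Suc (vs.dim K)" by (rule dim_ssum_line_le[OF sK KV sV])
      finally have VK: "vs.dim ?Vm \<le> Suc (vs.dim K)" .
      have HV: "H \<subseteq> ?V" using HVm Kr_sub by blast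
      \<comment> \<open>s accounts for the only short block of size b, and the rest,
        \<open>H\<close>, comes from \<open>U\<close> modulo \<open>A V\<close>. The argument is
        repeated inside \<open>H\<close>, now with a vector r of \<open>U\<close> of the highest
        level there.\<close>
      have KHeq: "K = H" by (rule dim_eq_V[OF sK KH HV sH]) (use VK dimH in simp)
      have dVm: "vs.dim ?Vm = Suc (vs.dim H)" using VK dimH KHeq by simp
      have "\<not> H \<subseteq> ?N" using dim_mono_V[OF _ NV, of H] dVm ng by linarith
      moreover have "H \<subseteq> ssum ?N (Kr d A (b - 1) ?V)" unfolding H_def by simp
      ultimately obtain b' where b': "1 \<le> b'" "b' \<le> b - 1" "H \<subseteq> ssum ?N (Kr d A b' ?V)"
        "\<not> H \<subseteq> ssum ?N (Kr d A (b' - 1) ?V)"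
        using exact_level[of H d A ?V "b - 1"] vs.subspace_0[OF subspace_supp_sp[of d UNIV]] by blast
      let ?H1 = "ssum ?N (Kr d A (b' - 1) ?V)"
      have "\<not> ?Um \<subseteq> ?H1"
      proof
        assume a: "?Um \<subseteq> ?H1"
        have "?N \<subseteq> ?H1" using in_ssumI1 subspace_Kr[OF subspace_supp_sp] by blast
        with a have "K \<subseteq> ?H1" unfolding K_def
          by (rule ssum_least) (use sN in auto)
        then show False using b'(4) KHeq by blast
      qed
      then obtain r where r: "r \<in> ?Um" "r \<notin> ?H1" by blast
      have rV: "r \<in> ?V" using r(1) UmVm Kr_sub by blast
      have GV: "ssum ?N (line r) \<subseteq> ?V" using NV line_subset[OF rV] by (intro ssum_V) auto
      show ?thesis
      proof (cases "H \<subseteq> ssum ?N (line r)")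
        case False
        then obtain v where v: "v \<in> H" "v \<notin> ssum ?N (line r)" by blast
        have "improvable d m Q A"
        proof (rule improvable_top[OF ok m _ _ GV _ _ _ b'(1) _ r(2) _ v(2)])
          show "r \<in> ?Vm" using r(1) UmVm by blast
          show "vs.subspace (ssum ?N (line r))" using sN by auto
          show "?N \<subseteq> ssum ?N (line r)" using in_ssumI1 by blast
          show "r \<in> ssum ?N (line r)" by (rule in_ssumI2[OF self_in_line sN])
          show "r \<in> ?U \<or> ?U \<subseteq> ssum ?N (line r)" using r(1) Kr_sub by blast
          show "v \<in> ssum ?N (Kr d A b' ?V)" using v(1) b'(3) by blast
          show "b' \<le> m" using b'(2) bm by simp
        qed
        then show ?thesis ..
      next
        case True
        have "vs.dim H \<le> Suc (vs.dim ?N)"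
          using dim_mono_V[OF True GV] dG[OF rV] by simp
        then have "vs.dim H = vs.dim ?N + 1" using dVm ng by simp
        then show ?thesis using dVm KHeq unfolding K_def by simp
      qed
    qed
  qed
qed

text \<open>Take y in \<open>T\<close> of exact level b. Conjugation fails only if
  \<open>ker A^b\<close> on \<open>U\<close> lies in \<open>A U\<close> plus the line of y. Then
  \<open>T\<close> lies between \<open>A U\<close> and that sum, and y is not in \<open>A U\<close>,
  so the excess is one dimension.\<close>

lemma image_meets_subspace:
  assumes ok: "ok d m Q A" and m: "m \<ge> 1"
    and T: "T = supp_sp d Q \<inter> NI d A (V d)"
  shows "T = NI d A (supp_sp d Q) \<or> improvable d m Q A \<or>
    (\<exists>b. 1 \<le> b \<and> b \<le> m - 1 \<and> T = ssum (NI d A (supp_sp d Q)) (Kr d A b (supp_sp d Q)) \<and>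
      \<not> T \<subseteq> ssum (NI d A (supp_sp d Q)) (Kr d A (b - 1) (supp_sp d Q)) \<and>
      vs.dim T = vs.dim (NI d A (supp_sp d Q)) + 1)"
proof -
  let ?V = "V d :: (nat \<Rightarrow> 'a) set" and ?U = "supp_sp d Q :: (nat \<Rightarrow> 'a) set"
  let ?N = "NI d A ?U" and ?Um = "Kr d A (m - 1) ?U"
  have sN: "vs.subspace ?N" and sT: "vs.subspace T" unfolding T by (auto intro: subspace_inter')
  have NV: "?N \<subseteq> V d" by (rule NI_V)
  have "NI d A ?V \<subseteq> Kr d A (m - 1) ?V" by (rule NI_Kr[OF _ ok_nil[OF ok] m]) simp_all
  then have TUm: "T \<subseteq> ?Um" unfolding T Kr_def by blast
  have NT: "?N \<subseteq> T" unfolding T using ok_U[OF ok] supp_sp_V by blast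
  have TV: "T \<subseteq> ?V" unfolding T using supp_sp_subset_V by blast
  show ?thesis
  proof (cases "T \<subseteq> ?N")
    case True then show ?thesis using NT by blast
  next
    case False
    moreover have "T \<subseteq> ssum ?N ?Um" using TUm in_ssumI2[OF _ sN] by blast
    ultimately obtain b where b: "1 \<le> b" "b \<le> m - 1" "T \<subseteq> ssum ?N (Kr d A b ?U)"
      "\<not> T \<subseteq> ssum ?N (Kr d A (b - 1) ?U)"
      using exact_level[of T d A ?U "m - 1"] vs.subspace_0[OF subspace_supp_sp[of d Q]] by blast
    obtain y where y: "y \<in> T" "y \<notin> ssum ?N (Kr d A (b - 1) ?U)" using b(4) by blast
    obtain s where s: "s \<in> ?V" "y = app d A s" using y(1) unfolding T by blast
    have yU: "y \<in> ?U" using y(1) unfolding T by blast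
    have yN: "y \<notin> ?N" using y(2) in_ssumI1[OF _ subspace_Kr[OF subspace_supp_sp]] by blast
    show ?thesis
    proof (cases "Kr d A b ?U \<subseteq> ssum ?N (line y)")
      case False
      then obtain w where "w \<in> Kr d A b ?U" "w \<notin> ssum ?N (line y)" by blast
      then have "improvable d m Q A"
        using improvable_conjugation[OF ok yU s(2,1) b(1) _ y(2)] b(2) by simp
      then show ?thesis by blast
    next
      case True
      have NNy: "?N \<subseteq> ssum ?N (line y)" using in_ssumI1 by blast
      have sNy: "vs.subspace (ssum ?N (line y))" using sN by auto
      have 1: "ssum ?N (Kr d A b ?U) \<subseteq> ssum ?N (line y)" by (rule ssum_least[OF NNy True sNy])
      have 2: "ssum ?N (line y) \<subseteq> T" by (rule ssum_least[OF NT line_subset[OF y(1) sT] sT])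
      have Teq: "T = ssum ?N (Kr d A b ?U)" "T = ssum ?N (line y)" using 1 2 b(3) by blast+
      have "vs.dim (ssum ?N (line y)) = Suc (vs.dim ?N)"
        by (rule dim_insert_V[OF sN NV _ yN]) (use y(1) TV in blast)
      then show ?thesis using b Teq by auto
    qed
  qed
qed

text \<open>The projection of \<open>A^b V\<close> to \<open>V / U\<close> has kernel
  \<open>U\<close> intersected with \<open>A^b V\<close>, and its image is that of the power induced
  on \<open>V / U\<close>, which has the rank of its transpose.\<close>

lemma dim_Img_star:
  assumes ok: "ok d m Q A"
  shows "vs.dim (Img d A b (V d)) = vs.dim (supp_sp d Q \<inter> Img d A b (V d)) + vs.dim (Img d (tr A) b (supp_sp d (- Q)))"
proof -
  let ?V = "V d :: (nat \<Rightarrow> 'a) set" and ?U = "supp_sp d Q :: (nat \<Rightarrow> 'a) set" and ?U' = "supp_sp d (- Q) :: (nat \<Rightarrow> 'a) set"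
  let ?I = "Img d A b ?V"
  have sI: "vs.subspace ?I" by auto
  have IV: "?I \<subseteq> ?V" by (rule Img_V) simp
  have "Kr d (tr A) b ?U' = ?U' \<inter> Kr d (tr A) b ?V" unfolding Kr_def using supp_sp_V by blast
  also have "\<dots> = perp d ?U \<inter> perp d ?I" by (simp only: Kr_tr perp_supp_sp)
  also have "\<dots> = perp d (ssum ?U ?I)" using perp_ssum[OF _ sI] by simp
  finally have K: "Kr d (tr A) b ?U' = perp d (ssum ?U ?I)" .
  have "vs.dim (perp d (ssum ?U ?I)) + vs.dim (ssum ?U ?I) = d"
    by (rule dim_perp[OF subspace_ssum[OF subspace_supp_sp sI] ssum_V[OF supp_sp_subset_V IV]])
  moreover have "vs.dim ?U' = vs.dim (Kr d (tr A) b ?U') + vs.dim (Img d (tr A) b ?U')" by (rule dim_Kr_Img) auto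
  moreover have "vs.dim (perp d ?U) + vs.dim ?U = d" by (rule dim_perp) auto
  moreover have "vs.dim (ssum ?U ?I) + vs.dim (?U \<inter> ?I) = vs.dim ?U + vs.dim ?I"
    by (rule dim_ssum[OF subspace_supp_sp supp_sp_subset_V sI IV])
  ultimately show ?thesis unfolding K perp_supp_sp by linarith
qed

section \<open>Perturbations of the off-diagonal block\<close>

text \<open>The derivative of \<open>t \<mapsto> (A + t B)\<^sup>b\<close>, exact because the off-diagonal blocks form an ideal of square zero.\<close>

primrec fib :: "nat \<Rightarrow> (nat \<Rightarrow> nat \<Rightarrow> 'k::field) \<Rightarrow> (nat \<Rightarrow> nat \<Rightarrow> 'k) \<Rightarrow> nat \<Rightarrow> (nat \<Rightarrow> 'k) \<Rightarrow> nat \<Rightarrow> 'k" where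
  "fib d A B 0 v = 0"
| "fib d A B (Suc b) v = app d A (fib d A B b v) + app d B ((app d A ^^ b) v)"

lemma lnm_pow_fib:
  assumes ok: "ok d m Q A" and BV: "\<And>v. app d B v \<in> supp_sp d Q" and BU: "\<And>u. u \<in> supp_sp d Q \<Longrightarrow> app d B u = 0"
  shows "(app d (lnm A B t) ^^ b) v = (app d A ^^ b) v + sc t (fib d A B b v)"
proof (induction b)
  case 0 show ?case by simp
next
  case (Suc b)
  have fU: "fib d A B b v \<in> supp_sp d Q" for b
    by (induction b) (auto intro!: vs.subspace_add BV ok_U[OF ok] vs.subspace_0)
  have "(app d (lnm A B t) ^^ Suc b) v = app d (lnm A B t) ((app d A ^^ b) v + sc t (fib d A B b v))"
    unfolding funpow.simps(2)[of b "app d (lnm A B t)"] comp_apply Suc.IH ..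
  also have "\<dots> = app d A ((app d A ^^ b) v + sc t (fib d A B b v)) +
      sc t (app d B ((app d A ^^ b) v + sc t (fib d A B b v)))"
    by (rule app_lnm)
  also have "\<dots> = (app d A ^^ Suc b) v + sc t (fib d A B (Suc b) v)"
    unfolding app_add app_sc BU[OF fU]
    by (simp add: vs.scale_right_distrib add.assoc)
  finally show ?case .
qed

lemma ok_line:
  assumes ok: "ok d m Q A" and BV: "\<And>v. app d B v \<in> supp_sp d Q" and BU: "\<And>u. u \<in> supp_sp d Q \<Longrightarrow> app d B u = 0"
    and f: "\<And>v. v \<in> V d \<Longrightarrow> fib d A B m v = 0"
  shows "ok d m Q (lnm A B t)"
  using ok_U[OF ok] ok_nil[OF ok] BU f
  by (simp add: ok_def lnm_pow_fib[OF ok BV BU]) (simp add: app_lnm)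

text \<open>The difference of the two operators is off-diagonal, and once the diagonal blocks are
  fixed the remaining relation is affine in the off-diagonal one. Hence the whole line through two
  admissible points is admissible, and one better point on it suffices.\<close>

lemma improvable_fixing_blocks:
  assumes ok: "ok d m Q A" and ok': "ok d m Q A'"
    and U: "\<And>u. u \<in> supp_sp d Q \<Longrightarrow> app d A' u = app d A u"
    and U': "\<And>f. f \<in> supp_sp d (- Q) \<Longrightarrow> app d (tr A') f = app d (tr A) f"
    and b: "b \<le> m" "vs.dim (Img d A' b (V d)) > vs.dim (Img d A b (V d))"
  shows "improvable d m Q A"
proof -
  define B where "B = (\<lambda>i j. A' i j - A i j)"
  have A': "lnm A B 1 = A'" by (simp add: lnm_def B_def)
  have B: "app d B v = app d A' v - app d A v" for v
    using app_lnm[of d A B 1 v] unfolding A' by simp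
  have BU: "app d B u = 0" if "u \<in> supp_sp d Q" for u using U[OF that] B by simp
  have BV: "app d B v \<in> supp_sp d Q" for v
  proof -
    have "ip d g (app d B v) = 0" if "g \<in> supp_sp d (- Q)" for g
      unfolding B ip_diff ip_app U'[OF that] by simp
    then have "app d B v \<in> perp d (supp_sp d (- Q))" by (intro perpI) (simp_all add: ip_commute[of d "app d B v"])
    then show ?thesis by (simp only: perp_supp_sp double_complement)
  qed
  have "fib d A B m v = 0" if "v \<in> V d" for v
    using lnm_pow_fib[OF ok BV BU, where t=1 and b=m and v=v] ok_nil[OF ok that] ok_nil[OF ok' that] A' by simp
  note fz = this
  have "ok d m Q (lnm A B t)" for t by (rule ok_line[OF ok BV BU fz])
  then show ?thesis using improvableI[OF _ b(1), of d Q A B 1] b(2) A' by simp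
qed

text \<open>The product rule: \<open>outer s f\<close> replaces one factor of \<open>A^b\<close>;
  the factors applied before it act on f by transposition, those applied after it act on s.\<close>

lemma fib_outer:
  assumes ok: "ok d m Q A" and s: "s \<in> supp_sp d Q"
  shows "fib d A (outer s f) b v = (\<Sum>c<b. sc (ip d ((app d (tr A) ^^ c) f) v) ((app d A ^^ (b - 1 - c)) s))"
proof (induction b)
  case 0 show ?case by simp
next
  case (Suc b)
  have "app d A (\<Sum>c<b. sc (ip d ((app d (tr A) ^^ c) f) v) ((app d A ^^ (b - 1 - c)) s)) =
    (\<Sum>c<b. sc (ip d ((app d (tr A) ^^ c) f) v) ((app d A ^^ (Suc b - 1 - c)) s))"
    unfolding app_sum
  proof (rule sum.cong[OF refl])
    fix c assume "c \<in> {..<b}"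
    then have "Suc b - 1 - c = Suc (b - 1 - c)" by auto
    then show "app d A (sc (ip d ((app d (tr A) ^^ c) f) v) ((app d A ^^ (b - 1 - c)) s)) =
      sc (ip d ((app d (tr A) ^^ c) f) v) ((app d A ^^ (Suc b - 1 - c)) s)"
      by (simp only: app_sc funpow.simps comp_apply)
  qed
  moreover have "app d (outer s f) ((app d A ^^ b) v) = sc (ip d ((app d (tr A) ^^ b) f) v) s"
    using supp_sp_V[OF s] by (simp add: app_outer ip_apow)
  ultimately show ?case by (simp add: Suc.IH)
qed

text \<open>The exponents c on f and m - 1 - c on s add up to less than h + e, so every term of the
  derivative of \<open>A^m\<close> has a vanishing factor. If h + e = m, the derivative of
  \<open>A^(m-1)\<close> keeps just the term c = e - 1 and thus is a single rank one
  operator.\<close>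

lemma outer_move:
  assumes ok: "ok d m Q A" and s: "s \<in> Kr d A h (supp_sp d Q)" and f: "f \<in> Kr d (tr A) e (supp_sp d (- Q))"
    and he: "h + e \<le> m"
  shows "ok d m Q (lnm A (outer s f) t)"
    and "u \<in> supp_sp d Q \<Longrightarrow> app d (lnm A (outer s f) t) u = app d A u"
    and "g \<in> supp_sp d (- Q) \<Longrightarrow> app d (tr (lnm A (outer s f) t)) g = app d (tr A) g"
    and "\<lbrakk>h + e = m; h \<ge> 1; e \<ge> 1\<rbrakk> \<Longrightarrow> (app d (lnm A (outer s f) t) ^^ (m - 1)) v =
      (app d A ^^ (m - 1)) v + sc (t * ip d ((app d (tr A) ^^ (e - 1)) f) v) ((app d A ^^ (h - 1)) s)"
proof -
  have sU: "s \<in> supp_sp d Q" and fU: "f \<in> supp_sp d (- Q)" using s f Kr_sub by blast+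
  have sV: "s \<in> V d" and fV: "f \<in> V d" using sU fU supp_sp_V by blast+
  have BV: "app d (outer s f) v \<in> supp_sp d Q" for v
    unfolding app_outer[OF sV] using sU by (intro vs.subspace_scale) auto
  have BU: "app d (outer s f) u = 0" if "u \<in> supp_sp d Q" for u
    unfolding app_outer[OF sV] using ip_supp_sp[OF fU that] by simp
  have s0: "(app d A ^^ k) s = 0" if "k \<ge> h" for k using s Kr_mono[OF that] unfolding Kr_def by blast
  have f0: "(app d (tr A) ^^ k) f = 0" if "k \<ge> e" for k using f Kr_mono[OF that] unfolding Kr_def by blast
  have z: "sc (ip d ((app d (tr A) ^^ c) f) v) ((app d A ^^ k) s) = 0" if "c \<ge> e \<or> k \<ge> h" for c k v
    using that s0[of k] f0[of c] by (auto simp: ip_0' vs.scale_zero_right)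
  have fz: "fib d A (outer s f) m v = 0" for v
    unfolding fib_outer[OF ok sU]
  proof (rule sum.neutral, rule ballI)
    fix c assume "c \<in> {..<m}"
    then have "c \<ge> e \<or> m - 1 - c \<ge> h" using he by auto
    then show "sc (ip d ((app d (tr A) ^^ c) f) v) ((app d A ^^ (m - 1 - c)) s) = 0" by (rule z)
  qed
  show "ok d m Q (lnm A (outer s f) t)" by (rule ok_line[OF ok BV BU fz])
  show "u \<in> supp_sp d Q \<Longrightarrow> app d (lnm A (outer s f) t) u = app d A u" by (simp add: app_lnm BU)
  show "g \<in> supp_sp d (- Q) \<Longrightarrow> app d (tr (lnm A (outer s f) t)) g = app d (tr A) g"
    using ip_supp_sp[of s d "- (- Q)" g] sU ip_supp_sp[of g d Q s]
    by (simp add: tr_lnm tr_outer app_lnm app_outer[OF fV] ip_commute[of d s])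
  assume he': "h + e = m" "h \<ge> 1" "e \<ge> 1"
  have "fib d A (outer s f) (m - 1) v = (\<Sum>c<m - 1. if c = e - 1 then
      sc (ip d ((app d (tr A) ^^ (e - 1)) f) v) ((app d A ^^ (h - 1)) s) else 0)"
    unfolding fib_outer[OF ok sU]
  proof (rule sum.cong[OF refl])
    fix c assume c: "c \<in> {..<m - 1}"
    have "m - 1 - 1 - (e - 1) = h - 1" using he' by simp
    moreover have "c \<ge> e \<or> m - 1 - 1 - c \<ge> h" if "c \<noteq> e - 1" using that he' c by auto
    ultimately show "sc (ip d ((app d (tr A) ^^ c) f) v) ((app d A ^^ (m - 1 - 1 - c)) s) = (if c = e - 1 then
      sc (ip d ((app d (tr A) ^^ (e - 1)) f) v) ((app d A ^^ (h - 1)) s) else 0)"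
      using z[of c "m - 1 - 1 - c" v] by auto
  qed
  also have "\<dots> = sc (ip d ((app d (tr A) ^^ (e - 1)) f) v) ((app d A ^^ (h - 1)) s)"
    using he' by simp
  finally show "(app d (lnm A (outer s f) t) ^^ (m - 1)) v =
      (app d A ^^ (m - 1)) v + sc (t * ip d ((app d (tr A) ^^ (e - 1)) f) v) ((app d A ^^ (h - 1)) s)"
    by (simp add: lnm_pow_fib[OF ok BV BU])
qed

section \<open>Points that are not generic\<close>

text \<open>The split representation, the direct sum of \<open>U\<close> and \<open>V / U\<close>.
  Ranks of its powers are sums over the two diagonal blocks, which makes it the natural origin for
  off-diagonal moves.\<close>

definition blk :: "nat set \<Rightarrow> (nat \<Rightarrow> nat \<Rightarrow> 'k::field) \<Rightarrow> nat \<Rightarrow> nat \<Rightarrow> 'k" where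
  "blk Q A = (\<lambda>i j. if (i \<in> Q) = (j \<in> Q) then A i j else 0)"

lemma tr_blk: "tr (blk Q A) = blk (- Q) (tr A)"
  by (auto simp: tr_def blk_def fun_eq_iff)

lemma blk_compl: "blk (- Q) A = blk Q A"
  by (auto simp: blk_def fun_eq_iff)

lemma supp_sp_out: "v \<in> supp_sp d Q \<Longrightarrow> i \<notin> Q \<Longrightarrow> v i = 0"
  unfolding supp_sp_def by blast

lemma supp_sp_disjoint: assumes "v \<in> supp_sp d Q" "v \<in> supp_sp d (- Q)" shows "v = 0"
proof
  fix i show "v i = 0 i"
    using supp_sp_out[OF assms(1), of i] supp_sp_out[OF assms(2), of i] by (auto simp: zero_fun_apply)
qed

lemma blk_stable: "v \<in> supp_sp d Q \<Longrightarrow> app d (blk Q A) v \<in> supp_sp d Q"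
proof -
  assume v: "v \<in> supp_sp d Q"
  have "app d (blk Q A) v i = 0" if "i \<notin> Q" for i
    unfolding app_def blk_def using v that by (auto simp: supp_sp_def intro!: sum.neutral)
  then show ?thesis using V_out[OF app_V] unfolding supp_sp_def by blast
qed

lemma app_blk:
  assumes ok: "ok d m Q A" and u: "u \<in> supp_sp d Q" shows "app d (blk Q A) u = app d A u"
proof
  fix i
  show "app d (blk Q A) u i = app d A u i"
  proof (cases "i \<in> Q")
    case True
    have e: "(if (i \<in> Q) = (j \<in> Q) then A i j else 0) * u j = A i j * u j" for j
      using u True by (auto simp: supp_sp_def)
    show ?thesis unfolding app_def blk_def e ..
  next
    case False
    then show ?thesis using supp_sp_out[OF blk_stable[OF u]] supp_sp_out[OF ok_U[OF ok u]] by simp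
  qed
qed

lemma apow_cong:
  assumes "\<And>u. u \<in> X \<Longrightarrow> app d A u = app d A' u" "\<And>u. u \<in> X \<Longrightarrow> app d A u \<in> X" "u \<in> X"
  shows "(app d A ^^ b) u = (app d A' ^^ b) u"
proof (induction b)
  case (Suc b)
  have "(app d A ^^ b) u \<in> X" using assms(2,3) by (rule apow_stable)
  then show ?case using assms(1) Suc.IH by simp
qed simp

lemma split_Q:
  assumes "v \<in> V d" obtains p q where "p \<in> supp_sp d Q" "q \<in> supp_sp d (- Q)" "v = p + q"
proof -
  have "v = (\<lambda>i. if i \<in> Q then v i else 0) + (\<lambda>i. if i \<in> Q then 0 else v i)"
    by (simp add: fun_eq_iff plus_fun_apply)
  moreover have "(\<lambda>i. if i \<in> Q then v i else 0) \<in> supp_sp d Q" "(\<lambda>i. if i \<in> Q then 0 else v i) \<in> supp_sp d (- Q)"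
    using assms unfolding supp_sp_def by auto
  ultimately show ?thesis using that by blast
qed

lemma ip_nondeg: assumes "v \<in> V d" "\<And>g. g \<in> V d \<Longrightarrow> ip d g v = 0" shows "v = 0"
proof
  fix i show "v i = 0 i"
  proof (cases "i < d")
    case True
    have "ip d v (unitv i) = 0" unfolding ip_commute[of d v] using unitv_supp_sp[OF True] by (intro assms(2)) auto
    then show ?thesis using ip_unitv[OF True] by (metis zero_fun_apply)
  next
    case False then show ?thesis using V_out[OF assms(1) False] by (simp add: zero_fun_apply)
  qed
qed

lemma ok_blk: assumes ok: "ok d m Q A" shows "ok d m Q (blk Q A)"
  unfolding ok_def
proof (intro conjI ballI)
  fix v :: "nat \<Rightarrow> 'a" assume v: "v \<in> V d"
  obtain p q where pq: "p \<in> supp_sp d Q" "q \<in> supp_sp d (- Q)" "v = p + q" using split_Q[OF v] by blast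
  have "(app d (blk Q A) ^^ m) p = (app d A ^^ m) p"
    by (rule apow_cong[OF app_blk[OF ok] blk_stable pq(1)])
  then have p0: "(app d (blk Q A) ^^ m) p = 0" using ok_nil[OF ok] supp_sp_V[OF pq(1)] by simp
  have q0: "(app d (blk Q A) ^^ m) q = 0"
  proof (rule ip_nondeg)
    show "(app d (blk Q A) ^^ m) q \<in> V d" using supp_sp_V[OF pq(2)] by (rule apow_V)
    fix g :: "nat \<Rightarrow> 'a" assume "g \<in> V d"
    then obtain g1 g2 where g: "g1 \<in> supp_sp d Q" "g2 \<in> supp_sp d (- Q)" "g = g1 + g2" using split_Q by blast
    have "(app d (tr (blk Q A)) ^^ m) g2 = (app d (tr A) ^^ m) g2" unfolding tr_blk
      by (rule apow_cong[OF app_blk[OF ok_tr[OF ok]] blk_stable g(2)])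
    then have "ip d ((app d (tr (blk Q A)) ^^ m) g2) q = 0"
      using ok_nil[OF ok_tr[OF ok]] supp_sp_V[OF g(2)] by (simp add: ip_0')
    moreover have "(app d (tr (blk Q A)) ^^ m) g1 \<in> supp_sp d Q"
      unfolding tr_blk blk_compl using blk_stable g(1) by (rule apow_stable)
    then have "ip d ((app d (tr (blk Q A)) ^^ m) g1) q = 0"
      using ip_supp_sp[OF pq(2)] by (simp add: ip_commute[of d _ q])
    ultimately show "ip d g ((app d (blk Q A) ^^ m) q) = 0"
      unfolding g(3) ip_apow apow_add ip_add' by simp
  qed
  show "(app d (blk Q A) ^^ m) v = 0" unfolding pq(3) apow_add p0 q0 by simp
qed (rule blk_stable)

lemma apow_blk:
  assumes "ok d m Q A" "u \<in> supp_sp d Q" shows "(app d (blk Q A) ^^ b) u = (app d A ^^ b) u"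
  by (rule apow_cong[OF app_blk[OF assms(1)] blk_stable assms(2)])

lemma Img_blk:
  assumes ok: "ok d m Q A" shows "supp_sp d Q \<inter> Img d (blk Q A) b (V d) = Img d A b (supp_sp d Q)"
proof
  show "Img d A b (supp_sp d Q) \<subseteq> supp_sp d Q \<inter> Img d (blk Q A) b (V d)"
  proof
    fix y assume "y \<in> Img d A b (supp_sp d Q)"
    then obtain u where u: "u \<in> supp_sp d Q" "y = (app d A ^^ b) u" by blast
    have "y \<in> supp_sp d Q" unfolding u(2) using ok_U[OF ok] u(1) by (rule apow_stable)
    moreover have "y \<in> Img d (blk Q A) b (V d)"
      using u supp_sp_V[OF u(1)] apow_blk[OF ok u(1)] by (metis imageI)
    ultimately show "y \<in> supp_sp d Q \<inter> Img d (blk Q A) b (V d)" by blast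
  qed
  show "supp_sp d Q \<inter> Img d (blk Q A) b (V d) \<subseteq> Img d A b (supp_sp d Q)"
  proof
    fix y assume y: "y \<in> supp_sp d Q \<inter> Img d (blk Q A) b (V d)"
    then obtain v where v: "v \<in> V d" "y = (app d (blk Q A) ^^ b) v" by blast
    obtain p q where pq: "p \<in> supp_sp d Q" "q \<in> supp_sp d (- Q)" "v = p + q" using split_Q[OF v(1)] by blast
    have p: "(app d (blk Q A) ^^ b) p \<in> supp_sp d Q" using blk_stable pq(1) by (rule apow_stable)
    have q: "(app d (blk Q A) ^^ b) q \<in> supp_sp d (- Q)"
      using blk_stable[where Q="- Q" and A=A and d=d, unfolded blk_compl] pq(2) by (rule apow_stable)
    have eq: "y - (app d (blk Q A) ^^ b) p = (app d (blk Q A) ^^ b) q" unfolding v(2) pq(3) apow_add by simp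
    have "y - (app d (blk Q A) ^^ b) p \<in> supp_sp d Q" using y p by (intro vs.subspace_diff) auto
    then have "(app d (blk Q A) ^^ b) q = 0" using q unfolding eq by (rule supp_sp_disjoint)
    then have "y = (app d A ^^ b) p" using eq apow_blk[OF ok pq(1)] by simp
    then show "y \<in> Img d A b (supp_sp d Q)" using pq(1) by blast
  qed
qed

lemma dim_Img_blk:
  assumes ok: "ok d m Q A"
  shows "vs.dim (Img d (blk Q A) b (V d)) = vs.dim (Img d A b (supp_sp d Q)) + vs.dim (Img d (tr A) b (supp_sp d (- Q)))"
proof -
  have "Img d (tr (blk Q A)) b (supp_sp d (- Q)) = Img d (tr A) b (supp_sp d (- Q))"
    unfolding tr_blk by (rule image_cong[OF refl]) (rule apow_blk[OF ok_tr[OF ok]])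
  then show ?thesis using dim_Img_star[OF ok_blk[OF ok], of b] Img_blk[OF ok] by simp
qed

lemma Img_antimono:
  assumes "\<And>v. v \<in> X \<Longrightarrow> app d A v \<in> X" "b \<le> b'" shows "Img d A b' X \<subseteq> Img d A b X"
proof
  fix y assume "y \<in> Img d A b' X"
  then obtain v where v: "v \<in> X" "y = (app d A ^^ b') v" by blast
  have "y = (app d A ^^ b) ((app d A ^^ (b' - b)) v)"
    using assms(2) v(2) by (metis comp_apply funpow_add le_add_diff_inverse)
  moreover have "(app d A ^^ (b' - b)) v \<in> X" using assms(1) v(1) by (rule apow_stable)
  ultimately show "y \<in> Img d A b X" by blast
qed

text \<open>\<open>dim_rank_one\<close> with its hypothesis dualised: the annihilator of
  \<open>ker A^b\<close> is the image of the transposed power, so \<phi> outside that image is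
  nonzero somewhere on the kernel.\<close>

lemma outer_gain:
  assumes A': "\<And>v. v \<in> V d \<Longrightarrow> (app d A' ^^ b) v = (app d A ^^ b) v + sc (1 * ip d \<phi> v) z"
    and z: "z \<in> V d" "z \<notin> Img d A b (V d)" and \<phi>: "\<phi> \<in> V d" "\<phi> \<notin> Img d (tr A) b (V d)"
  shows "vs.dim (Img d A' b (V d)) > vs.dim (Img d A b (V d))"
    and "Img d A' b (V d) \<subseteq> ssum (Img d A b (V d)) (line z)"
proof -
  have "\<exists>w\<in>Kr d A b (V d). ip d \<phi> w \<noteq> 0"
  proof (rule ccontr)
    assume "\<not> ?thesis"
    then have "\<phi> \<in> perp d (Kr d A b (V d))" using \<phi>(1) by (intro perpI) blast+
    also have "perp d (Kr d A b (V d)) = perp d (perp d (Img d (tr A) b (V d)))"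
      using Kr_tr[of d "tr A" b] by simp
    also have "\<dots> = Img d (tr A) b (V d)"
      by (rule perp_perp[OF subspace_Img[OF subspace_supp_sp] Img_V]) simp
    finally show False using \<phi>(2) by blast
  qed
  then obtain w where w: "w \<in> Kr d A b (V d)" "ip d \<phi> w \<noteq> 0" by blast
  show "vs.dim (Img d A' b (V d)) > vs.dim (Img d A b (V d))"
    by (rule dim_rank_one[where z=z and f=\<phi> and w=w and t=1, OF _ lin_app_pow Img_V z A' Img_V])
      (use w in \<open>auto simp: Kr_def\<close>)
  show "Img d A' b (V d) \<subseteq> ssum (Img d A b (V d)) (line z)"
  proof
    fix y assume "y \<in> Img d A' b (V d)"
    then obtain v where v: "v \<in> V d" "y = (app d A' ^^ b) v" by blast
    show "y \<in> ssum (Img d A b (V d)) (line z)"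
      unfolding v(2) A'[OF v(1)] by (rule in_ssumI) (use v(1) in \<open>auto simp: line_def\<close>)
  qed
qed

text \<open>The level is attained inside the kernel itself, since otherwise \<open>ker A^b\<close>
  would be absorbed one level lower, and \<open>H\<close> with it.\<close>

lemma exact_level_elem:
  assumes "H \<subseteq> Kr d A k X" "\<not> H \<subseteq> NI d A X" "vs.subspace X" "\<And>v. v \<in> X \<Longrightarrow> app d A v \<in> X"
  obtains b x where "1 \<le> b" "b \<le> k" "H \<subseteq> ssum (NI d A X) (Kr d A b X)"
    "x \<in> Kr d A b X" "x \<notin> ssum (NI d A X) (Kr d A (b - 1) X)"
proof -
  have sN: "vs.subspace (NI d A X)" using assms(3) by auto
  have "H \<subseteq> ssum (NI d A X) (Kr d A k X)" using assms(1) in_ssumI2[OF _ sN] by blast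
  then obtain b where b: "1 \<le> b" "b \<le> k" "H \<subseteq> ssum (NI d A X) (Kr d A b X)"
    "\<not> H \<subseteq> ssum (NI d A X) (Kr d A (b - 1) X)"
    using exact_level[OF _ assms(2) vs.subspace_0[OF assms(3)]] by blast
  have sS: "vs.subspace (ssum (NI d A X) (Kr d A (b - 1) X))" using sN assms(3) by auto
  have "\<not> Kr d A b X \<subseteq> ssum (NI d A X) (Kr d A (b - 1) X)"
  proof
    assume "Kr d A b X \<subseteq> ssum (NI d A X) (Kr d A (b - 1) X)"
    then have "ssum (NI d A X) (Kr d A b X) \<subseteq> ssum (NI d A X) (Kr d A (b - 1) X)"
      using in_ssumI1[OF _ subspace_Kr[OF assms(3)]] by (intro ssum_least sS) blast+
    then show False using b(3,4) by blast
  qed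
  then show ?thesis using that b by blast
qed

text \<open>Moving along \<open>e1 \<otimes> f2\<close> leaves \<open>A\<close> unchanged on \<open>U\<close> and on \<open>V / U\<close> but moves the image of \<open>A\<close>, so that
  \<open>improvable_conjugation\<close> applies at all points of the line other than \<open>A\<close>.\<close>

lemma exceptional_semi_improvable:
  fixes e1 e2 f2 :: "nat \<Rightarrow> 'k::field"
  assumes ok: "ok d m Q A"
    and T: "supp_sp d Q \<inter> NI d A (V d) = ssum (NI d A (supp_sp d Q)) (line e2)"
    and Um: "Kr d A (m - 1) (supp_sp d Q) \<subseteq> ssum (NI d A (supp_sp d Q)) (Kr d A l1 (supp_sp d Q))"
      "vs.dim (Kr d A (m - 1) (supp_sp d Q)) \<ge> vs.dim (NI d A (supp_sp d Q)) + 2"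
    and e1: "e1 \<in> Kr d A l1 (supp_sp d Q)" "e1 \<notin> ssum (NI d A (supp_sp d Q)) (Kr d A (l1 - 1) (supp_sp d Q))"
    and e2: "e2 \<in> Kr d A l2 (supp_sp d Q)" and l: "l2 < l1"
    and f2: "f2 \<in> Kr d (tr A) k2 (supp_sp d (- Q))" "f2 \<in> NI d (tr A) (V d)" "f2 \<notin> NI d (tr A) (supp_sp d (- Q))"
    and lk: "l1 + k2 \<le> m"
  shows "semi_improvable d m Q A"
proof -
  let ?V = "V d :: (nat \<Rightarrow> 'k) set" and ?U = "supp_sp d Q :: (nat \<Rightarrow> 'k) set" and ?U' = "supp_sp d (- Q) :: (nat \<Rightarrow> 'k) set"
  let ?N = "NI d A ?U"
  have sN: "vs.subspace ?N" by auto
  have NU: "?N \<subseteq> ?U" using ok_U[OF ok] by blast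
  have e1U: "e1 \<in> ?U" and e2U: "e2 \<in> ?U" using e1(1) e2 Kr_sub by blast+
  have f2U: "f2 \<in> ?U'" using f2(1) Kr_sub by blast
  obtain \<theta> where \<theta>: "\<theta> \<in> ?V" "f2 = app d (tr A) \<theta>" using f2(2) by blast
  have "e2 \<in> ?U \<inter> NI d A ?V" unfolding T by (rule in_ssumI2[OF self_in_line sN])
  then obtain v where v: "v \<in> ?V" "e2 = app d A v" by blast
  define c where "c = ip d f2 v"
  have c\<theta>: "c = ip d \<theta> e2" unfolding c_def v(2) \<theta>(2) ip_app ..
  \<comment> \<open>If c vanished, \<theta> would annihilate \<open>U\<close> intersected with
    \<open>A V\<close> and so be a sum of a functional killing \<open>U\<close> and one killing
    \<open>A V\<close>. The transpose sends the latter to 0, so f2 would be the image of the former,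
    against the choice of f2.\<close>
  have "c \<noteq> 0"
  proof
    assume "c = 0"
    then have z: "ip d \<theta> e2 = 0" using c\<theta> by simp
    have zN: "ip d \<theta> y = 0" if y: "y \<in> ?N" for y
    proof -
      obtain u where u: "u \<in> ?U" "y = app d A u" using y by blast
      show ?thesis unfolding u(2) ip_app \<theta>(2)[symmetric] by (rule ip_supp_sp[OF f2U u(1)])
    qed
    have "\<theta> \<in> perp d (?U \<inter> NI d A ?V)"
      unfolding T
    proof (rule perpI[OF \<theta>(1)])
      fix y assume "y \<in> ssum ?N (line e2)"
      then obtain h k where h: "h \<in> ?N" "y = h + sc k e2" by (rule in_ssum_lineE)
      show "ip d \<theta> y = 0" unfolding h(2) ip_add ip_sc zN[OF h(1)] z by simp
    qed
    also have "perp d (?U \<inter> NI d A ?V) = ssum (perp d ?U) (perp d (NI d A ?V))"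
      by (rule perp_Int[OF subspace_supp_sp subspace_NI[OF subspace_supp_sp] supp_sp_subset_V NI_V])
    finally obtain p q where pq: "p \<in> perp d ?U" "q \<in> perp d (NI d A ?V)" "\<theta> = p + q" by (rule in_ssumE)
    have "q \<in> perp d (Img d A 1 ?V)" using pq(2) by simp
    then have "q \<in> Kr d (tr A) 1 ?V" unfolding Kr_tr .
    then have "app d (tr A) q = 0" by (simp add: Kr_def)
    then have "f2 = app d (tr A) p" unfolding \<theta>(2) pq(3) app_add by simp
    moreover have "p \<in> ?U'" using pq(1) unfolding perp_supp_sp .
    ultimately show False using f2(3) by blast
  qed
  define B where "B = outer e1 f2"
  have okB: "ok d m Q (lnm A B t)" for t unfolding B_def by (rule outer_move(1)[OF ok e1(1) f2(1) lk])
  have BU: "app d (lnm A B t) u = app d A u" if "u \<in> ?U" for u t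
    unfolding B_def by (rule outer_move(2)[OF ok e1(1) f2(1) lk that])
  have "improvable d m Q (lnm A B t)" if t: "t \<noteq> 0" for t
  proof -
    let ?A = "lnm A B t"
    have NI: "NI d ?A ?U = ?N" by (rule image_cong[OF refl BU])
    have Kr: "Kr d ?A b ?U = Kr d A b ?U" for b
    proof -
      have "(app d ?A ^^ b) u = (app d A ^^ b) u" if "u \<in> ?U" for u
        using apow_cong[of ?U d ?A A, OF BU ok_U[OF okB] that] .
      then show ?thesis unfolding Kr_def by auto
    qed
    \<comment> \<open>The image of v under the moved operator: its level in \<open>U\<close> is l1
      instead of l2 as soon as t is nonzero.\<close>
    define y where "y = e2 + sc (t * c) e1"
    have yA: "y = app d ?A v"
      unfolding y_def app_lnm v(2) B_def app_outer[OF supp_sp_V[OF e1U]] c_def by simp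
    have yU: "y \<in> ?U" unfolding y_def using e1U e2U by (intro vs.subspace_add vs.subspace_scale) auto
    let ?S = "ssum ?N (Kr d A (l1 - 1) ?U)"
    have sS: "vs.subspace ?S" using sN by auto
    have yS: "y \<notin> ?S"
    proof
      assume yS: "y \<in> ?S"
      have "e2 \<in> Kr d A (l1 - 1) ?U" by (rule subsetD[OF Kr_mono e2]) (use l in simp)
      then have "e2 \<in> ?S" by (rule in_ssumI2[OF _ sN])
      then have "y - e2 \<in> ?S" using yS by (intro vs.subspace_diff[OF sS])
      then have "sc (1 / (t * c)) (y - e2) \<in> ?S" by (rule vs.subspace_scale[OF sS])
      moreover have "sc (1 / (t * c)) (y - e2) = e1" using t \<open>c \<noteq> 0\<close> by (simp add: y_def)
      ultimately show False using e1(2) by simp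
    qed
    have yV: "y \<in> ?V" by (rule supp_sp_V[OF yU])
    \<comment> \<open>A space that exceeds \<open>A U\<close> by two dimensions is not covered by
      one line, which supplies w.\<close>
    have "\<not> Kr d A l1 ?U \<subseteq> ssum ?N (line y)"
    proof
      assume "Kr d A l1 ?U \<subseteq> ssum ?N (line y)"
      then have "ssum ?N (Kr d A l1 ?U) \<subseteq> ssum ?N (line y)"
        using in_ssumI1[OF _ subspace_line] sN by (intro ssum_least) blast+
      then have "Kr d A (m - 1) ?U \<subseteq> ssum ?N (line y)" using Um(1) by blast
      moreover have "ssum ?N (line y) \<subseteq> ?V" by (rule ssum_V[OF NI_V line_subset[OF yV subspace_supp_sp]])
      ultimately have "vs.dim (Kr d A (m - 1) ?U) \<le> vs.dim (ssum ?N (line y))" by (rule dim_mono_V)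
      then show False using dim_ssum_line_le[OF sN NI_V yV] Um(2) by linarith
    qed
    then obtain w where w: "w \<in> Kr d A l1 ?U" "w \<notin> ssum ?N (line y)" by blast
    have "1 \<le> l1" "l1 \<le> m" using l lk by auto
    then show ?thesis
      by (intro improvable_conjugation[OF okB yU yA v(1), where b=l1 and w=w]) (use yS w in \<open>simp_all only: NI Kr not_False_eq_True\<close>)
  qed
  then have "{t. \<not> improvable d m Q (lnm A B t)} \<subseteq> {0}" by blast
  then have "finite {t. \<not> improvable d m Q (lnm A B t)}" by (rule finite_subset) simp
  then show ?thesis unfolding semi_improvable_def using okB by blast
qed

lemma not_in_later_image:
  assumes ok: "ok d m Q A" and x: "x \<in> Kr d A l (supp_sp d Q)"
    "x \<notin> ssum (NI d A (supp_sp d Q)) (Kr d A (l - 1) (supp_sp d Q))" and l: "1 \<le> l"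
  shows "(app d A ^^ (l - 1)) x \<notin> Img d A l (supp_sp d Q)"
proof -
  have "x \<in> supp_sp d Q" using x(1) Kr_sub by blast
  from not_in_image[OF this x(2) subspace_supp_sp ok_U[OF ok]] show ?thesis using l by simp
qed

text \<open>Depth in the image filtration separates the bottoms of the two chains: the first lies in
  \<open>A^l2 U\<close> but not in \<open>A^l1 U\<close>, the second not even in
  \<open>A^l2 U\<close>, while p lies in both.\<close>

lemma socle_vectors_indep:
  assumes ok: "ok d m Q A"
    and e1: "e1 \<in> Kr d A l1 (supp_sp d Q)" "e1 \<notin> ssum (NI d A (supp_sp d Q)) (Kr d A (l1 - 1) (supp_sp d Q))"
    and e2: "e2 \<in> Kr d A l2 (supp_sp d Q)" "e2 \<notin> ssum (NI d A (supp_sp d Q)) (Kr d A (l2 - 1) (supp_sp d Q))"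
    and l: "1 \<le> l2" "l2 < l1" "l1 \<le> n"
    and p: "p \<in> Img d A n (supp_sp d Q)"
    and eq: "sc a ((app d A ^^ (l1 - 1)) e1) + sc b ((app d A ^^ (l2 - 1)) e2) = p"
  shows "a = 0 \<and> b = 0"
proof -
  let ?U = "supp_sp d Q :: (nat \<Rightarrow> 'a) set"
  let ?z1 = "(app d A ^^ (l1 - 1)) e1" and ?z2 = "(app d A ^^ (l2 - 1)) e2"
  have st: "\<And>v. v \<in> ?U \<Longrightarrow> app d A v \<in> ?U" by (rule ok_U[OF ok])
  have sI: "vs.subspace (Img d A k ?U)" for k by auto
  have z1: "?z1 \<notin> Img d A l1 ?U" by (rule not_in_later_image[OF ok e1]) (use l in simp)
  have z2: "?z2 \<notin> Img d A l2 ?U" by (rule not_in_later_image[OF ok e2 l(1)])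
  have inv: "z \<in> S" if "vs.subspace S" "sc c z \<in> S" "c \<noteq> 0" for S :: "(nat \<Rightarrow> 'a) set" and c z
    using vs.subspace_scale[OF that(1,2), of "1 / c"] that(3) by simp
  have "e1 \<in> ?U" using e1(1) Kr_sub by blast
  then have "?z1 \<in> Img d A (l1 - 1) ?U" by blast
  then have z1': "?z1 \<in> Img d A l2 ?U" by (rule subsetD[OF Img_antimono[OF st], rotated 2]) (use l in auto)
  have pl2: "p \<in> Img d A l2 ?U" by (rule subsetD[OF Img_antimono[OF st] p]) (use l in auto)
  have pl1: "p \<in> Img d A l1 ?U" by (rule subsetD[OF Img_antimono[OF st] p]) (use l in auto)
  have b0: "b = 0"
  proof (rule ccontr)
    assume "b \<noteq> 0"
    have "p - sc a ?z1 \<in> Img d A l2 ?U" using pl2 z1' by (intro vs.subspace_diff[OF sI] vs.subspace_scale[OF sI])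
    moreover have "p - sc a ?z1 = sc b ?z2" using eq by (metis add_diff_cancel_left')
    ultimately show False using inv[OF sI, of b ?z2] \<open>b \<noteq> 0\<close> z2 by simp
  qed
  moreover have "a = 0"
  proof (rule ccontr)
    assume "a \<noteq> 0"
    have "sc a ?z1 = p" using eq b0 by simp
    then show False using inv[OF sI, of a ?z1 l1] pl1 \<open>a \<noteq> 0\<close> z1 by simp
  qed
  ultimately show ?thesis by simp
qed

text \<open>As \<open>A V\<close> lies in \<open>ker A^(m-1)\<close>, the intersection in the
  dimension formula for the sum is \<open>U\<close> intersected with \<open>A V\<close>.\<close>

lemma exceptional_dims:
  assumes ok: "ok d m Q A" and m: "m \<ge> 1"
    and e: "vs.dim (ssum (Kr d A (m - 1) (supp_sp d Q)) (NI d A (V d))) = vs.dim (NI d A (V d)) + 1"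
  shows "vs.dim (Kr d A (m - 1) (supp_sp d Q)) = vs.dim (supp_sp d Q \<inter> NI d A (V d)) + 1"
proof -
  let ?Um = "Kr d A (m - 1) (supp_sp d Q)" and ?N = "NI d A (V d)"
  have "?N \<subseteq> Kr d A (m - 1) (V d)" by (rule NI_Kr[OF _ ok_nil[OF ok] m]) simp_all
  then have eq: "?Um \<inter> ?N = supp_sp d Q \<inter> ?N" unfolding Kr_def by blast
  have "vs.dim (ssum ?Um ?N) + vs.dim (?Um \<inter> ?N) = vs.dim ?Um + vs.dim ?N"
    by (rule dim_ssum[OF subspace_Kr[OF subspace_supp_sp] _ subspace_NI[OF subspace_supp_sp] NI_V]) simp
  then show ?thesis using e eq by simp
qed

lemma socle_not_in_blk_image:
  assumes ok: "ok d m Q A" and x: "x \<in> Kr d A l (supp_sp d Q)"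
    "x \<notin> ssum (NI d A (supp_sp d Q)) (Kr d A (l - 1) (supp_sp d Q))" and l: "1 \<le> l" "l \<le> n"
  shows "(app d A ^^ (l - 1)) x \<in> supp_sp d Q" "(app d A ^^ (l - 1)) x \<notin> Img d (blk Q A) n (V d)"
proof -
  have xU: "x \<in> supp_sp d Q" using x(1) Kr_sub by blast
  show zU: "(app d A ^^ (l - 1)) x \<in> supp_sp d Q" using ok_U[OF ok] xU by (rule apow_stable)
  have "(app d A ^^ (l - 1)) x \<notin> Img d A n (supp_sp d Q)"
    using not_in_later_image[OF ok x l(1)] Img_antimono[OF ok_U[OF ok] l(2)] by blast
  then show "(app d A ^^ (l - 1)) x \<notin> Img d (blk Q A) n (V d)"
    using Img_blk[OF ok, of n] zU by blast
qed

text \<open>Going down the chain of x lowers its height to h and keeps its bottom vector; heights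
  can thus be fitted to the condition h + e = m of \<open>outer_move\<close>.\<close>

lemma socle_shift:
  assumes "ok d m Q A" "x \<in> Kr d A l (supp_sp d Q)" "1 \<le> l" "1 \<le> h" "h \<le> l"
  shows "(app d A ^^ (l - h)) x \<in> Kr d A h (supp_sp d Q)"
    "(app d A ^^ (h - 1)) ((app d A ^^ (l - h)) x) = (app d A ^^ (l - 1)) x"
proof -
  have comp: "(app d A ^^ a) ((app d A ^^ b) x) = (app d A ^^ (a + b)) x" for a b
    by (simp add: funpow_add)
  have "x \<in> supp_sp d Q" using assms(2) Kr_sub by blast
  then have "(app d A ^^ (l - h)) x \<in> supp_sp d Q" using ok_U[OF assms(1)] apow_stable by blast
  then show "(app d A ^^ (l - h)) x \<in> Kr d A h (supp_sp d Q)"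
    using assms(2,5) comp[of h "l - h"] by (simp add: Kr_def)
  show "(app d A ^^ (h - 1)) ((app d A ^^ (l - h)) x) = (app d A ^^ (l - 1)) x"
    unfolding comp using assms(4,5) by simp
qed

text \<open>By the two exceptional cases of \<open>nongeneric_top\<close> and \<open>image_meets_subspace\<close>, applied to \<open>A\<close> and to its
  transpose, \<open>U \<inter> A V\<close> exceeds \<open>A U\<close> by a dimension \<open>\<tau> \<in> {0, 1}\<close>, and \<open>\<tau>\<close> is the same for the transpose.
  If \<open>\<tau> = 0\<close>, replacing the off-diagonal block by one matrix of rank one raises a rank of \<open>A\<close> itself; if
  \<open>\<tau> = 1\<close>, two rank one matrices do, unless the levels are so small that
  \<open>exceptional_semi_improvable\<close> applies.\<close>

lemma nongeneric_improvable:
  assumes ok: "ok d m Q A" and m: "m \<ge> 1"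
    and ng: "vs.dim (Kr d A (m - 1) (V d)) \<ge> vs.dim (NI d A (V d)) + 2"
  shows "improvable d m Q A \<or> semi_improvable d m Q A"
proof (rule ccontr)
  assume "\<not> ?thesis"
  then have ni: "\<not> improvable d m Q A" and ns: "\<not> semi_improvable d m Q A" by blast+
  let ?V = "V d :: (nat \<Rightarrow> 'a) set" and ?U = "supp_sp d Q :: (nat \<Rightarrow> 'a) set" and ?U' = "supp_sp d (- Q) :: (nat \<Rightarrow> 'a) set"
  let ?B = "tr A" and ?A0 = "blk Q A"
  let ?N = "NI d A ?U" and ?N' = "NI d ?B ?U'"
  let ?Um = "Kr d A (m - 1) ?U" and ?Um' = "Kr d ?B (m - 1) ?U'"
  define T T' where "T = ?U \<inter> NI d A ?V" and "T' = ?U' \<inter> NI d ?B ?V"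
  have okt: "ok d m (- Q) ?B" by (rule ok_tr[OF ok])
  have nit: "\<not> improvable d m (- Q) ?B" using improvable_tr ni by blast
  have nst: "\<not> semi_improvable d m (- Q) ?B" using semi_improvable_tr ns by blast
  have dNt: "vs.dim (NI d ?B ?V) = vs.dim (NI d A ?V)" using dim_Img_tr[where d=d and A=A and b=1] by simp
  have dVm: "d = vs.dim (Kr d A (m - 1) ?V) + vs.dim (Img d A (m - 1) ?V)"
    using dim_Kr_Img[of ?V d A "m - 1"] by (simp add: dim_V)
  have dVmt: "d = vs.dim (Kr d ?B (m - 1) ?V) + vs.dim (Img d ?B (m - 1) ?V)"
    using dim_Kr_Img[of ?V d ?B "m - 1"] by (simp add: dim_V)
  have ngt: "vs.dim (Kr d ?B (m - 1) ?V) \<ge> vs.dim (NI d ?B ?V) + 2"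
    using ng dVm dVmt dim_Img_tr[where d=d and A=A and b="m - 1"] dNt by linarith
  have E: "vs.dim (Kr d A (m - 1) ?V) = vs.dim (NI d A ?V) + 2"
      "vs.dim (ssum ?Um (NI d A ?V)) = vs.dim (NI d A ?V) + 1"
    using nongeneric_top[OF ok m ng] ni by blast+
  have E': "vs.dim (ssum ?Um' (NI d ?B ?V)) = vs.dim (NI d ?B ?V) + 1"
    using nongeneric_top[OF okt m ngt] nit by blast
  have dUm: "vs.dim ?Um = vs.dim T + 1" unfolding T_def by (rule exceptional_dims[OF ok m E(2)])
  have dUm': "vs.dim ?Um' = vs.dim T' + 1" unfolding T'_def by (rule exceptional_dims[OF okt m E'])
  have S1: "vs.dim (NI d A ?V) = vs.dim T + vs.dim ?N'"
    using dim_Img_star[OF ok, of 1] unfolding T_def by simp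
  have S2: "vs.dim (NI d ?B ?V) = vs.dim T' + vs.dim ?N"
    using dim_Img_star[OF okt, of 1] unfolding T'_def by simp
  have bal: "vs.dim T + vs.dim ?N' = vs.dim T' + vs.dim ?N" using S1 S2 dNt by simp
  have dU: "vs.dim ?U = vs.dim ?Um + vs.dim (Img d A (m - 1) ?U)" by (rule dim_Kr_Img) auto
  have dU': "vs.dim ?U' = vs.dim ?Um' + vs.dim (Img d ?B (m - 1) ?U')" by (rule dim_Kr_Img) auto
  have dUU: "vs.dim ?U' + vs.dim ?U = d" using dim_perp[of ?U d] by (simp add: perp_supp_sp)
  have dA0: "vs.dim (Img d ?A0 (m - 1) ?V) = vs.dim (Img d A (m - 1) ?U) + vs.dim (Img d ?B (m - 1) ?U')"
    by (rule dim_Img_blk[OF ok])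
  \<comment> \<open>The counts of short blocks on V, \<open>U\<close> and the dual of
    \<open>V / U\<close>, combined. Together with \<open>bal\<close> they say that the rank of
    \<open>A^(m-1)\<close> exceeds that of its block diagonal part by \<tau>.\<close>
  have rk: "vs.dim (Img d A (m - 1) ?V) + vs.dim ?N' = vs.dim (Img d ?A0 (m - 1) ?V) + vs.dim T'"
    using dVm E(1) S1 dU dU' dUU dUm dUm' dA0 by linarith
  have rk1: "vs.dim (Img d ?A0 1 ?V) = vs.dim ?N + vs.dim ?N'"
    using dim_Img_blk[OF ok, of 1] by simp
  have stU: "\<And>v. v \<in> ?U \<Longrightarrow> app d A v \<in> ?U" and stU': "\<And>v. v \<in> ?U' \<Longrightarrow> app d ?B v \<in> ?U'"
    using ok_U[OF ok] ok_U[OF okt] by blast+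
  have NT: "?N \<subseteq> T" unfolding T_def using stU supp_sp_V by blast
  have NT': "?N' \<subseteq> T'" unfolding T'_def using stU' supp_sp_V by blast
  have TV: "T \<subseteq> ?V" "T' \<subseteq> ?V" unfolding T_def T'_def using supp_sp_subset_V by blast+
  have sub: "vs.subspace ?N" "vs.subspace ?N'" "vs.subspace T" "vs.subspace T'"
    unfolding T_def T'_def by (auto intro: subspace_inter')
  have UmN: "\<not> ?Um \<subseteq> ?N" 
    using dim_mono_V[of ?Um ?N d] NI_V[of d A ?U] dim_mono_V[OF NT TV(1)] dUm by auto
  have UmN': "\<not> ?Um' \<subseteq> ?N'"
    using dim_mono_V[of ?Um' ?N' d] NI_V[of d ?B ?U'] dim_mono_V[OF NT' TV(2)] dUm' by auto
  \<comment> \<open>e is the top of a largest block of \<open>A\<close> on \<open>U\<close> among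
    those of size below m; f below is its counterpart for the transpose.\<close>
  obtain l e where le: "1 \<le> l" "l \<le> m - 1" "?Um \<subseteq> ssum ?N (Kr d A l ?U)"
    "e \<in> Kr d A l ?U" "e \<notin> ssum ?N (Kr d A (l - 1) ?U)"
    using exact_level_elem[OF order_refl UmN subspace_supp_sp stU] by blast
  obtain k f where kf: "1 \<le> k" "k \<le> m - 1" "?Um' \<subseteq> ssum ?N' (Kr d ?B k ?U')"
    "f \<in> Kr d ?B k ?U'" "f \<notin> ssum ?N' (Kr d ?B (k - 1) ?U')"
    using exact_level_elem[OF order_refl UmN' subspace_supp_sp stU'] by blast
  have ok0: "ok d m Q ?A0" by (rule ok_blk[OF ok])
  have tr0: "tr ?A0 = blk (- Q) ?B" by (rule tr_blk)
  have Kr0: "Kr d ?A0 b ?U = Kr d A b ?U" for b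
    unfolding Kr_def using apow_blk[OF ok] by auto
  have Kr0': "Kr d (tr ?A0) b ?U' = Kr d ?B b ?U'" for b
    unfolding Kr_def tr0 using apow_blk[OF okt] by auto
  have A0U: "app d ?A0 u = app d A u" if "u \<in> ?U" for u by (rule app_blk[OF ok that])
  have A0U': "app d (tr ?A0) g = app d ?B g" if "g \<in> ?U'" for g unfolding tr0 by (rule app_blk[OF okt that])
  have pw0: "(app d ?A0 ^^ b) u = (app d A ^^ b) u" if "u \<in> ?U" for b u by (rule apow_blk[OF ok that])
  have pw0': "(app d (tr ?A0) ^^ b) g = (app d ?B ^^ b) g" if "g \<in> ?U'" for b g unfolding tr0 by (rule apow_blk[OF okt that])
  show False
  proof (cases "T = ?N")
    case True
    have d0: "vs.dim T' = vs.dim ?N'" using bal True by simp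
    show False
    \<comment> \<open>If the heights fit, e and f are used as they are and the rank of
      \<open>A\<close> itself goes up. Otherwise e is lowered until the heights add up to m, and the
      gain is in the rank of \<open>A^(m-1)\<close>. In both cases \<tau> = 0 means that the block
      diagonal part already has the rank of the original.\<close>
    proof (cases "l + k \<le> m")
      case lk: True
      let ?A1 = "lnm ?A0 (outer e f) 1"
      note mv = outer_move[OF ok0 le(4)[folded Kr0] kf(4)[folded Kr0'] lk, where t=1]
      have eU: "e \<in> ?U" and fU: "f \<in> ?U'" using le(4) kf(4) Kr_sub by blast+
      have "e \<notin> ?N" using le(5) in_ssumI1[OF _ subspace_Kr[OF subspace_supp_sp]] by blast
      then have e0: "e \<notin> Img d ?A0 1 ?V" using Img_blk[OF ok, of 1] eU by auto
      have "f \<notin> ?N'" using kf(5) in_ssumI1[OF _ subspace_Kr[OF subspace_supp_sp]] by blast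
      then have f0: "f \<notin> Img d (tr ?A0) 1 ?V" unfolding tr0 using Img_blk[OF okt, of 1] fU by auto
      have "vs.dim (Img d ?A1 1 ?V) > vs.dim (Img d ?A0 1 ?V)"
        by (rule outer_gain(1)[OF _ supp_sp_V[OF eU] e0 supp_sp_V[OF fU] f0])
          (simp add: app_lnm app_outer[OF supp_sp_V[OF eU]])
      moreover have "vs.dim (Img d ?A0 1 ?V) = vs.dim (Img d A 1 ?V)" using rk1 S1 True by simp
      ultimately have "improvable d m Q A"
        by (intro improvable_fixing_blocks[OF ok mv(1) _ _ m]) (simp_all add: mv(2,3) A0U A0U' del: funpow.simps)
      then show False using ni by blast
    next
      case lk: False
      define h where "h = m - k"
      have h: "1 \<le> h" "h \<le> l" "h + k = m" "h + k \<le> m" using lk kf le unfolding h_def by auto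
      let ?s = "(app d A ^^ (l - h)) e"
      note sh = socle_shift[OF ok le(4,1) h(1,2)]
      let ?A1 = "lnm ?A0 (outer ?s f) 1"
      note mv = outer_move[OF ok0 sh(1)[folded Kr0] kf(4)[folded Kr0'] h(4), where t=1]
      have sU: "?s \<in> ?U" and fU: "f \<in> ?U'" using sh(1) kf(4) Kr_sub by blast+
      let ?z = "(app d A ^^ (l - 1)) e" and ?\<phi> = "(app d ?B ^^ (k - 1)) f"
      note z = socle_not_in_blk_image[OF ok le(4,5,1,2)] and \<phi> = socle_not_in_blk_image[OF okt kf(4,5,1,2)]
      have "vs.dim (Img d ?A1 (m - 1) ?V) > vs.dim (Img d ?A0 (m - 1) ?V)"
      proof (rule outer_gain(1)[OF _ supp_sp_V[OF z(1)] z(2) supp_sp_V[OF \<phi>(1)]])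
        show "?\<phi> \<notin> Img d (tr ?A0) (m - 1) ?V" unfolding tr0 by (rule \<phi>(2))
        show "(app d ?A1 ^^ (m - 1)) v = (app d ?A0 ^^ (m - 1)) v + sc (1 * ip d ?\<phi> v) ?z" for v
          using mv(4)[OF h(3,1) kf(1)] unfolding pw0[OF sU] pw0'[OF fU] sh(2) .
      qed
      moreover have "vs.dim (Img d ?A0 (m - 1) ?V) = vs.dim (Img d A (m - 1) ?V)" using rk d0 by simp
      ultimately have "improvable d m Q A"
        by (intro improvable_fixing_blocks[OF ok mv(1), where b="m - 1"]) (simp_all add: mv(2,3) A0U A0U')
      then show False using ni by blast
    qed
  next
    case False
    then obtain l2 where l2: "1 \<le> l2" "l2 \<le> m - 1" "T = ssum ?N (Kr d A l2 ?U)"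
      "\<not> T \<subseteq> ssum ?N (Kr d A (l2 - 1) ?U)" "vs.dim T = vs.dim ?N + 1"
      using image_meets_subspace[OF ok m T_def] ni by blast
    have d1: "vs.dim T' = vs.dim ?N' + 1" using bal l2(5) by simp
    then have "T' \<noteq> ?N'" by auto
    then obtain k2 where k2: "1 \<le> k2" "k2 \<le> m - 1" "T' = ssum ?N' (Kr d ?B k2 ?U')"
      "\<not> T' \<subseteq> ssum ?N' (Kr d ?B (k2 - 1) ?U')"
      using image_meets_subspace[OF okt m T'_def] nit by blast
    \<comment> \<open>Otherwise all of \<open>?Um\<close> would lie in \<open>T\<close>, whose
      dimension is smaller by one.\<close>
    have ll: "l2 < l"
    proof (rule ccontr)
      assume "\<not> l2 < l"
      then have "Kr d A l ?U \<subseteq> Kr d A l2 ?U" by (intro Kr_mono) simp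
      then have "Kr d A l ?U \<subseteq> T" unfolding l2(3) using in_ssumI2[OF _ sub(1)] by blast
      then have "ssum ?N (Kr d A l ?U) \<subseteq> T" by (rule ssum_least[OF NT _ sub(3)])
      then have "?Um \<subseteq> T" using le(3) by blast
      then show False using dim_mono_V[OF _ TV(1), of ?Um] dUm by simp
    qed
    have kk: "k2 < k"
    proof (rule ccontr)
      assume "\<not> k2 < k"
      then have "Kr d ?B k ?U' \<subseteq> Kr d ?B k2 ?U'" by (intro Kr_mono) simp
      then have "Kr d ?B k ?U' \<subseteq> T'" unfolding k2(3) using in_ssumI2[OF _ sub(2)] by blast
      then have "ssum ?N' (Kr d ?B k ?U') \<subseteq> T'" by (rule ssum_least[OF NT' _ sub(4)])
      then have "?Um' \<subseteq> T'" using kf(3) by blast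
      then show False using dim_mono_V[OF _ TV(2), of ?Um'] dUm' by simp
    qed
    have ex: "\<exists>x\<in>Kr d C b X. x \<notin> ssum (NI d C X) (Kr d C (b - 1) X)"
      if "\<not> ssum (NI d C X) (Kr d C b X) \<subseteq> ssum (NI d C X) (Kr d C (b - 1) X)" "vs.subspace X"
      for C :: "nat \<Rightarrow> nat \<Rightarrow> 'a" and b X
    proof (rule ccontr)
      assume "\<not> ?thesis"
      then have a: "Kr d C b X \<subseteq> ssum (NI d C X) (Kr d C (b - 1) X)" by blast
      have "ssum (NI d C X) (Kr d C b X) \<subseteq> ssum (NI d C X) (Kr d C (b - 1) X)"
        by (rule ssum_least[OF _ a]) (use in_ssumI1[OF _ subspace_Kr[OF that(2)]] that(2) in auto)
      then show False using that(1) by blast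
    qed
    obtain e2 where e2: "e2 \<in> Kr d A l2 ?U" "e2 \<notin> ssum ?N (Kr d A (l2 - 1) ?U)"
      using ex[of A ?U l2] l2(4) unfolding l2(3) by auto
    obtain f2 where f2: "f2 \<in> Kr d ?B k2 ?U'" "f2 \<notin> ssum ?N' (Kr d ?B (k2 - 1) ?U')"
      using ex[of ?B ?U' k2] k2(4) unfolding k2(3) by auto
    have e2T: "e2 \<in> T" unfolding l2(3) by (rule in_ssumI2[OF e2(1) sub(1)])
    have f2T: "f2 \<in> T'" unfolding k2(3) by (rule in_ssumI2[OF f2(1) sub(2)])
    have e2N: "e2 \<notin> ?N" using e2(2) in_ssumI1[OF _ subspace_Kr[OF subspace_supp_sp]] by blast
    have f2N: "f2 \<notin> ?N'" using f2(2) in_ssumI1[OF _ subspace_Kr[OF subspace_supp_sp]] by blast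
    have Te: "T = ssum ?N (line e2)"
    proof (rule dim_eq_V[symmetric, OF subspace_ssum[OF sub(1) subspace_line] _ TV(1) sub(3)])
      show "ssum ?N (line e2) \<subseteq> T" by (rule ssum_least[OF NT line_subset[OF e2T sub(3)] sub(3)])
      have "vs.dim (ssum ?N (line e2)) = Suc (vs.dim ?N)"
        by (rule dim_insert_V[OF sub(1) NI_V _ e2N]) (use e2T TV(1) in blast)
      then show "vs.dim T \<le> vs.dim (ssum ?N (line e2))" using l2(5) by simp
    qed
    have Tf: "T' = ssum ?N' (line f2)"
    proof (rule dim_eq_V[symmetric, OF subspace_ssum[OF sub(2) subspace_line] _ TV(2) sub(4)])
      show "ssum ?N' (line f2) \<subseteq> T'" by (rule ssum_least[OF NT' line_subset[OF f2T sub(4)] sub(4)])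
      have "vs.dim (ssum ?N' (line f2)) = Suc (vs.dim ?N')"
        by (rule dim_insert_V[OF sub(2) NI_V _ f2N]) (use f2T TV(2) in blast)
      then show "vs.dim T' \<le> vs.dim (ssum ?N' (line f2))" using d1 by simp
    qed
    have dU2: "vs.dim ?Um \<ge> vs.dim ?N + 2" "vs.dim ?Um' \<ge> vs.dim ?N' + 2"
      using dUm dUm' l2(5) d1 by auto
    show False
    proof (cases "l + k2 \<le> m")
      case True
      have "semi_improvable d m Q A"
        by (rule exceptional_semi_improvable[OF ok Te[unfolded T_def] le(3) dU2(1) le(4,5) e2(1) ll f2(1) _ f2N True])
          (use f2T in \<open>simp add: T'_def\<close>)
      then show False using ns by blast
    next
      case lk2: False
      show False
      proof (cases "k + l2 \<le> m")
        case True
        have "semi_improvable d m (- Q) ?B"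
          by (rule exceptional_semi_improvable[OF okt Tf[unfolded T'_def] kf(3) dU2(2) kf(4,5) f2(1) kk _ _ _ True])
            (use e2(1) e2T e2N in \<open>simp_all add: T_def\<close>)
        then show False using nst by blast
      next
        case kl2: False
        \<comment> \<open>Each chain is paired with the other chain of the dual: the long one with
          the short dual one and conversely. At these heights both pairs add up to m, so each move
          changes \<open>A^(m-1)\<close> by one rank one operator.\<close>
        define h1 h2 where "h1 = m - k2" and "h2 = m - k"
        have h1: "1 \<le> h1" "h1 \<le> l" "h1 + k2 = m" "h1 + k2 \<le> m" using lk2 k2 le unfolding h1_def by auto
        have h2: "1 \<le> h2" "h2 \<le> l2" "h2 + k = m" "h2 + k \<le> m" using kl2 kf l2 unfolding h2_def by auto
        let ?s1 = "(app d A ^^ (l - h1)) e" and ?s2 = "(app d A ^^ (l2 - h2)) e2"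
        note sh1 = socle_shift[OF ok le(4,1) h1(1,2)] and sh2 = socle_shift[OF ok e2(1) l2(1) h2(1,2)]
        let ?z1 = "(app d A ^^ (l - 1)) e" and ?z2 = "(app d A ^^ (l2 - 1)) e2"
        let ?p1 = "(app d ?B ^^ (k - 1)) f" and ?p2 = "(app d ?B ^^ (k2 - 1)) f2"
        note z1 = socle_not_in_blk_image[OF ok le(4,5,1,2)] and z2 = socle_not_in_blk_image[OF ok e2 l2(1,2)]
        note p1 = socle_not_in_blk_image[OF okt kf(4,5,1,2)] and p2 = socle_not_in_blk_image[OF okt f2 k2(1,2)]
        let ?A1 = "lnm ?A0 (outer ?s1 f2) 1"
        let ?A2 = "lnm ?A1 (outer ?s2 f) 1"
        have s1U: "?s1 \<in> ?U" and s2U: "?s2 \<in> ?U" using sh1(1) sh2(1) Kr_sub by blast+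
        have fU: "f \<in> ?U'" and f2U: "f2 \<in> ?U'" using kf(4) f2(1) Kr_sub by blast+
        note mv1 = outer_move[OF ok0 sh1(1)[folded Kr0] f2(1)[folded Kr0'] h1(4), where t=1]
        have pw1: "(app d ?A1 ^^ b) u = (app d A ^^ b) u" if "u \<in> ?U" for b u
          using apow_cong[of ?U d ?A1 A, OF _ ok_U[OF mv1(1)] that] mv1(2) A0U by simp
        have pw1': "(app d (tr ?A1) ^^ b) g = (app d ?B ^^ b) g" if "g \<in> ?U'" for b g
          using apow_cong[of ?U' d "tr ?A1" ?B, OF _ ok_U[OF ok_tr[OF mv1(1)]] that] mv1(3) A0U' by simp
        have s2k: "?s2 \<in> Kr d ?A1 h2 ?U" using sh2(1) pw1 unfolding Kr_def by auto
        have fk: "f \<in> Kr d (tr ?A1) k ?U'" using kf(4) pw1' unfolding Kr_def by auto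
        note mv2 = outer_move[OF mv1(1) s2k fk h2(4), where t=1]
        have A1: "(app d ?A1 ^^ (m - 1)) v = (app d ?A0 ^^ (m - 1)) v + sc (1 * ip d ?p2 v) ?z1" for v
          using mv1(4)[OF h1(3,1) k2(1)] unfolding pw0[OF s1U] pw0'[OF f2U] sh1(2) .
        have A1t: "(app d (tr ?A1) ^^ (m - 1)) v = (app d (tr ?A0) ^^ (m - 1)) v + sc (1 * ip d ?z1 v) ?p2"
          if "v \<in> ?V" for v
        proof -
          have "(app d (tr ?A1) ^^ (m - 1)) v - ((app d (tr ?A0) ^^ (m - 1)) v + sc (1 * ip d ?z1 v) ?p2) = 0"
          proof (rule ip_nondeg)
            show "(app d (tr ?A1) ^^ (m - 1)) v - ((app d (tr ?A0) ^^ (m - 1)) v + sc (1 * ip d ?z1 v) ?p2) \<in> V d"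
              using apow_V[OF that] supp_sp_V[OF p2(1)]
              by (intro vs.subspace_diff vs.subspace_add vs.subspace_scale) auto
            fix g :: "nat \<Rightarrow> 'a"
            have "ip d g ((app d (tr ?A1) ^^ (m - 1)) v) = ip d v ((app d ?A1 ^^ (m - 1)) g)"
              unfolding ip_apow[of d g] tr_tr by (rule ip_commute)
            also have "\<dots> = ip d v ((app d ?A0 ^^ (m - 1)) g) + ip d ?p2 g * ip d v ?z1"
              unfolding A1 ip_add ip_sc by simp
            also have "ip d v ((app d ?A0 ^^ (m - 1)) g) = ip d g ((app d (tr ?A0) ^^ (m - 1)) v)"
              unfolding ip_apow[of d g] tr_tr by (rule ip_commute)
            finally show "ip d g ((app d (tr ?A1) ^^ (m - 1)) v - ((app d (tr ?A0) ^^ (m - 1)) v + sc (1 * ip d ?z1 v) ?p2)) = 0"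
              unfolding ip_diff ip_add ip_sc ip_commute[of d g ?p2] ip_commute[of d ?z1 v]
              by (simp add: mult.commute)
          qed
          then show ?thesis by simp
        qed
        have p2n: "?p2 \<notin> Img d (tr ?A0) (m - 1) ?V" unfolding tr0 by (rule p2(2))
        note g1 = outer_gain[OF A1 supp_sp_V[OF z1(1)] z1(2) supp_sp_V[OF p2(1)] p2n]
        have z1n: "?z1 \<notin> Img d (tr (tr ?A0)) (m - 1) ?V" using z1(2) by simp
        note g1t = outer_gain[OF A1t supp_sp_V[OF p2(1)] p2n supp_sp_V[OF z1(1)] z1n]
        \<comment> \<open>The first move has enlarged the image by the bottom \<open>?z1\<close>;
          independence of the two bottoms keeps \<open>?z2\<close> outside, so the second gain adds
          to the first.\<close>
        have z2n: "?z2 \<notin> Img d ?A1 (m - 1) ?V"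
        proof
          assume "?z2 \<in> Img d ?A1 (m - 1) ?V"
          then have "?z2 \<in> ssum (Img d ?A0 (m - 1) ?V) (line ?z1)" using g1(2) by blast
          then obtain p c where p: "p \<in> Img d ?A0 (m - 1) ?V" "?z2 = p + sc c ?z1" by (rule in_ssum_lineE)
          have pe: "sc (- c) ?z1 + sc 1 ?z2 = p" unfolding p(2) by (simp add: vs.scale_minus_left)
          have "p \<in> ?U" unfolding pe[symmetric] using z1(1) z2(1) by (intro vs.subspace_add vs.subspace_scale) auto
          then have "p \<in> Img d A (m - 1) ?U" using p(1) Img_blk[OF ok, of "m - 1"] by blast
          from socle_vectors_indep[OF ok le(4,5) e2 l2(1) ll le(2) this pe] show False by simp
        qed
        have p1n: "?p1 \<notin> Img d (tr ?A1) (m - 1) ?V"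
        proof
          assume "?p1 \<in> Img d (tr ?A1) (m - 1) ?V"
          then have "?p1 \<in> ssum (Img d (tr ?A0) (m - 1) ?V) (line ?p2)" using g1t(2) by blast
          then obtain p c where p: "p \<in> Img d (tr ?A0) (m - 1) ?V" "?p1 = p + sc c ?p2" by (rule in_ssum_lineE)
          have pe: "sc 1 ?p1 + sc (- c) ?p2 = p" unfolding p(2) by (simp add: vs.scale_minus_left)
          have "p \<in> ?U'" unfolding pe[symmetric] using p1(1) p2(1) by (intro vs.subspace_add vs.subspace_scale) auto
          then have "p \<in> Img d ?B (m - 1) ?U'" using p(1) Img_blk[OF okt, of "m - 1"] unfolding tr0 by blast
          from socle_vectors_indep[OF okt kf(4,5) f2 k2(1) kk kf(2) this pe] show False by simp
        qed
        have A2: "(app d ?A2 ^^ (m - 1)) v = (app d ?A1 ^^ (m - 1)) v + sc (1 * ip d ?p1 v) ?z2" for v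
          using mv2(4)[OF h2(3,1) kf(1)] unfolding pw1[OF s2U] pw1'[OF fU] sh2(2) .
        note g2 = outer_gain(1)[OF A2 supp_sp_V[OF z2(1)] z2n supp_sp_V[OF p1(1)] p1n]
        \<comment> \<open>Two gains over the block diagonal part, against the single one that
          \<open>A\<close> has over it.\<close>
        have "vs.dim (Img d ?A2 (m - 1) ?V) > vs.dim (Img d A (m - 1) ?V)"
          using g1(1) g2 rk d1 by linarith
        then have "improvable d m Q A"
          by (intro improvable_fixing_blocks[OF ok mv2(1), where b="m - 1"]) (simp_all add: mv1(2,3) mv2(2,3) A0U A0U')
        then show False using ni by blast
      qed
    qed
  qed
qed

text \<open>Induction on the distance of \<open>meas\<close> from its upper bound. \<open>Zp\<close>
  will be the vanishing of a polynomial function, and \<open>lc\<close> expresses that its zero set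
  is closed along lines.\<close>

theorem dense:
  fixes Zp :: "(nat \<Rightarrow> nat \<Rightarrow> 'k::field) \<Rightarrow> bool"
  assumes lc: "\<And>A B. finite {t. \<not> Zp (lnm A B t)} \<Longrightarrow> Zp A"
    and gen: "\<And>A. ok d m Q A \<Longrightarrow> vs.dim (Kr d A (m - 1) (V d)) \<le> vs.dim (NI d A (V d)) + 1 \<Longrightarrow> Zp A"
    and m: "m \<ge> 1" and ok: "ok d m Q A"
  shows "Zp A"
  using ok
proof (induction "(m + 1) * (3 * d) - meas d m Q A" arbitrary: A rule: less_induct)
  case less
  have IH: "Zp A'" if "ok d m Q A'" "meas d m Q A < meas d m Q A'" for A'
    using less.hyps[OF _ that(1)] that(2) meas_le[of d m Q A'] by simp
  have imp: "Zp A'" if A': "improvable d m Q A'" "meas d m Q A \<le> meas d m Q A'" for A'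
  proof -
    obtain B where B: "\<forall>t. ok d m Q (lnm A' B t)" "finite {t. \<not> meas d m Q A' < meas d m Q (lnm A' B t)}"
      using A'(1) unfolding improvable_def by blast
    have "{t. \<not> Zp (lnm A' B t)} \<subseteq> {t. \<not> meas d m Q A' < meas d m Q (lnm A' B t)}"
    proof
      fix t assume "t \<in> {t. \<not> Zp (lnm A' B t)}"
      then have "\<not> meas d m Q A < meas d m Q (lnm A' B t)" using IH B(1) by blast
      then show "t \<in> {t. \<not> meas d m Q A' < meas d m Q (lnm A' B t)}" using A'(2) by simp
    qed
    then have "finite {t. \<not> Zp (lnm A' B t)}" by (rule finite_subset) (rule B(2))
    then show "Zp A'" by (rule lc)
  qed
  show ?case
  proof (cases "vs.dim (Kr d A (m - 1) (V d)) \<le> vs.dim (NI d A (V d)) + 1")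
    case True then show ?thesis using gen less.prems by blast
  next
    case False
    then have "improvable d m Q A \<or> semi_improvable d m Q A" by (intro nongeneric_improvable[OF less.prems m]) simp
    then show ?thesis
    proof
      assume "improvable d m Q A" then show ?thesis using imp by blast
    next
      assume "semi_improvable d m Q A"
      then obtain B where B: "finite {t. \<not> improvable d m Q (lnm A B t)}"
        unfolding semi_improvable_def by blast
      \<comment> \<open>Points of the first line need not be better than \<open>A\<close>; by
        semicontinuity almost all are no worse, so improving them further leads above the measure of
        \<open>A\<close>.\<close>
      have "{t. \<not> Zp (lnm A B t)} \<subseteq> {t. \<not> improvable d m Q (lnm A B t)} \<union> {t. meas d m Q (lnm A B t) < meas d m Q A}"
        using imp not_le by blast
      then have "finite {t. \<not> Zp (lnm A B t)}" by (rule finite_subset) (intro finite_UnI B meas_semicont)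
      then show ?thesis by (rule lc)
    qed
  qed
qed

section \<open>Jordan bases of generic operators\<close>

lemma dim_span_le: "vs.dim (vs.span (b ` {..<k})) \<le> k"
proof -
  have "vs.dim (vs.span (b ` {..<k})) \<le> card (b ` {..<k})" by (rule vs.dim_le_card) auto
  also have "\<dots> \<le> k" by (metis card_image_le card_lessThan finite_lessThan)
  finally show ?thesis .
qed

lemma span_indepf:
  assumes "V d \<subseteq> vs.span (h ` {..<d})" shows "indepf d h"
  unfolding indepf_def
proof (intro allI impI, rule ccontr)
  fix \<alpha> k assume a: "\<forall>x. (\<Sum>i<d. \<alpha> i * h i x) = 0" and k: "k < d" "\<alpha> k \<noteq> 0"
  let ?B = "h ` ({..<d} - {k})"
  have s: "(\<Sum>i\<in>{..<d} - {k}. sc (\<alpha> i) (h i)) + sc (\<alpha> k) (h k) = 0"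
  proof
    fix x
    have "(\<Sum>i<d. \<alpha> i * h i x) = \<alpha> k * h k x + (\<Sum>i\<in>{..<d} - {k}. \<alpha> i * h i x)"
      by (rule sum.remove) (use k in auto)
    then show "((\<Sum>i\<in>{..<d} - {k}. sc (\<alpha> i) (h i)) + sc (\<alpha> k) (h k)) x = 0 x"
      using a by (simp add: plus_fun_apply sum_fun_apply sc_apply zero_fun_apply add.commute)
  qed
  have S: "(\<Sum>i\<in>{..<d} - {k}. sc (\<alpha> i) (h i)) \<in> vs.span ?B"
    by (intro vs.span_sum vs.span_scale vs.span_base) auto
  have "sc (- 1 / \<alpha> k) (\<Sum>i\<in>{..<d} - {k}. sc (\<alpha> i) (h i)) = h k"
  proof -
    have "(\<Sum>i\<in>{..<d} - {k}. sc (\<alpha> i) (h i)) = sc (- \<alpha> k) (h k)"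
      using s by (simp add: vs.scale_minus_left eq_neg_iff_add_eq_0)
    then show ?thesis using k(2) by simp
  qed
  then have hk: "h k \<in> vs.span ?B" using vs.span_scale[OF S, of "- 1 / \<alpha> k"] by simp
  have "h ` {..<d} \<subseteq> vs.span ?B"
  proof
    fix y assume "y \<in> h ` {..<d}"
    then obtain i where "i < d" "y = h i" by blast
    then show "y \<in> vs.span ?B" using hk by (cases "i = k") (auto intro: vs.span_base)
  qed
  then have "vs.span (h ` {..<d}) \<subseteq> vs.span ?B" by (intro vs.span_minimal) auto
  then have "V d \<subseteq> vs.span ?B" using assms by blast
  then have "vs.dim (V d :: (nat \<Rightarrow> 'a) set) \<le> card ?B" by (rule vs.dim_le_card) simp
  also have "\<dots> \<le> card ({..<d} - {k})" by (rule card_image_le) simp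
  also have "\<dots> = d - 1" using k(1) by simp
  finally show False using k(1) by (simp add: dim_V)
qed

lemma span_V: "(\<And>i. i < k \<Longrightarrow> c i \<in> S) \<Longrightarrow> vs.subspace S \<Longrightarrow> vs.span (c ` {..<k}) \<subseteq> S"
  by (rule vs.span_minimal) auto

lemma indepf_spans:
  assumes c: "indepf k c" "\<And>i. i < k \<Longrightarrow> c i \<in> S" and S: "vs.subspace S" "S \<subseteq> V d" "vs.dim S \<le> k"
  shows "S = vs.span (c ` {..<k})"
proof -
  have sub: "vs.span (c ` {..<k}) \<subseteq> S" by (rule span_V[OF c(2) S(1)])
  have "k \<le> vs.dim (vs.span (c ` {..<k}))"
    by (rule indepf_le_dim[OF c(1)]) (use sub S(2) in \<open>auto intro: vs.span_base\<close>)
  then show ?thesis using dim_eq_V[OF _ sub S(2,1)] S(3) by simp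
qed

text \<open>Rank-nullity for \<open>A\<close> on its successive images, telescoped. In a Jordan
  basis the b-th summand counts the blocks of size greater than b.\<close>

lemma dim_sum_socles:
  assumes X: "vs.subspace X" "X \<subseteq> V d"
  shows "vs.dim X = (\<Sum>b<k. vs.dim (Kr d A 1 (Img d A b X))) + vs.dim (Img d A k X)"
proof (induction k)
  case 0 show ?case by simp
next
  case (Suc k)
  have "vs.dim (Img d A k X) = vs.dim (Kr d A 1 (Img d A k X)) + vs.dim (Img d A 1 (Img d A k X))"
    by (rule dim_Kr_Img[OF subspace_Img[OF X(1)] Img_V[OF X(2)]])
  moreover have "Img d A 1 (Img d A k X) = Img d A (Suc k) X" by (simp add: image_comp comp_def)
  ultimately show ?case using Suc.IH by simp
qed

lemma soc_antimono:
  assumes "\<And>v. v \<in> X \<Longrightarrow> app d A v \<in> X" "b \<le> b'"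
  shows "Kr d A 1 (Img d A b' X) \<subseteq> Kr d A 1 (Img d A b X)"
  using Img_antimono[OF assms] unfolding Kr_def by blast

lemma last_image_soc:
  assumes X: "\<And>v. v \<in> X \<Longrightarrow> app d A v \<in> X" "\<And>v. v \<in> X \<Longrightarrow> (app d A ^^ Suc k) v = 0" and b: "b \<le> k"
  shows "Img d A k X \<subseteq> Kr d A 1 (Img d A b X)"
proof
  fix y assume y: "y \<in> Img d A k X"
  then obtain v where "v \<in> X" "y = (app d A ^^ k) v" by blast
  then have "app d A y = 0" using X(2) by simp
  moreover have "y \<in> Img d A b X" by (rule subsetD[OF Img_antimono[OF X(1) b] y])
  ultimately show "y \<in> Kr d A 1 (Img d A b X)" by (simp add: Kr_def)
qed

text \<open>The fixed Jordan form: blocks of size \<open>m\<close> starting at the multiples of \<open>m\<close>, and a last block of size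
  \<open>d mod m\<close>.\<close>

definition jnext :: "nat \<Rightarrow> nat \<Rightarrow> nat \<Rightarrow> bool" where
  "jnext d m k \<longleftrightarrow> Suc k < d \<and> \<not> m dvd Suc k"

definition jordan_basis :: "nat \<Rightarrow> nat \<Rightarrow> (nat \<Rightarrow> nat \<Rightarrow> 'k::field) \<Rightarrow> (nat \<Rightarrow> nat \<Rightarrow> 'k) \<Rightarrow> bool" where
  "jordan_basis d m A h \<longleftrightarrow> (\<forall>k<d. h k \<in> V d \<and> app d A (h k) = (if jnext d m k then h (Suc k) else 0)) \<and> indepf d h"

text \<open>The socles \<open>S b\<close> of the images decrease from \<open>ker A\<close>, of
  dimension at most q + 1, to \<open>I\<close>, of dimension q; the place r of the drop is the size
  of the short block, 0 if there is none. Chains over a basis of \<open>I\<close> and over one more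
  socle vector span V, and \<open>dim_sum_socles\<close> shows that they have no more than d
  members.\<close>

lemma generic_basis:
  fixes A :: "nat \<Rightarrow> nat \<Rightarrow> 'k::field"
  assumes nil: "\<And>v. v \<in> V d \<Longrightarrow> (app d A ^^ m) v = 0" and m: "m \<ge> 1"
    and g: "vs.dim (Kr d A (m - 1) (V d)) \<le> vs.dim (NI d A (V d)) + 1"
  obtains h where "jordan_basis d m A h"
proof -
  let ?V = "V d :: (nat \<Rightarrow> 'k) set"
  define I where "I = Img d A (m - 1) ?V"
  define q where "q = vs.dim I"
  define S where "S b = Kr d A 1 (Img d A b ?V)" for b
  have sI: "vs.subspace I" unfolding I_def by auto
  have IV: "I \<subseteq> ?V" unfolding I_def by (rule Img_V) simp
  have sS: "vs.subspace (S b)" for b unfolding S_def by auto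
  have SV: "S b \<subseteq> ?V" for b unfolding S_def using Kr_sub Img_V[OF order_refl] by blast
  have st: "\<And>v. v \<in> ?V \<Longrightarrow> app d A v \<in> ?V" by simp
  have m1: "Suc (m - 1) = m" using m by simp
  have IS: "I \<subseteq> S b" if "b \<le> m - 1" for b
    unfolding I_def S_def by (rule last_image_soc[OF st _ that]) (use nil m1 in simp_all)
  have Smono: "S b' \<subseteq> S b" if "b \<le> b'" for b b' unfolding S_def by (rule soc_antimono[OF st that])
  \<comment> \<open>\<open>dim (ker A)\<close> is the number of all blocks, q the number of full
    ones.\<close>
  have dS0: "vs.dim (S 0) \<le> q + 1"
  proof -
    have "d = vs.dim (Kr d A (m - 1) ?V) + q" unfolding q_def I_def
      using dim_Kr_Img[of ?V d A "m - 1"] by (simp add: dim_V)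
    moreover have "d = vs.dim (Kr d A 1 ?V) + vs.dim (Img d A 1 ?V)"
      using dim_Kr_Img[of ?V d A 1] by (simp add: dim_V)
    moreover have "S 0 = Kr d A 1 ?V" unfolding S_def by simp
    ultimately show ?thesis using g by simp
  qed
  have "S (m - 1) \<subseteq> I" unfolding S_def I_def by (rule Kr_sub)
  define r where "r = (LEAST b. S b \<subseteq> I)"
  have r1: "S r \<subseteq> I" unfolding r_def by (rule LeastI) fact
  have r2: "r \<le> m - 1" unfolding r_def by (rule Least_le) fact
  have r3: "\<not> S b \<subseteq> I" if "b < r" for b using not_less_Least that unfolding r_def by blast
  obtain c where c: "indepf q c" "\<And>i. i < q \<Longrightarrow> c i \<in> I" unfolding q_def by (rule dim_indepf[OF IV]) blast
  have Isp: "I = vs.span (c ` {..<q})" by (rule indepf_spans[OF c sI IV]) (simp_all add: q_def)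
  have "\<forall>i. \<exists>v. i < q \<longrightarrow> v \<in> ?V \<and> c i = (app d A ^^ (m - 1)) v" using c(2) unfolding I_def by blast
  then obtain w where w: "\<And>i. i < q \<Longrightarrow> w i \<in> ?V \<and> c i = (app d A ^^ (m - 1)) (w i)" by metis
  \<comment> \<open>For r = 0 there is no short block, and zero vectors serve as
    placeholders.\<close>
  have "\<exists>e z. e \<in> ?V \<and> z = (app d A ^^ (r - 1)) e \<and> (app d A ^^ r) e = 0 \<and> (r > 0 \<longrightarrow> z \<in> S (r - 1) \<and> z \<notin> I)"
  proof (cases "r = 0")
    case True
    then show ?thesis by (intro exI[of _ 0] exI[of _ "0 :: nat \<Rightarrow> 'k"]) (simp add: vs.subspace_0)
  next
    case False
    then obtain z where z: "z \<in> S (r - 1)" "z \<notin> I" using r3[of "r - 1"] by auto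
    then obtain e where e: "e \<in> ?V" "z = (app d A ^^ (r - 1)) e" unfolding S_def Kr_def by blast
    have "(app d A ^^ Suc (r - 1)) e = 0" using z(1) e(2) unfolding S_def Kr_def by simp
    then have "(app d A ^^ r) e = 0" using False by simp
    then show ?thesis using e z by blast
  qed
  then obtain e z where e: "e \<in> ?V" "z = (app d A ^^ (r - 1)) e" "(app d A ^^ r) e = 0"
    and z: "r > 0 \<Longrightarrow> z \<in> S (r - 1) \<and> z \<notin> I" by blast
  define wx where "wx i = (if i < q then w i else e)" for i
  define h where "h k = (app d A ^^ (k mod m)) (wx (k div m))" for k
  define n where "n = q * m + r"
  have wxV: "wx i \<in> ?V" for i unfolding wx_def using w e by auto
  have hV: "h k \<in> ?V" for k unfolding h_def by (rule apow_V[OF wxV])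
  have rm: "r < m" using r2 m by simp
  have hw: "(app d A ^^ j) (w i) = h (i * m + j)" if "i < q" "j < m" for i j
    unfolding h_def wx_def using that by simp
  have he: "(app d A ^^ j) e = h (q * m + j)" if "j < m" for j
    unfolding h_def wx_def using that by simp
  have iq: "i * m + j < n" if "i < q" "j < m" for i j
  proof -
    have "i * m + j < Suc i * m" using that by simp
    also have "\<dots> \<le> q * m" using that by (intro mult_le_mono1) simp
    finally show ?thesis unfolding n_def by simp
  qed
  have nd: "n \<le> d"
  proof -
    have "Img d A m ?V \<subseteq> {0}" using nil by blast
    have "(\<Sum>b<m. q + (if b < r then 1 else 0)) \<le> (\<Sum>b<m. vs.dim (S b))"
    proof (rule sum_mono)
      fix b assume "b \<in> {..<m}"
      then have bm: "b \<le> m - 1" by auto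
      show "q + (if b < r then 1 else 0) \<le> vs.dim (S b)"
      proof (cases "b < r")
        case True
        then have "I \<subset> S b" using IS[OF bm] r3 by blast
        from dim_psubset_V[OF sI this SV sS] show ?thesis using True unfolding q_def by simp
      next
        case False
        then show ?thesis using dim_mono_V[OF IS[OF bm] SV] unfolding q_def by simp
      qed
    qed
    moreover have "(\<Sum>b<m. q + (if b < r then 1 else 0)) = n"
    proof -
      have "(\<Sum>b<m. if b < r then 1 else 0 :: nat) = (\<Sum>b<r. 1)"
        by (rule sum.mono_neutral_cong_right) (use rm in auto)
      then show ?thesis unfolding n_def by (simp add: sum.distrib)
    qed
    moreover have "(\<Sum>b<m. vs.dim (S b)) \<le> d"
      using dim_sum_socles[where X="?V" and d=d and k=m and A=A] unfolding S_def by (simp add: dim_V)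
    ultimately show ?thesis by simp
  qed
  define F where "F = vs.span (h ` {..<n})"
  have sF: "vs.subspace F" unfolding F_def by simp
  have hF: "h k \<in> F" if "k < n" for k unfolding F_def using that by (intro vs.span_base) auto
  have IF: "I \<subseteq> Img d A b F" if "b < m" for b
    unfolding Isp
  proof (rule span_V)
    fix i assume i: "i < q"
    have "c i = (app d A ^^ b) ((app d A ^^ (m - 1 - b)) (w i))"
      using w[OF i] that by (metis Nat.le_diff_conv2 add.commute comp_apply funpow_add le_add_diff_inverse
          less_Suc_eq_le m1)
    moreover have "(app d A ^^ (m - 1 - b)) (w i) \<in> F"
      unfolding hw[OF i, of "m - 1 - b", OF diff_less_Suc[of "m - 1" b, unfolded m1]]
      by (intro hF iq i) (use that in simp)
    ultimately show "c i \<in> Img d A b F" by blast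
  qed (use sF in auto)
  have SF: "S b \<subseteq> Img d A b F" if b: "b < m" for b
  proof (cases "b < r")
    case False
    then show ?thesis using Smono[of r b] r1 IF[OF b] by auto
  next
    case True
    then have r0: "r > 0" by simp
    note z = z[OF r0]
    have zV: "z \<in> ?V" using z SV by blast
    have 1: "ssum I (line z) \<subseteq> S 0"
      by (rule ssum_least[OF IS line_subset[OF _ sS] sS]) (use z Smono[of 0 "r - 1"] in auto)
    have "vs.dim (ssum I (line z)) = Suc q" unfolding q_def
      by (rule dim_insert_V[OF sI IV zV]) (use z in blast)
    then have "ssum I (line z) = S 0"
      using dS0 by (intro dim_eq_V[OF _ 1 SV sS]) (use sI in auto)
    then have S0: "S b \<subseteq> ssum I (line z)" using Smono[of 0 b] by simp
    have "z = (app d A ^^ b) ((app d A ^^ (r - 1 - b)) e)"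
    proof -
      have "r - 1 = b + (r - 1 - b)" using True by simp
      then show ?thesis unfolding e(2) by (metis comp_apply funpow_add)
    qed
    moreover have "(app d A ^^ (r - 1 - b)) e \<in> F"
      unfolding he[OF less_imp_diff_less[OF less_imp_diff_less[OF rm]]]
      by (rule hF) (use r0 in \<open>simp add: n_def\<close>)
    ultimately have "z \<in> Img d A b F" by blast
    then have "line z \<subseteq> Img d A b F" using sF by (intro line_subset) auto
    then have "ssum I (line z) \<subseteq> Img d A b F" using IF[OF b] sF by (intro ssum_least) auto
    then show ?thesis using S0 by blast
  qed
  \<comment> \<open>If \<open>A^(b+1) v = 0\<close>, then \<open>A^b v\<close> is a socle vector of
    \<open>A^b V\<close> and hence equals \<open>A^b x\<close> for some x in \<open>F\<close>; the
    difference v - x is killed by \<open>A^b\<close>.\<close>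
  have KF: "b \<le> m \<Longrightarrow> Kr d A b ?V \<subseteq> F" for b
  proof (induction b)
    case 0 show ?case using vs.subspace_0[OF sF] by (auto simp: Kr_def)
  next
    case (Suc b)
    show ?case
    proof
      fix v assume v: "v \<in> Kr d A (Suc b) ?V"
      then have vV: "v \<in> ?V" using Kr_sub by blast
      have "app d A ((app d A ^^ b) v) = 0" using v by (simp add: Kr_def)
      then have "(app d A ^^ b) v \<in> S b" unfolding S_def using vV by (simp add: Kr_def)
      then obtain x where x: "x \<in> F" "(app d A ^^ b) v = (app d A ^^ b) x" using SF[of b] Suc.prems by auto
      have "x \<in> ?V" using x(1) span_V[of n h ?V] hV unfolding F_def by auto
      then have "v - x \<in> ?V" using vV by (intro vs.subspace_diff) auto
      then have "v - x \<in> Kr d A b ?V" using x(2) by (simp add: Kr_def apow_diff)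
      then have "v - x \<in> F" using Suc by auto
      then have "v - x + x \<in> F" using x(1) by (intro vs.subspace_add[OF sF])
      then show "v \<in> F" by simp
    qed
  qed
  have VF: "?V \<subseteq> F" using KF[OF order_refl] nil by (auto simp: Kr_def)
  have "d \<le> n"
    using dim_mono_V[OF VF, of d] span_V[of n h ?V] hV dim_span_le[of h n] unfolding F_def
    by (auto simp: dim_V)
  then have nd: "n = d" using nd by simp
  have ind: "indepf d h" by (rule span_indepf) (use VF in \<open>simp add: F_def nd\<close>)
  have "app d A (h k) = (if jnext d m k then h (Suc k) else 0)" if k: "k < d" for k
  proof (cases "jnext d m k")
    case True
    then have "Suc k mod m = Suc (k mod m)" "Suc k div m = k div m"
      unfolding jnext_def by (auto simp: mod_Suc div_Suc dvd_eq_mod_eq_0)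
    then show ?thesis using True by (simp add: h_def)
  next
    case False
    have "app d A (h k) = (app d A ^^ Suc (k mod m)) (wx (k div m))" by (simp add: h_def)
    also have "\<dots> = 0"
    proof (cases "m dvd Suc k")
      case True
      then have "Suc (k mod m) = m" by (metis dvd_eq_mod_eq_0 mod_Suc nat.simps(3))
      then show ?thesis using nil[OF wxV] by simp
    next
      case nd': False
      then have d: "Suc k = q * m + r" using False k nd unfolding jnext_def n_def by auto
      then have r0: "r > 0" using nd' by (cases r) auto
      then have "k = q * m + (r - 1)" using d by simp
      then have "k div m = q" "k mod m = r - 1" using rm by auto
      then show ?thesis using e(3) r0 by (simp add: wx_def)
    qed
    finally show ?thesis using False by simp
  qed
  then have "jordan_basis d m A h" unfolding jordan_basis_def using hV ind by blast
  then show ?thesis by (rule that)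
qed

section \<open>Adapted flags\<close>

text \<open>The position of \<open>j < n\<close> in a flag with \<open>m\<close> layers, the last of which has dimension \<open>\<lfloor>n / m\<rfloor>\<close>, the
  one before it \<open>\<lfloor>n' / (m - 1)\<rfloor>\<close> for \<open>n' = n - \<lfloor>n / m\<rfloor>\<close>, and so on.\<close>

primrec lab :: "nat \<Rightarrow> nat \<Rightarrow> nat \<Rightarrow> nat" where
  "lab 0 n j = 0"
| "lab (Suc m) n j = (if j < n - n div Suc m then lab m (n - n div Suc m) j else m)"

lemma lab_less: "0 < m \<Longrightarrow> j < n \<Longrightarrow> lab m n j < m"
proof (induction m arbitrary: n)
  case (Suc m)
  show ?case
  proof (cases "j < n - n div Suc m")
    case True
    then have "0 < m" by (cases m) auto
    then show ?thesis using Suc.IH[OF _ True] True by (simp add: less_SucI)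
  next
    case False
    then show ?thesis by simp
  qed
qed simp

lemma subspace_between:
  assumes "vs.subspace L" "vs.subspace K" "L \<subseteq> K" "K \<subseteq> V d" "vs.dim L \<le> n" "n \<le> vs.dim K"
  shows "\<exists>F. vs.subspace F \<and> L \<subseteq> F \<and> F \<subseteq> K \<and> vs.dim F = n"
  using assms
proof (induction "n - vs.dim L" arbitrary: L)
  case 0
  then show ?case by (intro exI[of _ L]) auto
next
  case (Suc x)
  have LV: "L \<subseteq> V d" using Suc.prems by blast
  have "L \<noteq> K" using Suc.hyps(2) Suc.prems(6) by auto
  then obtain z where z: "z \<in> K" "z \<notin> L" using Suc.prems(3) by blast
  have dz: "vs.dim (ssum L (line z)) = Suc (vs.dim L)"
    by (rule dim_insert_V[OF Suc.prems(1) LV _ z(2)]) (use z Suc.prems(4) in blast)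
  have "\<exists>F. vs.subspace F \<and> ssum L (line z) \<subseteq> F \<and> F \<subseteq> K \<and> vs.dim F = n"
  proof (rule Suc.hyps(1))
    show "x = n - vs.dim (ssum L (line z))" using dz Suc.hyps(2) by simp
    show "vs.subspace (ssum L (line z))" using Suc.prems(1) by auto
    show "ssum L (line z) \<subseteq> K" by (rule ssum_least[OF Suc.prems(3) line_subset[OF z(1) Suc.prems(2)] Suc.prems(2)])
    show "vs.dim (ssum L (line z)) \<le> n" using dz Suc.hyps(2) by simp
  qed (use Suc.prems in auto)
  moreover have "L \<subseteq> ssum L (line z)" using in_ssumI1 by blast
  ultimately show ?case by blast
qed

lemma indepf_snoc:
  assumes "indepf k b" "z \<notin> vs.span (b ` {..<k})" shows "indepf (Suc k) (b(k := z))"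
  unfolding indepf_def
proof (intro allI impI)
  fix \<alpha> i assume a: "\<forall>x. (\<Sum>i<Suc k. \<alpha> i * (b(k := z)) i x) = 0" and i: "i < Suc k"
  have s: "(\<Sum>i<k. \<alpha> i * b i x) + \<alpha> k * z x = 0" for x
  proof -
    have "(\<Sum>i<k. \<alpha> i * (b(k := z)) i x) = (\<Sum>i<k. \<alpha> i * b i x)" by (rule sum.cong) auto
    then show ?thesis using a[rule_format, of x] unfolding sum.lessThan_Suc by simp
  qed
  have k0: "\<alpha> k = 0"
  proof (rule ccontr)
    assume nz: "\<alpha> k \<noteq> 0"
    have "(\<Sum>i<k. sc (\<alpha> i) (b i)) + sc (\<alpha> k) z = 0"
    proof
      fix x show "((\<Sum>i<k. sc (\<alpha> i) (b i)) + sc (\<alpha> k) z) x = 0 x"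
        using s[of x] by (simp add: plus_fun_apply sum_fun_apply sc_apply zero_fun_apply)
    qed
    then have "(\<Sum>i<k. sc (\<alpha> i) (b i)) = sc (- \<alpha> k) z"
      by (simp add: vs.scale_minus_left eq_neg_iff_add_eq_0)
    then have "z = sc (- 1 / \<alpha> k) (\<Sum>i<k. sc (\<alpha> i) (b i))" using nz by simp
    also have "\<dots> \<in> vs.span (b ` {..<k})"
      by (intro vs.span_scale vs.span_sum vs.span_base) auto
    finally show False using assms(2) by blast
  qed
  then have "(\<Sum>i<k. \<alpha> i * b i x) = 0" for x using s[of x] by simp
  then have "\<alpha> i = 0" if "i < k" for i using indepfD[OF assms(1) _ that] by blast
  then show "\<alpha> i = 0" using k0 i less_Suc_eq by auto
qed

lemma indepf_extend:
  assumes "indepf k b" "\<And>i. i < k \<Longrightarrow> b i \<in> X" "vs.subspace X" "X \<subseteq> V d"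
  shows "\<exists>b'. (\<forall>i<k. b' i = b i) \<and> indepf (vs.dim X) b' \<and> (\<forall>i<vs.dim X. b' i \<in> X)"
  using assms
proof (induction "vs.dim X - k" arbitrary: k b)
  case 0
  have "k \<le> vs.dim X" by (rule indepf_le_dim[OF 0(2) _ 0(5)]) (use 0 in blast)
  then have "k = vs.dim X" using 0 by simp
  then show ?case using 0 by blast
next
  case (Suc x)
  have "\<not> X \<subseteq> vs.span (b ` {..<k})"
  proof
    assume a: "X \<subseteq> vs.span (b ` {..<k})"
    have "vs.span (b ` {..<k}) \<subseteq> V d" using span_V[of k b X] Suc.prems by blast
    then have "vs.dim X \<le> k" using dim_mono_V[OF a] dim_span_le[of b k] by (meson order_trans)
    then show False using Suc.hyps(2) by simp
  qed
  then obtain z where z: "z \<in> X" "z \<notin> vs.span (b ` {..<k})" by blast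
  have "\<exists>b'. (\<forall>i<Suc k. b' i = (b(k := z)) i) \<and> indepf (vs.dim X) b' \<and> (\<forall>i<vs.dim X. b' i \<in> X)"
  proof (rule Suc.hyps(1))
    show "x = vs.dim X - Suc k" using Suc.hyps(2) by simp
    show "indepf (Suc k) (b(k := z))" by (rule indepf_snoc[OF Suc.prems(1) z(2)])
    show "(b(k := z)) i \<in> X" if "i < Suc k" for i using that Suc.prems(2) z(1) less_Suc_eq by auto
  qed (use Suc.prems in auto)
  then obtain b' where b': "\<forall>i<Suc k. b' i = (b(k := z)) i" "indepf (vs.dim X) b'" "\<forall>i<vs.dim X. b' i \<in> X" by blast
  have "\<forall>i<k. b' i = b i" using b'(1) by auto
  then show ?case using b' by blast
qed

text \<open>\<open>A\<close> maps the kernel of \<open>A^(b+1)\<close> into that of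
  \<open>A^b\<close>, with fibres no larger than \<open>ker A\<close>.\<close>

lemma dim_Kr_le:
  assumes X: "vs.subspace X" "X \<subseteq> V d" "\<And>v. v \<in> X \<Longrightarrow> app d A v \<in> X"
  shows "vs.dim (Kr d A b X) \<le> b * vs.dim (Kr d A 1 X)"
proof (induction b)
  case 0
  have "Kr d A 0 X \<subseteq> vs.span {}" by (auto simp: Kr_def)
  then have "vs.dim (Kr d A 0 X) \<le> card ({} :: (nat \<Rightarrow> 'a) set)" by (rule vs.dim_le_card) simp
  then show ?case by simp
next
  case (Suc b)
  let ?K = "Kr d A (Suc b) X"
  have K: "vs.subspace ?K" "?K \<subseteq> V d" using X Kr_sub by blast+
  have "vs.dim ?K = vs.dim {v \<in> ?K. app d A v = 0} + vs.dim (app d A ` ?K)"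
    by (rule rank_nullity[OF lin_app K])
  moreover have "vs.dim {v \<in> ?K. app d A v = 0} \<le> vs.dim (Kr d A 1 X)"
    by (rule dim_mono_V[of _ _ d]) (use X Kr_sub in \<open>auto simp: Kr_def\<close>)
  moreover have "vs.dim (app d A ` ?K) \<le> vs.dim (Kr d A b X)"
  proof (rule dim_mono_V[of _ _ d])
    show "app d A ` ?K \<subseteq> Kr d A b X"
      using X(3) unfolding Kr_def by (auto simp: funpow_swap1)
    show "Kr d A b X \<subseteq> V d" using X Kr_sub by blast
  qed
  ultimately show ?case using Suc.IH by simp
qed

text \<open>For nilpotency \<open>Suc m\<close>, the top layer is split off by a subspace F between
  \<open>E X\<close> and \<open>ker E^m\<close>; on F the m-th power vanishes and the induction
  continues. The codimension \<open>n div Suc m\<close> can be fixed beforehand: the codimension of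
  the kernel is the number of blocks of size \<open>Suc m\<close>, which is at most that, and the
  codimension of \<open>E X\<close> is the number of all blocks, which is at least that. The vector
  u will be the image in \<open>V / U\<close> of the top of the last Jordan block.\<close>

lemma adapted_flag_basis:
  assumes "vs.subspace X" "X \<subseteq> V d" "\<And>v. v \<in> X \<Longrightarrow> app d E v \<in> X" "\<And>v. v \<in> X \<Longrightarrow> (app d E ^^ m) v = 0"
    "u \<in> X" "(app d E ^^ r) u = 0"
  shows "\<exists>b. indepf (vs.dim X) b \<and> (\<forall>k<vs.dim X. b k \<in> X) \<and>
    (\<forall>k<vs.dim X. app d E (b k) \<in> vs.span (b ` {j. j < vs.dim X \<and> lab m (vs.dim X) j < lab m (vs.dim X) k})) \<and>
    u \<in> vs.span (b ` {j. j < vs.dim X \<and> lab m (vs.dim X) j < r})"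
  using assms
proof (induction m arbitrary: X u)
  case 0
  have X0: "X \<subseteq> vs.span {}" using 0(4) by auto
  then have "vs.dim X \<le> card ({} :: (nat \<Rightarrow> 'a) set)" by (rule vs.dim_le_card) simp
  then have d0: "vs.dim X = 0" by simp
  have "u \<in> vs.span {}" using X0 0(5) by blast
  then show ?case unfolding d0 by (simp add: indepf_def)
next
  case (Suc m)
  note X = Suc.prems(1,2) and st = Suc.prems(3) and nil = Suc.prems(4)
  define n p n' where "n = vs.dim X" and "p = n div Suc m" and "n' = n - n div Suc m"
  define N K where "N = NI d E X" and "K = Kr d E m X"
  have sN: "vs.subspace N" and sK: "vs.subspace K" unfolding N_def K_def using X(1) by auto
  have NX: "N \<subseteq> X" unfolding N_def using st by blast
  have KX: "K \<subseteq> X" unfolding K_def by (rule Kr_sub)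
  have KV: "K \<subseteq> V d" and NV: "N \<subseteq> V d" using KX NX X(2) by blast+
  have NK: "N \<subseteq> K" unfolding N_def K_def using NI_Kr[OF st nil] by simp
  have "Suc m * vs.dim (Img d E m X) \<le> n"
  proof -
    have "(\<Sum>b<Suc m. vs.dim (Img d E m X)) \<le> (\<Sum>b<Suc m. vs.dim (Kr d E 1 (Img d E b X)))"
    proof (rule sum_mono)
      fix b assume "b \<in> {..<Suc m}"
      then have "b \<le> m" by simp
      have "Img d E m X \<subseteq> Kr d E 1 (Img d E b X)" by (rule last_image_soc[OF st nil \<open>b \<le> m\<close>])
      then show "vs.dim (Img d E m X) \<le> vs.dim (Kr d E 1 (Img d E b X))"
        by (rule dim_mono_V) (rule subset_trans[OF Kr_sub Img_V[OF X(2)]])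
    qed
    also have "\<dots> \<le> n" unfolding n_def using dim_sum_socles[OF X, where k="Suc m" and A=E] by simp
    finally show ?thesis by simp
  qed
  then have "vs.dim (Img d E m X) \<le> p" unfolding p_def
    by (metis mult.commute div_le_mono nonzero_mult_div_cancel_left nat.simps(3))
  moreover have dimK: "n = vs.dim K + vs.dim (Img d E m X)" unfolding n_def K_def by (rule dim_Kr_Img[OF X])
  ultimately have nK: "n' \<le> vs.dim K" unfolding n'_def p_def by linarith
  define k1 where "k1 = vs.dim (Kr d E 1 X)"
  have dimN: "n = k1 + vs.dim N" unfolding n_def k1_def N_def using dim_Kr_Img[OF X, of E 1] by simp
  have Xeq: "Kr d E (Suc m) X = X" using nil unfolding Kr_def by blast
  have nk1: "n \<le> Suc m * k1" using dim_Kr_le[OF X st, of "Suc m"] unfolding Xeq n_def k1_def .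
  then have pk1: "p \<le> k1" unfolding p_def
    by (metis div_le_mono nonzero_mult_div_cancel_left nat.simps(3))
  have uK: "u \<in> K" if "r \<le> m"
    using Suc.prems(5,6) Kr_mono[OF that, of d E X] unfolding K_def Kr_def by blast
  \<comment> \<open>For r at most m, u must be kept in F; for larger r every layer is open to u, and
    the induction is run with the zero vector instead.\<close>
  define L where "L = (if r \<le> m then ssum N (line u) else N)"
  have sL: "vs.subspace L" unfolding L_def using sN by auto
  have NL: "N \<subseteq> L" unfolding L_def using in_ssumI1[OF _ subspace_line] by auto
  have LK: "L \<subseteq> K" unfolding L_def using NK uK ssum_least[OF NK line_subset[OF _ sK] sK] by auto
  have dL: "vs.dim L \<le> n'"
  proof (cases "r \<le> m \<and> u \<notin> N")
    case False
    have "L \<subseteq> N" unfolding L_def using False ssum_least[OF order_refl line_subset[OF _ sN] sN] by auto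
    then have "vs.dim L \<le> vs.dim N" using dim_mono_V NV by blast
    then show ?thesis using dimN pk1 unfolding n'_def p_def by linarith
  next
    case True
    have uV: "u \<in> V d" using Suc.prems(5) X(2) by blast
    have L1: "vs.dim L \<le> Suc (vs.dim N)" unfolding L_def using True dim_ssum_line_le[OF sN NV uV] by simp
    \<comment> \<open>This makes room for u: with exactly p blocks all would have full size, so that
      \<open>E X\<close> would equal \<open>ker E^m\<close> and already contain u.\<close>
    have "p < k1"
    proof (rule ccontr)
      assume "\<not> p < k1"
      then have pk: "p = k1" using pk1 by simp
      have "p * Suc m \<le> n" unfolding p_def by (rule div_times_less_eq_dividend)
      then have "n = Suc m * p" using nk1 unfolding pk by (simp add: mult.commute)
      then have "vs.dim N = m * p" using dimN pk by simp
      moreover have "vs.dim K \<le> m * p" using dim_Kr_le[OF X st, of m] unfolding K_def pk k1_def .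
      ultimately have "N = K" by (intro dim_eq_V[OF sN NK KV sK]) simp
      then show False using uK True by blast
    qed
    then show ?thesis using L1 dimN unfolding n'_def p_def by linarith
  qed
  obtain F where F: "vs.subspace F" "L \<subseteq> F" "F \<subseteq> K" "vs.dim F = n'"
    using subspace_between[OF sL sK LK KV dL nK] by blast
  have FV: "F \<subseteq> V d" using F(3) KV by blast
  define u' where "u' = (if r \<le> m then u else 0)"
  have "u' \<in> F"
  proof (cases "r \<le> m")
    case True
    have "u \<in> L" unfolding L_def using True in_ssumI2[OF self_in_line sN] by simp
    then show ?thesis using F(2) True unfolding u'_def by auto
  next
    case False then show ?thesis unfolding u'_def using vs.subspace_0[OF F(1)] by simp
  qed
  moreover have "(app d E ^^ r) u' = 0" unfolding u'_def using Suc.prems(6) by simp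
  moreover have "app d E v \<in> F" if "v \<in> F" for v
    using that F(2,3) KX NL unfolding N_def by blast
  moreover have "(app d E ^^ m) v = 0" if "v \<in> F" for v using that F(3) unfolding K_def Kr_def by blast
  ultimately obtain b where b: "indepf n' b" "\<forall>k<n'. b k \<in> F"
    "\<forall>k<n'. app d E (b k) \<in> vs.span (b ` {j. j < n' \<and> lab m n' j < lab m n' k})"
    "u' \<in> vs.span (b ` {j. j < n' \<and> lab m n' j < r})"
    using Suc.IH[OF F(1) FV, of u'] unfolding F(4) by blast
  have "\<And>i. i < n' \<Longrightarrow> b i \<in> X" using b(2) F(3) KX by blast
  then obtain b' where b': "\<forall>i<n'. b' i = b i" "indepf n b'" "\<forall>i<n. b' i \<in> X"
    using indepf_extend[OF b(1) _ X] unfolding n_def by blast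
  have nn: "n' \<le> n" unfolding n'_def by simp
  have lab1: "lab (Suc m) n j = lab m n' j" if "j < n'" for j using that unfolding n'_def by simp
  have lab2: "lab (Suc m) n j = m" if "\<not> j < n'" for j using that unfolding n'_def by simp
  have im: "b ` {j. j < n' \<and> lab m n' j < s} \<subseteq> b' ` {j. j < n \<and> lab (Suc m) n j < s}" for s
  proof
    fix y assume "y \<in> b ` {j. j < n' \<and> lab m n' j < s}"
    then obtain j where "j < n'" "lab m n' j < s" "y = b j" by blast
    then show "y \<in> b' ` {j. j < n \<and> lab (Suc m) n j < s}" using lab1 b'(1) nn by (intro image_eqI[of _ _ j]) auto
  qed
  have Fsp: "F = vs.span (b ` {..<n'})" by (rule indepf_spans[OF b(1) _ F(1) FV]) (use b(2) F(4) in auto)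
  have 1: "app d E (b' k) \<in> vs.span (b' ` {j. j < n \<and> lab (Suc m) n j < lab (Suc m) n k})" if k: "k < n" for k
  proof (cases "k < n'")
    case True
    then have "app d E (b' k) \<in> vs.span (b ` {j. j < n' \<and> lab m n' j < lab m n' k})" using b(3) b'(1) by simp
    then show ?thesis unfolding lab1[OF True] using vs.span_mono[OF im] by blast
  next
    case False
    have "app d E (b' k) \<in> N" unfolding N_def using b'(3) k by blast
    then have "app d E (b' k) \<in> vs.span (b ` {..<n'})" using NL F(2) Fsp by blast
    moreover have "lab m n' j < m" if "j < n'" for j
    proof (rule lab_less[OF _ that])
      show "0 < m"
      proof (rule ccontr)
        assume "\<not> 0 < m"
        then show False using that unfolding n'_def by simp
      qed
    qed
    then have "b ` {..<n'} \<subseteq> b ` {j. j < n' \<and> lab m n' j < m}" by blast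
    ultimately have "app d E (b' k) \<in> vs.span (b ` {j. j < n' \<and> lab m n' j < m})" using vs.span_mono by blast
    then show ?thesis unfolding lab2[OF False] using vs.span_mono[OF im] by blast
  qed
  have 2: "u \<in> vs.span (b' ` {j. j < n \<and> lab (Suc m) n j < r})"
  proof (cases "r \<le> m")
    case True
    then have "u \<in> vs.span (b ` {j. j < n' \<and> lab m n' j < r})" using b(4) unfolding u'_def by simp
    then show ?thesis using vs.span_mono[OF im] by blast
  next
    case False
    have "X = vs.span (b' ` {..<n})" by (rule indepf_spans[OF b'(2) _ X]) (use b'(3) n_def in auto)
    then have "u \<in> vs.span (b' ` {..<n})" using Suc.prems(5) by blast
    moreover have "{j. j < n \<and> lab (Suc m) n j < r} = {..<n}"
    proof -
      have "lab (Suc m) n j < r" if "j < n" for j using lab_less[OF _ that, of "Suc m"] False by simp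
      then show ?thesis by blast
    qed
    ultimately show ?thesis by simp
  qed
  show ?case using b'(2,3) 1 2 unfolding n_def by blast
qed

lemma span_coeffs:
  assumes "v \<in> vs.span (b ` J)" "finite J"
  shows "\<exists>\<alpha>. (\<forall>j. j \<notin> J \<longrightarrow> \<alpha> j = 0) \<and> v = (\<Sum>j\<in>J. sc (\<alpha> j) (b j))"
proof -
  let ?S = "{v. \<exists>\<alpha>. (\<forall>j. j \<notin> J \<longrightarrow> \<alpha> j = 0) \<and> v = (\<Sum>j\<in>J. sc (\<alpha> j) (b j))}"
  have "vs.subspace ?S"
    unfolding subspace_iff
  proof (intro conjI ballI allI)
    show "0 \<in> ?S" by (intro CollectI exI[of _ "\<lambda>j. 0"]) simp
    fix x y assume "x \<in> ?S" "y \<in> ?S"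
    then obtain \<alpha> \<beta> where "\<forall>j. j \<notin> J \<longrightarrow> \<alpha> j = 0" "x = (\<Sum>j\<in>J. sc (\<alpha> j) (b j))"
      "\<forall>j. j \<notin> J \<longrightarrow> \<beta> j = 0" "y = (\<Sum>j\<in>J. sc (\<beta> j) (b j))" by blast
    then show "x + y \<in> ?S"
      by (intro CollectI exI[of _ "\<lambda>j. \<alpha> j + \<beta> j"]) (simp add: vs.scale_left_distrib sum.distrib)
  next
    fix c x assume "x \<in> ?S"
    then obtain \<alpha> where "\<forall>j. j \<notin> J \<longrightarrow> \<alpha> j = 0" "x = (\<Sum>j\<in>J. sc (\<alpha> j) (b j))" by blast
    then show "sc c x \<in> ?S"
      by (intro CollectI exI[of _ "\<lambda>j. c * \<alpha> j"]) (simp add: vs.scale_sum_right)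
  qed
  moreover have "b ` J \<subseteq> ?S"
  proof
    fix y assume "y \<in> b ` J"
    then obtain j where j: "j \<in> J" "y = b j" by blast
    have "(\<Sum>i\<in>J. sc (if i = j then 1 else 0) (b i)) = (\<Sum>i\<in>J. if i = j then b i else 0)"
      by (rule sum.cong) auto
    then have "y = (\<Sum>i\<in>J. sc (if i = j then 1 else 0) (b i))" using j assms(2) by simp
    then show "y \<in> ?S" using j(1) by (intro CollectI exI[of _ "\<lambda>i. if i = j then 1 else 0"]) auto
  qed
  ultimately have "vs.span (b ` J) \<subseteq> ?S" by (intro vs.span_minimal)
  then show ?thesis using assms(1) by blast
qed

section \<open>Parametrising generic operators\<close>

text \<open>The projection to \<open>V / U\<close> in coordinates, renumbered from 0. Below,
  \<open>up\<close> is a section of it and \<open>corner\<close> the matrix that an operator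
  preserving \<open>U\<close> induces on \<open>V / U\<close>.\<close>

definition low :: "nat \<Rightarrow> nat \<Rightarrow> (nat \<Rightarrow> 'k::field) \<Rightarrow> nat \<Rightarrow> 'k" where
  "low d0 d1 v = (\<lambda>i. if i < d1 then v (d0 + i) else 0)"

definition up :: "nat \<Rightarrow> nat \<Rightarrow> (nat \<Rightarrow> 'k::field) \<Rightarrow> nat \<Rightarrow> 'k" where
  "up d0 d1 v = (\<lambda>i. if d0 \<le> i \<and> i < d0 + d1 then v (i - d0) else 0)"

definition corner :: "nat \<Rightarrow> (nat \<Rightarrow> nat \<Rightarrow> 'k) \<Rightarrow> nat \<Rightarrow> nat \<Rightarrow> 'k" where
  "corner d0 A = (\<lambda>i j. A (d0 + i) (d0 + j))"

lemma lin_low: "lin (low d0 d1)"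
  by (rule linI) (auto simp: low_def fun_eq_iff fun_simps)

lemma low_0 [simp]: "low d0 d1 0 = 0"
  by (rule lin_0[OF lin_low])

lemma low_V [simp]: "low d0 d1 v \<in> V d1"
  by (auto simp: low_def supp_sp_def)

lemma up_V [simp]: "up d0 d1 v \<in> V (d0 + d1)"
  by (auto simp: up_def supp_sp_def)

lemma low_up: "v \<in> V d1 \<Longrightarrow> low d0 d1 (up d0 d1 v) = v"
  by (auto simp: low_def up_def fun_eq_iff V_out)

lemma low_U: "u \<in> supp_sp (d0 + d1) {..<d0} \<Longrightarrow> low d0 d1 u = 0"
  by (auto simp: low_def supp_sp_def fun_eq_iff zero_fun_apply)

lemma low_0_U: "v \<in> V (d0 + d1) \<Longrightarrow> low d0 d1 v = 0 \<Longrightarrow> v \<in> supp_sp (d0 + d1) {..<d0}"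
proof -
  assume v: "v \<in> V (d0 + d1)" and l: "low d0 d1 v = 0"
  have "v i = 0" if "\<not> i < d0" "i < d0 + d1" for i
  proof -
    have "low d0 d1 v (i - d0) = 0" unfolding l by (simp add: zero_fun_apply)
    moreover have "i - d0 < d1" "d0 + (i - d0) = i" using that by simp_all
    ultimately show ?thesis by (simp add: low_def)
  qed
  then show ?thesis using v unfolding supp_sp_def by auto
qed

lemma sum_split_nat: "(\<Sum>j<a + b. f j) = (\<Sum>j<a. f j) + (\<Sum>j<b. f (a + j))"
  for f :: "nat \<Rightarrow> 'a::comm_monoid_add"
  by (induction b) (simp_all add: add.assoc)

lemma low_app:
  assumes ok: "ok (d0 + d1) m {..<d0} A" and v: "v \<in> V (d0 + d1)"
  shows "low d0 d1 (app (d0 + d1) A v) = app d1 (corner d0 A) (low d0 d1 v)"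
proof -
  obtain p q where pq: "p \<in> supp_sp (d0 + d1) {..<d0}" "q \<in> supp_sp (d0 + d1) (- {..<d0})" "v = p + q"
    using split_Q[OF v] by blast
  have lp: "low d0 d1 (app (d0 + d1) A p) = 0" by (rule low_U[OF ok_U[OF ok pq(1)]])
  have lq: "low d0 d1 (app (d0 + d1) A q) = app d1 (corner d0 A) (low d0 d1 q)"
  proof
    fix i
    have "(\<Sum>j<d0. A (d0 + i) j * q j) = 0"
      by (rule sum.neutral) (use pq(2) in \<open>auto simp: supp_sp_def\<close>)
    moreover have "(\<Sum>j<d1. A (d0 + i) (d0 + j) * q (d0 + j)) = (\<Sum>j<d1. corner d0 A i j * low d0 d1 q j)"
      by (rule sum.cong) (auto simp: corner_def low_def)
    moreover have "low d0 d1 (app (d0 + d1) A q) i = (\<Sum>j<d0 + d1. A (d0 + i) j * q j)" if "i < d1"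
      using that by (simp add: low_def app_def)
    ultimately have "low d0 d1 (app (d0 + d1) A q) i = (\<Sum>j<d1. corner d0 A i j * low d0 d1 q j)" if "i < d1"
      using that unfolding sum_split_nat by simp
    then show "low d0 d1 (app (d0 + d1) A q) i = app d1 (corner d0 A) (low d0 d1 q) i"
      by (cases "i < d1") (simp_all add: app_def[of d1] V_out[OF low_V])
  qed
  show ?thesis
    unfolding pq(3) app_add lin_add[OF lin_low] lp lq low_U[OF pq(1)] by simp
qed

lemma low_apow:
  assumes ok: "ok (d0 + d1) m {..<d0} A" and v: "v \<in> V (d0 + d1)"
  shows "low d0 d1 ((app (d0 + d1) A ^^ b) v) = (app d1 (corner d0 A) ^^ b) (low d0 d1 v)"
proof (induction b)
  case (Suc b)
  show ?case using low_app[OF ok apow_V[OF v, where A=A and b=b]] Suc.IH by simp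
qed simp

text \<open>The parameters of a generic operator: \<open>\<epsilon>\<close> is the operator induced on \<open>V / U\<close> in a basis adapted to the
  flag, \<open>c q\<close> the image in \<open>V / U\<close> of the top of the \<open>q\<close>-th Jordan block, \<open>g\<close> the change of basis on
  \<open>V / U\<close>, and \<open>\<psi>\<close> the \<open>U\<close>-components of the Jordan basis. For linear conditions on \<open>\<epsilon>\<close> and \<open>c\<close>
  that imply all relations, the last block has to start in the first \<open>(d0 + d1) mod m\<close> layers.\<close>

definition phi :: "nat \<Rightarrow> nat \<Rightarrow> (nat \<Rightarrow> nat \<Rightarrow> 'k::field) \<Rightarrow> (nat \<Rightarrow> nat \<Rightarrow> 'k) \<Rightarrow> nat \<Rightarrow> nat \<Rightarrow> 'k" where
  "phi d1 m \<epsilon> c k = (app d1 \<epsilon> ^^ (k mod m)) (c (k div m))"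

definition hcol :: "nat \<Rightarrow> nat \<Rightarrow> nat \<Rightarrow> (nat \<Rightarrow> nat \<Rightarrow> 'k::field) \<Rightarrow> (nat \<Rightarrow> nat \<Rightarrow> 'k) \<Rightarrow>
    (nat \<Rightarrow> nat \<Rightarrow> 'k) \<Rightarrow> (nat \<Rightarrow> nat \<Rightarrow> 'k) \<Rightarrow> nat \<Rightarrow> nat \<Rightarrow> 'k" where
  "hcol d0 d1 m \<epsilon> c \<psi> g k = (\<lambda>i. if i < d0 then \<psi> i k else if i < d0 + d1 then app d1 g (phi d1 m \<epsilon> c k) (i - d0) else 0)"

definition pdata :: "nat \<Rightarrow> nat \<Rightarrow> nat \<Rightarrow> (nat \<Rightarrow> nat \<Rightarrow> 'k::field) \<Rightarrow> (nat \<Rightarrow> nat \<Rightarrow> 'k) \<Rightarrow> bool" where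
  "pdata d0 d1 m \<epsilon> c \<longleftrightarrow> (\<forall>i<d1. \<forall>j<d1. \<not> lab m d1 i < lab m d1 j \<longrightarrow> \<epsilon> i j = 0) \<and>
     (\<forall>i. c i \<in> V d1) \<and> (\<forall>i<d1. \<not> lab m d1 i < (d0 + d1) mod m \<longrightarrow> c ((d0 + d1) div m) i = 0)"

lemma hcol_V: "hcol d0 d1 m \<epsilon> c \<psi> g k \<in> V (d0 + d1)"
  by (auto simp: hcol_def supp_sp_def)

lemma low_hcol: "low d0 d1 (hcol d0 d1 m \<epsilon> c \<psi> g k) = app d1 g (phi d1 m \<epsilon> c k)"
  by (auto simp: low_def hcol_def fun_eq_iff V_out[OF app_V])

lemma phi_V: "pdata d0 d1 m \<epsilon> c \<Longrightarrow> phi d1 m \<epsilon> c k \<in> V d1"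
  unfolding phi_def pdata_def by (intro apow_V) blast

text \<open>Each application of \<epsilon> lowers the layer l by at least one.\<close>

lemma strict_upper_pow:
  assumes \<epsilon>: "\<forall>i<d1. \<forall>j<d1. \<not> l i < l j \<longrightarrow> \<epsilon> i j = (0::'k::field)"
    and v: "v \<in> V d1" "\<forall>i<d1. \<not> l i < (r::nat) \<longrightarrow> v i = 0"
  shows "i < d1 \<Longrightarrow> \<not> l i + b < r \<Longrightarrow> (app d1 \<epsilon> ^^ b) v i = 0"
proof (induction b arbitrary: i)
  case 0 then show ?case using v by simp
next
  case (Suc b)
  have "(\<Sum>j<d1. \<epsilon> i j * (app d1 \<epsilon> ^^ b) v j) = 0"
  proof (rule sum.neutral, rule ballI)
    fix j assume "j \<in> {..<d1}"
    then have j: "j < d1" by simp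
    show "\<epsilon> i j * (app d1 \<epsilon> ^^ b) v j = 0"
    proof (cases "l i < l j")
      case True
      then have "\<not> l j + b < r" using Suc.prems(2) by linarith
      then show ?thesis using Suc.IH[OF j] by simp
    next
      case False then show ?thesis using \<epsilon> Suc.prems(1) j by simp
    qed
  qed
  then show ?case unfolding funpow.simps comp_apply app_def[of d1 \<epsilon> "(app d1 \<epsilon> ^^ b) v"] by simp
qed

lemma strict_upper_nil:
  assumes \<epsilon>: "\<forall>i<d1. \<forall>j<d1. \<not> l i < l j \<longrightarrow> \<epsilon> i j = (0::'k::field)"
    and v: "v \<in> V d1" "\<forall>i<d1. \<not> l i < (r::nat) \<longrightarrow> v i = 0"
  shows "(app d1 \<epsilon> ^^ r) v = 0"
proof
  fix i show "(app d1 \<epsilon> ^^ r) v i = 0 i"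
  proof (cases "i < d1")
    case True then show ?thesis using strict_upper_pow[OF assms True, of r] by (simp add: zero_fun_apply)
  next
    case False then show ?thesis using V_out[OF apow_V[OF v(1)] False] by (simp add: zero_fun_apply)
  qed
qed

lemma jnext_div: "m > 0 \<Longrightarrow> jnext d m k \<Longrightarrow> Suc k mod m = Suc (k mod m) \<and> Suc k div m = k div m"
  unfolding jnext_def by (auto simp: mod_Suc div_Suc dvd_eq_mod_eq_0)

text \<open>A chain ends with a full block or with the last index, which then belongs to the block
  of size \<open>d mod m\<close>.\<close>

lemma not_jnext:
  assumes "m > 0" "k < d" "\<not> jnext d m k"
  shows "Suc (k mod m) = m \<or> k div m = d div m \<and> Suc (k mod m) = d mod m"
proof (cases "m dvd Suc k")
  case True
  then show ?thesis by (metis dvd_eq_mod_eq_0 mod_Suc nat.simps(3))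
next
  case False
  then have d: "d = Suc k" using assms unfolding jnext_def by auto
  show ?thesis unfolding d using False by (auto simp: mod_Suc div_Suc dvd_eq_mod_eq_0)
qed

text \<open>Counting layers alone makes \<open>phi\<close> follow the Jordan form: m layers give
  \<open>\<epsilon>^m = 0\<close>, and starting in the first \<open>(d0 + d1) mod m\<close> layers
  makes the last chain end in time. No equation between the parameters is left.\<close>

lemma phi_next:
  assumes p: "pdata d0 d1 m \<epsilon> c" and m: "m \<ge> 1" and k: "k < d0 + d1"
  shows "app d1 \<epsilon> (phi d1 m \<epsilon> c k) = (if jnext (d0 + d1) m k then phi d1 m \<epsilon> c (Suc k) else 0)"
proof (cases "jnext (d0 + d1) m k")
  case True
  then show ?thesis using jnext_div[OF _ True] m by (simp add: phi_def)
next
  case False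
  have eq: "app d1 \<epsilon> (phi d1 m \<epsilon> c k) = (app d1 \<epsilon> ^^ Suc (k mod m)) (c (k div m))" by (simp add: phi_def)
  from p have e: "\<forall>i<d1. \<forall>j<d1. \<not> lab m d1 i < lab m d1 j \<longrightarrow> \<epsilon> i j = 0"
    and c: "\<And>i. c i \<in> V d1" and cq: "\<forall>i<d1. \<not> lab m d1 i < (d0 + d1) mod m \<longrightarrow> c ((d0 + d1) div m) i = 0"
    unfolding pdata_def by blast+
  have "Suc (k mod m) = m \<or> k div m = (d0 + d1) div m \<and> Suc (k mod m) = (d0 + d1) mod m"
    by (rule not_jnext[OF _ k False]) (use m in simp)
  then have "(app d1 \<epsilon> ^^ Suc (k mod m)) (c (k div m)) = 0"
  proof
    assume "Suc (k mod m) = m"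
    moreover have "\<forall>i<d1. \<not> lab m d1 i < m \<longrightarrow> c (k div m) i = 0" using lab_less[of m] m by auto
    ultimately show ?thesis using strict_upper_nil[OF e c, of m] by simp
  next
    assume "k div m = (d0 + d1) div m \<and> Suc (k mod m) = (d0 + d1) mod m"
    then show ?thesis using strict_upper_nil[OF e c cq] by simp
  qed
  then show ?thesis using eq False by simp
qed

lemma jordan_basis_pow:
  assumes h: "jordan_basis d m A h" and m: "m \<ge> 1"
  shows "k < d \<Longrightarrow> k mod m + j \<ge> m \<or> k + j \<ge> d \<Longrightarrow> (app d A ^^ j) (h k) = 0"
proof (induction j arbitrary: k)
  case 0
  have "k mod m < m" using m by simp
  then show ?case using 0 by simp
next
  case (Suc j)
  have e: "(app d A ^^ Suc j) (h k) = (app d A ^^ j) (app d A (h k))" by (simp add: funpow_swap1)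
  show ?case
  proof (cases "jnext d m k")
    case True
    then have "Suc k < d" by (simp add: jnext_def)
    moreover have "Suc k mod m + j \<ge> m \<or> Suc k + j \<ge> d" using Suc.prems jnext_div[OF _ True] m by auto
    ultimately have "(app d A ^^ j) (h (Suc k)) = 0" by (rule Suc.IH)
    then show ?thesis unfolding e using h True Suc.prems(1) unfolding jordan_basis_def by simp
  next
    case False
    then show ?thesis unfolding e using h Suc.prems(1) unfolding jordan_basis_def by simp
  qed
qed

lemma indepf_expand:
  assumes "indepf d h" "\<And>k. k < d \<Longrightarrow> h k \<in> V d" "v \<in> V d"
  obtains \<alpha> where "v = (\<Sum>k<d. sc (\<alpha> k) (h k))"
proof -
  have "V d = vs.span (h ` {..<d})" by (rule indepf_spans[OF assms(1,2), where d=d]) (simp_all add: dim_V)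
  then have "v \<in> vs.span (h ` {..<d})" using assms(3) by blast
  from span_coeffs[OF this] show ?thesis using that by auto
qed

text \<open>A combination of the columns lies in \<open>U\<close> iff the same combination of
  \<open>phi\<close> is 0, since g is injective. \<open>A\<close> shifts the columns as \<epsilon>
  shifts \<open>phi\<close>, and \<epsilon> maps 0 to 0, so \<open>U\<close> is preserved.\<close>

lemma param_ok:
  assumes p: "pdata d0 d1 m \<epsilon> c" and m: "m \<ge> 1"
    and g: "\<And>v. v \<in> V d1 \<Longrightarrow> app d1 g v = 0 \<Longrightarrow> v = 0"
    and h: "jordan_basis (d0 + d1) m A (hcol d0 d1 m \<epsilon> c \<psi> g)"
  shows "ok (d0 + d1) m {..<d0} A"
  unfolding ok_def
proof (intro conjI ballI)
  let ?d = "d0 + d1" and ?h = "hcol d0 d1 m \<epsilon> c \<psi> g" and ?p = "phi d1 m \<epsilon> c"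
  have ind: "indepf ?d ?h" and hA: "\<And>k. k < ?d \<Longrightarrow> app ?d A (?h k) = (if jnext ?d m k then ?h (Suc k) else 0)"
    using h unfolding jordan_basis_def by blast+
  {
    fix v :: "nat \<Rightarrow> 'a" assume v: "v \<in> V ?d"
    obtain \<alpha> where \<alpha>: "v = (\<Sum>k<?d. sc (\<alpha> k) (?h k))" by (rule indepf_expand[OF ind hcol_V v])
    have "(app ?d A ^^ m) (?h k) = 0" if "k < ?d" for k by (rule jordan_basis_pow[OF h m that]) simp
    then show "(app ?d A ^^ m) v = 0" unfolding \<alpha> apow_sum apow_sc by simp
  next
    fix u :: "nat \<Rightarrow> 'a" assume u: "u \<in> supp_sp ?d {..<d0}"
    obtain \<alpha> where \<alpha>: "u = (\<Sum>k<?d. sc (\<alpha> k) (?h k))" by (rule indepf_expand[OF ind hcol_V supp_sp_V[OF u]])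
    define y where "y = (\<Sum>k<?d. sc (\<alpha> k) (?p k))"
    have yV: "y \<in> V d1" unfolding y_def by (intro vs.subspace_sum vs.subspace_scale phi_V[OF p]) auto
    have "app d1 g y = low d0 d1 u"
      unfolding \<alpha> y_def lin_sum[OF lin_low] lin_sc[OF lin_low] low_hcol app_sum app_sc ..
    then have y0: "y = 0" using g[OF yV] low_U[OF u] by simp
    have l: "low d0 d1 (app ?d A (?h k)) = app d1 g (app d1 \<epsilon> (?p k))" if "k < ?d" for k
      unfolding hA[OF that] phi_next[OF p m that] by (simp add: low_hcol)
    have "low d0 d1 (app ?d A u) = app d1 g (app d1 \<epsilon> y)"
      unfolding \<alpha> y_def lin_sum[OF lin_low] lin_sc[OF lin_low] app_sum app_sc
      by (rule sum.cong) (simp_all add: l)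
    then show "app ?d A u \<in> supp_sp ?d {..<d0}"
      unfolding y0 by (intro low_0_U) simp_all
  }
qed

text \<open>Projected to \<open>V / U\<close>, a Jordan basis of \<open>A\<close> becomes a system
  of chains of the induced operator \<open>E\<close>. A basis adapted to \<open>E\<close> and to the
  top of the last chain forms the columns of g; \<epsilon> and c are coordinates in it.\<close>

lemma param_exists:
  fixes A :: "nat \<Rightarrow> nat \<Rightarrow> 'k::field"
  assumes ok: "ok (d0 + d1) m {..<d0} A" and m: "m \<ge> 1"
    and gen: "vs.dim (Kr (d0 + d1) A (m - 1) (V (d0 + d1))) \<le> vs.dim (NI (d0 + d1) A (V (d0 + d1))) + 1"
  obtains \<epsilon> c \<psi> g where "pdata d0 d1 m \<epsilon> c" "indepf d1 (\<lambda>k. app d1 g (unitv k))"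
    "jordan_basis (d0 + d1) m A (hcol d0 d1 m \<epsilon> c \<psi> g)"
proof -
  let ?d = "d0 + d1"
  obtain h where h: "jordan_basis ?d m A h" by (rule generic_basis[OF ok_nil[OF ok] m gen])
  have hV: "\<And>k. k < ?d \<Longrightarrow> h k \<in> V ?d"
    and hA: "\<And>k. k < ?d \<Longrightarrow> app ?d A (h k) = (if jnext ?d m k then h (Suc k) else 0)"
    using h unfolding jordan_basis_def by blast+
  define E where "E = corner d0 A"
  define f where "f k = low d0 d1 (h k)" for k
  have fE: "app d1 E (f k) = (if jnext ?d m k then f (Suc k) else 0)" if "k < ?d" for k
    unfolding E_def f_def low_app[OF ok hV[OF that], symmetric] hA[OF that]
    by simp
  \<comment> \<open>Tops of the projected chains, and 0 where there is no block; this covers the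
    index \<open>q\<close> below when m divides d0 + d1.\<close>
  define v where "v i = (if i * m < ?d then f (i * m) else 0)" for i
  have vV: "v i \<in> V d1" for i unfolding v_def f_def by (simp add: vs.subspace_0)
  have fv: "k < ?d \<Longrightarrow> f k = (app d1 E ^^ (k mod m)) (v (k div m))" for k
  proof (induction k)
    case 0 then show ?case by (simp add: v_def)
  next
    case (Suc k)
    show ?case
    proof (cases "m dvd Suc k")
      case True
      then have "Suc k mod m = 0" "Suc k div m * m = Suc k" by auto
      then show ?thesis using Suc.prems unfolding v_def by simp
    next
      case False
      then have j: "jnext ?d m k" using Suc.prems by (simp add: jnext_def)
      have "f (Suc k) = app d1 E (f k)" using fE[of k] j Suc.prems by simp
      then show ?thesis using Suc jnext_div[OF _ j] m by simp
    qed
  qed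
  have Enil: "(app d1 E ^^ m) w = 0" if "w \<in> V d1" for w
  proof -
    have "(app d1 E ^^ m) w = low d0 d1 ((app ?d A ^^ m) (up d0 d1 w))"
      unfolding E_def low_apow[OF ok up_V] low_up[OF that] ..
    then show ?thesis using ok_nil[OF ok up_V, of w] by simp
  qed
  define q r where "q = ?d div m" and "r = ?d mod m"
  have uq: "(app d1 E ^^ r) (v q) = 0"
  proof (cases "r = 0")
    case True
    then have "q * m = ?d" unfolding q_def r_def by auto
    then have "v q = 0" unfolding v_def by simp
    then show ?thesis by simp
  next
    case False
    have dq: "?d = q * m + r" unfolding q_def r_def by simp
    define k where "k = ?d - 1"
    have k: "k < ?d" "Suc k = ?d" using dq False unfolding k_def by auto
    have "r < m" unfolding r_def using m by simp
    moreover have kk: "k = q * m + (r - 1)" using dq False unfolding k_def by simp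
    ultimately have "k div m = q" "k mod m = r - 1" by auto
    then have "f k = (app d1 E ^^ (r - 1)) (v q)" using fv[OF k(1)] by simp
    then have "(app d1 E ^^ Suc (r - 1)) (v q) = app d1 E (f k)" by simp
    also have "\<dots> = 0" using fE[OF k(1)] k(2) by (simp add: jnext_def)
    finally show ?thesis using False by simp
  qed
  have "\<exists>b. indepf d1 b \<and> (\<forall>k<d1. b k \<in> V d1) \<and>
    (\<forall>k<d1. app d1 E (b k) \<in> vs.span (b ` {j. j < d1 \<and> lab m d1 j < lab m d1 k})) \<and>
    v q \<in> vs.span (b ` {j. j < d1 \<and> lab m d1 j < r})"
    using adapted_flag_basis[where X="V d1" and d=d1 and E=E and m=m and u="v q" and r=r] Enil uq vV by (simp add: dim_V)
  then obtain b where b: "indepf d1 b" "\<And>k. k < d1 \<Longrightarrow> b k \<in> V d1"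
    "\<And>k. k < d1 \<Longrightarrow> app d1 E (b k) \<in> vs.span (b ` {j. j < d1 \<and> lab m d1 j < lab m d1 k})"
    "v q \<in> vs.span (b ` {j. j < d1 \<and> lab m d1 j < r})" by blast
  define g where "g i j = b j i" for i j
  have gu: "app d1 g x = (\<Sum>j<d1. sc (x j) (b j))" for x
  proof
    fix i show "app d1 g x i = (\<Sum>j<d1. sc (x j) (b j)) i"
    proof (cases "i < d1")
      case True
      then show ?thesis by (simp add: app_def g_def sum_fun_apply sc_apply mult.commute)
    next
      case False
      then have "(\<Sum>j<d1. x j * b j i) = 0" using V_out[OF b(2) False] by simp
      then show ?thesis using False by (simp add: app_def sum_fun_apply sc_apply)
    qed
  qed
  have gun: "app d1 g (unitv k) = b k" if "k < d1" for k
  proof -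
    have "(\<Sum>j<d1. sc (unitv k j) (b j)) = (\<Sum>j<d1. if j = k then b j else 0)"
      by (rule sum.cong) (auto simp: unitv_def)
    then show ?thesis using that unfolding gu by simp
  qed
  have coeff: "\<exists>x\<in>V d1. app d1 g x = w \<and> (\<forall>j<d1. j \<notin> J \<longrightarrow> x j = 0)"
    if w: "w \<in> vs.span (b ` J)" and J: "J \<subseteq> {..<d1}" for w J
  proof -
    have fJ: "finite J" using J finite_subset by blast
    obtain \<alpha> where \<alpha>: "\<forall>j. j \<notin> J \<longrightarrow> \<alpha> j = 0" "w = (\<Sum>j\<in>J. sc (\<alpha> j) (b j))"
      using span_coeffs[OF w fJ] by blast
    have "app d1 g \<alpha> = w" unfolding gu \<alpha>(2)
      by (rule sum.mono_neutral_right) (use J \<alpha>(1) in auto)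
    moreover have "\<alpha> \<in> V d1" using \<alpha>(1) J unfolding supp_sp_def by blast
    ultimately show ?thesis using \<alpha>(1) by blast
  qed
  have "\<forall>k. \<exists>x. k < d1 \<longrightarrow> x \<in> V d1 \<and> app d1 g x = app d1 E (b k) \<and> (\<forall>j<d1. \<not> lab m d1 j < lab m d1 k \<longrightarrow> x j = 0)"
  proof
    fix k show "\<exists>x. k < d1 \<longrightarrow> x \<in> V d1 \<and> app d1 g x = app d1 E (b k) \<and> (\<forall>j<d1. \<not> lab m d1 j < lab m d1 k \<longrightarrow> x j = 0)"
    proof (cases "k < d1")
      case True
      from coeff[OF b(3)[OF True]] show ?thesis by fastforce
    qed blast
  qed
  then obtain ee where ee: "\<And>k. k < d1 \<Longrightarrow> ee k \<in> V d1 \<and> app d1 g (ee k) = app d1 E (b k) \<and> (\<forall>j<d1. \<not> lab m d1 j < lab m d1 k \<longrightarrow> ee k j = 0)"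
    by metis
  define \<epsilon> where "\<epsilon> i j = ee j i" for i j
  have eu: "app d1 \<epsilon> (unitv k) = ee k" if k: "k < d1" for k
  proof
    fix i
    have "(\<Sum>j<d1. ee j i * unitv k j) = (\<Sum>j<d1. if j = k then ee j i else 0)"
      by (rule sum.cong) (auto simp: unitv_def)
    also have "\<dots> = ee k i" using k by simp
    finally show "app d1 \<epsilon> (unitv k) i = ee k i" using V_out[of "ee k" d1 i] ee[OF k] by (simp add: app_def \<epsilon>_def)
  qed
  have gE: "app d1 E (app d1 g x) = app d1 g (app d1 \<epsilon> x)" if "x \<in> V d1" for x
  proof -
    have x: "x = (\<Sum>k<d1. sc (x k) (unitv k))" by (rule V_expand[OF that])
    have "app d1 E (app d1 g (unitv k)) = app d1 g (app d1 \<epsilon> (unitv k))" if "k < d1" for k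
      using gun[OF that] eu[OF that] ee[OF that] by simp
    then have "(\<Sum>k<d1. sc (x k) (app d1 E (app d1 g (unitv k)))) = (\<Sum>k<d1. sc (x k) (app d1 g (app d1 \<epsilon> (unitv k))))"
      by (intro sum.cong) simp_all
    then have "app d1 E (app d1 g (\<Sum>k<d1. sc (x k) (unitv k))) = app d1 g (app d1 \<epsilon> (\<Sum>k<d1. sc (x k) (unitv k)))"
      unfolding app_sum app_sc .
    then show ?thesis using x by simp
  qed
  have gEp: "(app d1 E ^^ j) (app d1 g x) = app d1 g ((app d1 \<epsilon> ^^ j) x)" if "x \<in> V d1" for j x
  proof (induction j)
    case (Suc j) then show ?case using gE[OF apow_V[OF that]] by simp
  qed simp
  have bs: "V d1 = vs.span (b ` {..<d1})" by (rule indepf_spans[OF b(1,2), where d=d1]) (simp_all add: dim_V)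
  have "\<forall>i. \<exists>x\<in>V d1. app d1 g x = v i \<and> (i = q \<longrightarrow> (\<forall>j<d1. \<not> lab m d1 j < r \<longrightarrow> x j = 0))"
  proof
    fix i show "\<exists>x\<in>V d1. app d1 g x = v i \<and> (i = q \<longrightarrow> (\<forall>j<d1. \<not> lab m d1 j < r \<longrightarrow> x j = 0))"
    proof (cases "i = q")
      case True
      from coeff[OF b(4)] True show ?thesis by fastforce
    next
      case False
      have "v i \<in> vs.span (b ` {..<d1})" using vV bs by blast
      from coeff[OF this] False show ?thesis by fastforce
    qed
  qed
  then obtain c where c: "\<And>i. c i \<in> V d1" "\<And>i. app d1 g (c i) = v i"
    "\<And>j. j < d1 \<Longrightarrow> \<not> lab m d1 j < r \<Longrightarrow> c q j = 0" by metis
  define \<psi> where "\<psi> i k = h k i" for i k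
  have hc: "hcol d0 d1 m \<epsilon> c \<psi> g k = h k" if k: "k < ?d" for k
  proof -
    have "app d1 g (phi d1 m \<epsilon> c k) = f k"
      unfolding phi_def gEp[OF c(1), symmetric] c(2) fv[OF k] ..
    then show ?thesis unfolding hcol_def f_def low_def \<psi>_def using V_out[OF hV[OF k]] by (auto simp: fun_eq_iff)
  qed
  show ?thesis
  proof (rule that)
    show "pdata d0 d1 m \<epsilon> c" unfolding pdata_def q_def[symmetric] r_def[symmetric] \<epsilon>_def using ee c by blast
    show "indepf d1 (\<lambda>k. app d1 g (unitv k))" using b(1) gun unfolding indepf_def by simp
    have "indepf ?d (hcol d0 d1 m \<epsilon> c \<psi> g)" using h hc unfolding jordan_basis_def indepf_def by simp
    moreover have "hcol d0 d1 m \<epsilon> c \<psi> g (Suc k) = h (Suc k)" if "jnext ?d m k" for k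
      by (rule hc) (use that in \<open>simp add: jnext_def\<close>)
    ultimately show "jordan_basis ?d m A (hcol d0 d1 m \<epsilon> c \<psi> g)"
      unfolding jordan_basis_def using hc hV hA by simp
  qed
qed

section \<open>Rational curves\<close>

text \<open>With \<open>H\<close> the polynomial matrix of the columns, \<open>H J H^-1\<close> is
  \<open>H J adj(H)\<close> over the single denominator \<delta> = det \<open>H\<close>, which is
  nonzero wherever the columns are independent.\<close>

lemma rational_conj:
  fixes c :: "nat \<Rightarrow> 'k::field \<Rightarrow> nat \<Rightarrow> 'k" and J :: "nat \<Rightarrow> nat \<Rightarrow> 'k"
  assumes c: "\<And>k. k < d \<Longrightarrow> pcurve (c k)" "\<And>k t. k < d \<Longrightarrow> c k t \<in> V d"
  obtains \<delta> P where "\<And>t. indepf d (\<lambda>k. c k t) \<Longrightarrow> poly \<delta> t \<noteq> 0"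
    "\<And>t k. poly \<delta> t \<noteq> 0 \<Longrightarrow> k < d \<Longrightarrow>
      app d (\<lambda>i j. poly (P i j) t / poly \<delta> t) (c k t) = (\<Sum>l<d. sc (J l k) (c l t))"
proof -
  have "\<forall>k i. \<exists>q. k < d \<longrightarrow> (\<forall>t. c k t i = poly q t)" using c(1) unfolding pcurve_def by blast
  then obtain p where p: "\<And>k i t. k < d \<Longrightarrow> c k t i = poly (p k i) t" by metis
  define H where "H = mat d d (\<lambda>(i, k). p k i)"
  define Jm where "Jm = mat d d (\<lambda>(l, k). [:J l k:])"
  define \<delta> where "\<delta> = det H"
  define PM where "PM = H * Jm * adj_mat H"
  have H: "H \<in> carrier_mat d d" and Jm: "Jm \<in> carrier_mat d d" unfolding H_def Jm_def by simp_all
  have aH: "adj_mat H \<in> carrier_mat d d" by (rule adj_mat(1)[OF H])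
  have PM: "PM \<in> carrier_mat d d" unfolding PM_def using H Jm aH by simp
  have "PM * H = H * Jm * (adj_mat H * H)"
    unfolding PM_def by (rule assoc_mult_mat) (use H Jm aH in auto)
  also have "\<dots> = H * Jm * (\<delta> \<cdot>\<^sub>m 1\<^sub>m d)" unfolding adj_mat(3)[OF H] \<delta>_def ..
  also have "\<dots> = \<delta> \<cdot>\<^sub>m (H * Jm * 1\<^sub>m d)"
    by (rule mult_smult_distrib) (use H Jm in auto)
  also have "H * Jm * 1\<^sub>m d = H * Jm" by (rule right_mult_one_mat) (use H Jm in auto)
  finally have eq: "PM * H = \<delta> \<cdot>\<^sub>m (H * Jm)" .
  have ent: "(\<Sum>j<d. PM $$ (i, j) * p k j) = \<delta> * (\<Sum>l<d. p l i * [:J l k:])" if "i < d" "k < d" for i k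
  proof -
    have "(PM * H) $$ (i, k) = (\<Sum>j<d. PM $$ (i, j) * p k j)"
      using that PM H unfolding times_mat_def scalar_prod_def
      by (simp add: H_def atLeast0LessThan)
    moreover have "(\<delta> \<cdot>\<^sub>m (H * Jm)) $$ (i, k) = \<delta> * (\<Sum>l<d. p l i * [:J l k:])"
      using that H Jm unfolding times_mat_def scalar_prod_def
      by (simp add: H_def Jm_def atLeast0LessThan)
    ultimately show ?thesis using eq by simp
  qed
  define P where "P i j = PM $$ (i, j)" for i j
  show ?thesis
  proof (rule that[of \<delta> P])
    fix t assume ind: "indepf d (\<lambda>k. c k t)"
    interpret ev: comm_ring_hom "\<lambda>q. poly q t" by unfold_locales auto
    let ?M = "map_mat (\<lambda>q. poly q t) H"
    have M: "?M \<in> carrier_mat d d" using H by simp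
    show "poly \<delta> t \<noteq> 0"
    proof
      assume "poly \<delta> t = 0"
      then have "det ?M = 0" unfolding \<delta>_def ev.hom_det .
      then obtain v where v: "v \<in> carrier_vec d" "v \<noteq> 0\<^sub>v d" "?M *\<^sub>v v = 0\<^sub>v d"
        using det_0_iff_vec_prod_zero_field[OF M] by blast
      have "(\<Sum>k<d. v $ k * c k t x) = 0" for x
      proof (cases "x < d")
        case True
        have "(?M *\<^sub>v v) $ x = (\<Sum>k<d. poly (p k x) t * v $ k)"
          using True v(1) unfolding mult_mat_vec_def scalar_prod_def by (simp add: H_def atLeast0LessThan)
        also have "\<dots> = (\<Sum>k<d. v $ k * c k t x)" by (rule sum.cong) (simp_all add: p mult.commute)
        finally show ?thesis using v(3) True by simp
      next
        case False
        show ?thesis by (rule sum.neutral) (use V_out[OF c(2) False] in simp)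
      qed
      then have "v $ k = 0" if "k < d" for k using indepfD[OF ind, of "\<lambda>k. v $ k" k] that by simp
      then have "v = 0\<^sub>v d" using v(1) by (intro eq_vecI) auto
      then show False using v(2) by blast
    qed
  next
    fix t k assume nz: "poly \<delta> t \<noteq> 0" and k: "k < d"
    show "app d (\<lambda>i j. poly (P i j) t / poly \<delta> t) (c k t) = (\<Sum>l<d. sc (J l k) (c l t))"
    proof
      fix i
      show "app d (\<lambda>i j. poly (P i j) t / poly \<delta> t) (c k t) i = (\<Sum>l<d. sc (J l k) (c l t)) i"
      proof (cases "i < d")
        case True
        have "(\<Sum>j<d. poly (P i j) t / poly \<delta> t * c k t j) = (\<Sum>j<d. poly (P i j) t * poly (p k j) t) / poly \<delta> t"
          unfolding sum_divide_distrib by (rule sum.cong) (simp_all add: p[OF k])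
        also have "(\<Sum>j<d. poly (P i j) t * poly (p k j) t) = poly (\<Sum>j<d. PM $$ (i, j) * p k j) t"
          by (simp add: P_def poly_sum)
        also have "\<dots> = poly \<delta> t * (\<Sum>l<d. J l k * poly (p l i) t)"
          unfolding ent[OF True k] by (simp add: poly_sum)
        also have "\<dots> / poly \<delta> t = (\<Sum>l<d. J l k * poly (p l i) t)" using nz by simp
        also have "\<dots> = (\<Sum>l<d. J l k * c l t i)" by (rule sum.cong) (simp_all add: p)
        finally show ?thesis using True by (simp add: app_def sum_fun_apply sc_apply)
      next
        case False
        have "(\<Sum>l<d. J l k * c l t i) = 0" by (rule sum.neutral) (use V_out[OF c(2) False] in simp)
        then show ?thesis using False by (simp add: app_def sum_fun_apply sc_apply)
      qed
    qed
  qed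
qed

text \<open>If all coordinates share the denominator \<delta>, a power of \<delta> clears the
  denominators of a polynomial in them; what remains is a polynomial in t, to which
  \<open>poly_0_cofinite\<close> applies.\<close>

lemma poly_fun_rational:
  assumes p: "p \<in> poly_fun" and x: "\<And>t i. poly \<delta> t \<noteq> 0 \<Longrightarrow> x t i = poly (R i) t / poly \<delta> t"
  shows "\<exists>S N. \<forall>t. poly \<delta> t \<noteq> 0 \<longrightarrow> p (x t) * poly \<delta> t ^ N = poly S (t :: 'k::field)"
  using p
proof induction
  case (pf_const c)
  show ?case by (intro exI[of _ "[:c:]"] exI[of _ 0]) simp
next
  case (pf_coord i)
  show ?case by (intro exI[of _ "R i"] exI[of _ 1]) (simp add: x)
next
  case (pf_add p q)
  then obtain S N S' N' where S: "\<And>t. poly \<delta> t \<noteq> 0 \<Longrightarrow> p (x t) * poly \<delta> t ^ N = poly S t"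
    and S': "\<And>t. poly \<delta> t \<noteq> 0 \<Longrightarrow> q (x t) * poly \<delta> t ^ N' = poly S' t" by blast
  have "(p (x t) + q (x t)) * poly \<delta> t ^ (N + N') = poly (S * \<delta> ^ N' + S' * \<delta> ^ N) t" if "poly \<delta> t \<noteq> 0" for t
    unfolding poly_add poly_mult poly_power S[OF that, symmetric] S'[OF that, symmetric] power_add distrib_right
    by (simp only: mult_ac)
  then show ?case by blast
next
  case (pf_mult p q)
  then obtain S N S' N' where S: "\<And>t. poly \<delta> t \<noteq> 0 \<Longrightarrow> p (x t) * poly \<delta> t ^ N = poly S t"
    and S': "\<And>t. poly \<delta> t \<noteq> 0 \<Longrightarrow> q (x t) * poly \<delta> t ^ N' = poly S' t" by blast
  have "p (x t) * q (x t) * poly \<delta> t ^ (N + N') = poly (S * S') t" if "poly \<delta> t \<noteq> 0" for t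
    unfolding poly_mult S[OF that, symmetric] S'[OF that, symmetric] power_add by (simp only: mult_ac)
  then show ?case by blast
qed

text \<open>Over a finite field, 1 plus the product of all linear factors takes the value 1
  everywhere although its degree is positive.\<close>

lemma alg_closed_infinite: "infinite (UNIV :: 'k::alg_closed_field set)"
proof
  assume fin: "finite (UNIV :: 'k set)"
  define p where "p = (\<Prod>a\<in>(UNIV :: 'k set). [:- a, 1:]) + 1"
  have val: "poly p x = 1" for x :: 'k
  proof -
    have "(\<Prod>a\<in>(UNIV :: 'k set). poly [:- a, 1:] x) = 0"
      using fin by (intro prod_zero) (auto intro: bexI[of _ x])
    then show ?thesis unfolding p_def by (simp add: poly_prod)
  qed
  have "degree (\<Prod>a\<in>(UNIV :: 'k set). [:- a, 1:]) = (\<Sum>a\<in>(UNIV :: 'k set). degree [:- a, 1:])"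
    by (rule degree_prod_eq_sum_degree) auto
  then have "degree (\<Prod>a\<in>(UNIV :: 'k set). [:- a, 1:]) > 0"
    using fin by (simp add: card_gt_0_iff)
  then have "degree p > 0" unfolding p_def by (simp add: degree_add_eq_left)
  then obtain x where "poly p x = 0" using alg_closed_imp_poly_has_root by blast
  then show False using val[of x] by simp
qed

lemma poly_0_cofinite:
  fixes S :: "'k::alg_closed_field poly"
  assumes "finite {t. poly S t \<noteq> 0}" shows "S = 0"
proof (rule ccontr)
  assume "S \<noteq> 0"
  then have "finite {t. poly S t = 0}" by (rule poly_roots_finite)
  then have "finite ({t. poly S t = 0} \<union> {t. poly S t \<noteq> 0})" using assms by (rule finite_UnI)
  moreover have "{t. poly S t = 0} \<union> {t. poly S t \<noteq> 0} = UNIV" by blast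
  moreover have "infinite (UNIV :: 'k set)" by (rule alg_closed_infinite)
  ultimately show False by simp
qed

section \<open>Representations as block matrices\<close>

definition Mx :: "nat \<Rightarrow> nat \<Rightarrow> (arrow \<times> nat \<times> nat \<Rightarrow> 'k::field) \<Rightarrow> nat \<Rightarrow> nat \<Rightarrow> 'k" where
  "Mx d0 d1 x i j = (if i < d0 \<and> j < d0 then x (Eps0, i, j)
     else if i < d0 \<and> d0 \<le> j \<and> j < d0 + d1 then x (Alpha 1, i, j - d0)
     else if d0 \<le> i \<and> i < d0 + d1 \<and> d0 \<le> j \<and> j < d0 + d1 then x (Eps1, i - d0, j - d0) else 0)"

text \<open>An inverse of \<open>Mx\<close> on the three arrows that carry relations; the free
  arrows are taken from y, so that the operator can move while they stay fixed.\<close>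

definition pt :: "nat \<Rightarrow> nat \<Rightarrow> (nat \<Rightarrow> nat \<Rightarrow> 'k::field) \<Rightarrow> (arrow \<times> nat \<times> nat \<Rightarrow> 'k) \<Rightarrow> arrow \<times> nat \<times> nat \<Rightarrow> 'k" where
  "pt d0 d1 A y = (\<lambda>(a, i, j). case a of
       Eps0 \<Rightarrow> if i < d0 \<and> j < d0 then A i j else 0
     | Eps1 \<Rightarrow> if i < d1 \<and> j < d1 then A (d0 + i) (d0 + j) else 0
     | Alpha l \<Rightarrow> if l = 1 then (if i < d0 \<and> j < d1 then A i (d0 + j) else 0) else y (Alpha l, i, j))"

lemma mpow_app: "j < d \<Longrightarrow> i < d \<Longrightarrow> mpow d A b i j = (app d A ^^ b) (unitv j) i"
proof (induction b arbitrary: i)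
  case 0 show ?case by (simp add: unitv_def)
next
  case (Suc b)
  have "(\<Sum>l<d. A i l * mpow d A b l j) = (\<Sum>l<d. A i l * (app d A ^^ b) (unitv j) l)"
    by (rule sum.cong) (use Suc in auto)
  then show ?case using Suc.prems by (simp add: mmul_def app_def[of d A "(app d A ^^ b) (unitv j)"])
qed

lemma nil_mpow: "(\<forall>v\<in>V d. (app d A ^^ m) v = 0) \<longleftrightarrow> (\<forall>i<d. \<forall>j<d. mpow d A m i j = (0::'k::field))"
proof
  assume a: "\<forall>v\<in>V d. (app d A ^^ m) v = 0"
  show "\<forall>i<d. \<forall>j<d. mpow d A m i j = 0"
  proof (intro allI impI)
    fix i j assume ij: "i < d" "j < d"
    have "(app d A ^^ m) (unitv j) = 0" using a unitv_supp_sp[OF ij(2)] by blast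
    then show "mpow d A m i j = 0" unfolding mpow_app[OF ij(2,1)] by (simp only: zero_fun_apply)
  qed
next
  assume a: "\<forall>i<d. \<forall>j<d. mpow d A m i j = 0"
  show "\<forall>v\<in>V d. (app d A ^^ m) v = 0"
  proof
    fix v :: "nat \<Rightarrow> 'k" assume v: "v \<in> V d"
    have u: "(app d A ^^ m) (unitv j) = 0" if j: "j < d" for j
    proof
      fix i show "(app d A ^^ m) (unitv j) i = 0 i"
      proof (cases "i < d")
        case True then show ?thesis using a j mpow_app[OF j True, of A m] by (simp add: zero_fun_apply)
      next
        case False
        have "unitv j \<in> (V d :: (nat \<Rightarrow> 'k) set)" using unitv_supp_sp[OF j] by blast
        then show ?thesis using V_out[OF apow_V False] by (simp add: zero_fun_apply)
      qed
    qed
    have "(app d A ^^ m) (\<Sum>j<d. sc (v j) (unitv j)) = 0" unfolding apow_sum apow_sc by (simp add: u)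
    then show "(app d A ^^ m) v = 0" using V_expand[OF v] by simp
  qed
qed

lemma mpow_cong:
  assumes "\<And>i j. i < d \<Longrightarrow> j < d \<Longrightarrow> A i j = B i j"
  shows "i < d \<Longrightarrow> j < d \<Longrightarrow> mpow d A b i j = mpow d B b i j"
proof (induction b arbitrary: i)
  case (Suc b)
  have "(\<Sum>l<d. A i l * mpow d A b l j) = (\<Sum>l<d. B i l * mpow d B b l j)"
    by (rule sum.cong) (use Suc assms in auto)
  then show ?case by (simp add: mmul_def)
qed simp

text \<open>The third relation with m replaced by a variable exponent b. It is the upper right block
  of the b-th power of the block matrix, and \<open>ur_Suc\<close> is the recursion of that
  block.\<close>

definition ur :: "nat \<Rightarrow> nat \<Rightarrow> (nat \<Rightarrow> nat \<Rightarrow> 'k::field) \<Rightarrow> (nat \<Rightarrow> nat \<Rightarrow> 'k) \<Rightarrow> (nat \<Rightarrow> nat \<Rightarrow> 'k) \<Rightarrow> nat \<Rightarrow> nat \<Rightarrow> nat \<Rightarrow> 'k" where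
  "ur d0 d1 E0 a E1 b r c = (\<Sum>i<b. mmul d1 (mmul d0 (mpow d0 E0 (b - 1 - i)) a) (mpow d1 E1 i) r c)"

lemma ur_Suc:
  assumes "r < d0" "c < d1"
  shows "ur d0 d1 E0 a E1 (Suc b) r c = (\<Sum>l<d0. E0 r l * ur d0 d1 E0 a E1 b l c) + (\<Sum>l<d1. a r l * mpow d1 E1 b l c)"
proof -
  have 1: "mmul d1 (mmul d0 (mpow d0 E0 0) a) (mpow d1 E1 b) r c = (\<Sum>l<d1. a r l * mpow d1 E1 b l c)"
  proof -
    have "(\<Sum>l<d0. mpow d0 E0 0 r l * a l j) = (\<Sum>l<d0. if l = r then a l j else 0)" for j
      by (rule sum.cong) auto
    then have "(\<Sum>l<d0. mpow d0 E0 0 r l * a l j) = a r j" for j using assms by simp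
    then show ?thesis unfolding mmul_def by simp
  qed
  have 2: "mmul d1 (mmul d0 (mpow d0 E0 (Suc e)) a) (mpow d1 E1 i) r c =
      (\<Sum>l<d0. E0 r l * mmul d1 (mmul d0 (mpow d0 E0 e) a) (mpow d1 E1 i) l c)" for e i
  proof -
    have in1: "(\<Sum>l<d0. mpow d0 E0 (Suc e) r l * a l j) = (\<Sum>k<d0. E0 r k * (\<Sum>l<d0. mpow d0 E0 e k l * a l j))" for j
    proof -
      have "(\<Sum>l<d0. mpow d0 E0 (Suc e) r l * a l j) = (\<Sum>l<d0. \<Sum>k<d0. E0 r k * (mpow d0 E0 e k l * a l j))"
        unfolding mpow.simps mmul_def[of d0 E0] sum_distrib_right mult.assoc ..
      also have "\<dots> = (\<Sum>k<d0. \<Sum>l<d0. E0 r k * (mpow d0 E0 e k l * a l j))" by (rule sum.swap)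
      finally show ?thesis unfolding sum_distrib_left .
    qed
    define F where "F k j = (\<Sum>l<d0. mpow d0 E0 e k l * a l j)" for k j
    have "mmul d1 (mmul d0 (mpow d0 E0 (Suc e)) a) (mpow d1 E1 i) r c =
      (\<Sum>j<d1. (\<Sum>k<d0. E0 r k * F k j) * mpow d1 E1 i j c)"
      unfolding mmul_def[of d1] mmul_def[of d0 "mpow d0 E0 (Suc e)"] in1 F_def ..
    also have "\<dots> = (\<Sum>j<d1. \<Sum>k<d0. E0 r k * (F k j * mpow d1 E1 i j c))"
      unfolding sum_distrib_right mult.assoc ..
    also have "\<dots> = (\<Sum>k<d0. \<Sum>j<d1. E0 r k * (F k j * mpow d1 E1 i j c))"
      by (rule sum.swap)
    also have "\<dots> = (\<Sum>k<d0. E0 r k * (\<Sum>j<d1. F k j * mpow d1 E1 i j c))"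
      unfolding sum_distrib_left ..
    finally show ?thesis
      unfolding F_def mmul_def[of d0 "mpow d0 E0 e"] mmul_def[of d1 "\<lambda>i j. \<Sum>l<d0. mpow d0 E0 e i l * a l j"] .
  qed
  \<comment> \<open>The summand i = b has no factor \<open>E0\<close> on the left; every other one
    releases such a factor.\<close>
  have "ur d0 d1 E0 a E1 (Suc b) r c = (\<Sum>i<b. mmul d1 (mmul d0 (mpow d0 E0 (b - i)) a) (mpow d1 E1 i) r c) +
      mmul d1 (mmul d0 (mpow d0 E0 0) a) (mpow d1 E1 b) r c"
    unfolding ur_def sum.lessThan_Suc by simp
  also have "(\<Sum>i<b. mmul d1 (mmul d0 (mpow d0 E0 (b - i)) a) (mpow d1 E1 i) r c) =
      (\<Sum>i<b. \<Sum>l<d0. E0 r l * mmul d1 (mmul d0 (mpow d0 E0 (b - 1 - i)) a) (mpow d1 E1 i) l c)"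
  proof (rule sum.cong[OF refl])
    fix i assume "i \<in> {..<b}"
    then have "b - i = Suc (b - 1 - i)" by auto
    then show "mmul d1 (mmul d0 (mpow d0 E0 (b - i)) a) (mpow d1 E1 i) r c =
      (\<Sum>l<d0. E0 r l * mmul d1 (mmul d0 (mpow d0 E0 (b - 1 - i)) a) (mpow d1 E1 i) l c)"
      using 2[of "b - 1 - i" i] by (simp only:)
  qed
  also have "\<dots> = (\<Sum>l<d0. E0 r l * ur d0 d1 E0 a E1 b l c)"
    unfolding ur_def sum_distrib_left by (rule sum.swap)
  finally show ?thesis unfolding 1 .
qed

lemma mpow_blocks:
  fixes A :: "nat \<Rightarrow> nat \<Rightarrow> 'k::field"
  assumes z: "\<And>i j. i < d1 \<Longrightarrow> j < d0 \<Longrightarrow> A (d0 + i) j = 0"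
  shows "(\<forall>i<d0. \<forall>j<d0. mpow (d0 + d1) A b i j = mpow d0 A b i j) \<and>
    (\<forall>i<d1. \<forall>j<d0. mpow (d0 + d1) A b (d0 + i) j = 0) \<and>
    (\<forall>i<d1. \<forall>j<d1. mpow (d0 + d1) A b (d0 + i) (d0 + j) = mpow d1 (corner d0 A) b i j) \<and>
    (\<forall>i<d0. \<forall>j<d1. mpow (d0 + d1) A b i (d0 + j) = ur d0 d1 A (\<lambda>i j. A i (d0 + j)) (corner d0 A) b i j)"
proof (induction b)
  case 0 show ?case by (auto simp: ur_def)
next
  case (Suc b)
  have e: "mpow (d0 + d1) A (Suc b) i j = (\<Sum>l<d0. A i l * mpow (d0 + d1) A b l j) + (\<Sum>l<d1. A i (d0 + l) * mpow (d0 + d1) A b (d0 + l) j)" for i j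
    by (simp add: mmul_def sum_split_nat)
  have sz: "(\<Sum>l<d0. A (d0 + i) l * f l) = 0" if "i < d1" for i and f :: "nat \<Rightarrow> 'k"
    by (rule sum.neutral) (use z that in simp)
  have IH: "\<And>i j. i < d0 \<Longrightarrow> j < d0 \<Longrightarrow> mpow (d0 + d1) A b i j = mpow d0 A b i j"
    "\<And>i j. i < d1 \<Longrightarrow> j < d0 \<Longrightarrow> mpow (d0 + d1) A b (d0 + i) j = 0"
    "\<And>i j. i < d1 \<Longrightarrow> j < d1 \<Longrightarrow> mpow (d0 + d1) A b (d0 + i) (d0 + j) = mpow d1 (corner d0 A) b i j"
    "\<And>i j. i < d0 \<Longrightarrow> j < d1 \<Longrightarrow> mpow (d0 + d1) A b i (d0 + j) = ur d0 d1 A (\<lambda>i j. A i (d0 + j)) (corner d0 A) b i j"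
    using Suc by blast+
  show ?case
  proof (intro conjI allI impI)
    fix i j assume ij: "i < d0" "j < d0"
    have "(\<Sum>l<d0. A i l * mpow (d0 + d1) A b l j) = (\<Sum>l<d0. A i l * mpow d0 A b l j)"
      by (rule sum.cong) (simp_all add: IH ij)
    moreover have "(\<Sum>l<d1. A i (d0 + l) * mpow (d0 + d1) A b (d0 + l) j) = 0"
      by (rule sum.neutral) (simp add: IH ij)
    ultimately show "mpow (d0 + d1) A (Suc b) i j = mpow d0 A (Suc b) i j" unfolding e by (simp add: mmul_def)
  next
    fix i j assume ij: "i < d1" "j < d0"
    have "(\<Sum>l<d1. A (d0 + i) (d0 + l) * mpow (d0 + d1) A b (d0 + l) j) = 0"
      by (rule sum.neutral) (simp add: IH ij)
    then show "mpow (d0 + d1) A (Suc b) (d0 + i) j = 0" unfolding e sz[OF ij(1)] by simp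
  next
    fix i j assume ij: "i < d1" "j < d1"
    have "(\<Sum>l<d1. A (d0 + i) (d0 + l) * mpow (d0 + d1) A b (d0 + l) (d0 + j)) = (\<Sum>l<d1. corner d0 A i l * mpow d1 (corner d0 A) b l j)"
      by (rule sum.cong) (simp_all add: IH ij, simp add: corner_def)
    then show "mpow (d0 + d1) A (Suc b) (d0 + i) (d0 + j) = mpow d1 (corner d0 A) (Suc b) i j"
      unfolding e sz[OF ij(1)] by (simp add: mmul_def)
  next
    fix i j assume ij: "i < d0" "j < d1"
    have "(\<Sum>l<d0. A i l * mpow (d0 + d1) A b l (d0 + j)) = (\<Sum>l<d0. A i l * ur d0 d1 A (\<lambda>i j. A i (d0 + j)) (corner d0 A) b l j)"
      by (rule sum.cong) (simp_all add: IH ij)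
    moreover have "(\<Sum>l<d1. A i (d0 + l) * mpow (d0 + d1) A b (d0 + l) (d0 + j)) = (\<Sum>l<d1. A i (d0 + l) * mpow d1 (corner d0 A) b l j)"
      by (rule sum.cong) (simp_all add: IH ij)
    ultimately show "mpow (d0 + d1) A (Suc b) i (d0 + j) = ur d0 d1 A (\<lambda>i j. A i (d0 + j)) (corner d0 A) (Suc b) i j"
      unfolding e ur_Suc[OF ij] by simp
  qed
qed

lemma app_cong:
  assumes "\<And>i j. i < d \<Longrightarrow> j < d \<Longrightarrow> A i j = B i j" shows "app d A = app d B"
proof (intro ext)
  fix v i
  have "(\<Sum>j<d. A i j * v j) = (\<Sum>j<d. B i j * v j)" if "i < d"
    by (rule sum.cong) (use assms that in auto)
  then show "app d A v i = app d B v i" by (simp add: app_def)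
qed

lemma ok_cong: "(\<And>i j. i < d \<Longrightarrow> j < d \<Longrightarrow> A i j = B i j) \<Longrightarrow> ok d m Q A \<longleftrightarrow> ok d m Q B"
  unfolding ok_def using app_cong[of d A B] by simp

lemma app_unitv: "i < d \<Longrightarrow> j < d \<Longrightarrow> app d A (unitv j) i = A i j"
proof -
  assume ij: "i < d" "j < d"
  have "(\<Sum>l<d. A i l * unitv j l) = (\<Sum>l<d. if l = j then A i l else 0)"
    by (rule sum.cong) (auto simp: unitv_def)
  then show ?thesis using ij by (simp add: app_def)
qed

lemma ok_iff_blocks:
  "ok (d0 + d1) m {..<d0} A \<longleftrightarrow> (\<forall>i<d1. \<forall>j<d0. A (d0 + i) j = 0) \<and>
    (\<forall>i<d0. \<forall>j<d0. mpow d0 A m i j = 0) \<and> (\<forall>i<d1. \<forall>j<d1. mpow d1 (corner d0 A) m i j = 0) \<and>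
    (\<forall>i<d0. \<forall>j<d1. ur d0 d1 A (\<lambda>i j. A i (d0 + j)) (corner d0 A) m i j = 0)"
  (is "_ \<longleftrightarrow> ?Z \<and> ?A \<and> ?B \<and> ?C")
proof
  assume ok: "ok (d0 + d1) m {..<d0} A"
  have Z: "A (d0 + i) j = 0" if "i < d1" "j < d0" for i j
  proof -
    have "app (d0 + d1) A (unitv j) \<in> supp_sp (d0 + d1) {..<d0}"
      by (rule ok_U[OF ok]) (use that in \<open>auto simp: supp_sp_def unitv_def\<close>)
    then have "app (d0 + d1) A (unitv j) (d0 + i) = 0" by (rule supp_sp_out) simp
    then show ?thesis using app_unitv[of "d0 + i" "d0 + d1" j A] that by simp
  qed
  have "\<forall>i<d0 + d1. \<forall>j<d0 + d1. mpow (d0 + d1) A m i j = 0"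
    using ok unfolding ok_def nil_mpow by blast
  then have n: "mpow (d0 + d1) A m i j = 0" if "i < d0 + d1" "j < d0 + d1" for i j using that by blast
  note bl = mpow_blocks[of d1 d0 A m, OF Z]
  show "?Z \<and> ?A \<and> ?B \<and> ?C"
  proof (intro conjI allI impI)
    show "A (d0 + i) j = 0" if "i < d1" "j < d0" for i j by (rule Z[OF that])
    show "mpow d0 A m i j = 0" if "i < d0" "j < d0" for i j using bl n[of i j] that by simp
    show "mpow d1 (corner d0 A) m i j = 0" if "i < d1" "j < d1" for i j
      using bl n[of "d0 + i" "d0 + j"] that by simp
    show "ur d0 d1 A (\<lambda>i j. A i (d0 + j)) (corner d0 A) m i j = 0" if "i < d0" "j < d1" for i j
      using bl n[of i "d0 + j"] that by simp
  qed
next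
  assume a: "?Z \<and> ?A \<and> ?B \<and> ?C"
  then have Z: "\<And>i j. i < d1 \<Longrightarrow> j < d0 \<Longrightarrow> A (d0 + i) j = 0" by blast
  note bl = mpow_blocks[of d1 d0 A m, OF Z]
  show "ok (d0 + d1) m {..<d0} A"
    unfolding ok_def nil_mpow
  proof (intro conjI ballI allI impI)
    fix u :: "nat \<Rightarrow> 'a" assume u: "u \<in> supp_sp (d0 + d1) {..<d0}"
    have "app (d0 + d1) A u k = 0" if k: "\<not> k < d0" "k < d0 + d1" for k
    proof -
      define i where "i = k - d0"
      have i: "i < d1" "k = d0 + i" using k unfolding i_def by auto
      have "(\<Sum>j<d0 + d1. A (d0 + i) j * u j) = 0"
      proof (rule sum.neutral, rule ballI)
        fix j assume "j \<in> {..<d0 + d1}"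
        show "A (d0 + i) j * u j = 0"
        proof (cases "j < d0")
          case True then show ?thesis using Z[OF i(1) True] by simp
        next
          case False then show ?thesis using supp_sp_out[OF u, of j] by simp
        qed
      qed
      then show ?thesis unfolding i(2) by (simp add: app_def)
    qed
    then show "app (d0 + d1) A u \<in> supp_sp (d0 + d1) {..<d0}"
      using V_out[OF app_V] unfolding supp_sp_def by blast
  next
    fix i j assume ij: "i < d0 + d1" "j < d0 + d1"
    show "mpow (d0 + d1) A m i j = 0"
    proof (cases "i < d0")
      case i: True
      show ?thesis
      proof (cases "j < d0")
        case True then show ?thesis using i bl a by simp
      next
        case False
        define j' where "j' = j - d0"
        have "j' < d1" "j = d0 + j'" using False ij unfolding j'_def by auto
        then show ?thesis using i bl a by simp
      qed
    next
      case False
      define i' where "i' = i - d0"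
      have i: "i' < d1" "i = d0 + i'" using False ij unfolding i'_def by auto
      show ?thesis
      proof (cases "j < d0")
        case True then show ?thesis using i bl by simp
      next
        case False
        define j' where "j' = j - d0"
        have "j' < d1" "j = d0 + j'" using False ij unfolding j'_def by auto
        then show ?thesis using i bl a by simp
      qed
    qed
  qed
qed

lemma mmul_cong:
  assumes "\<And>l. l < k \<Longrightarrow> A i l = A' i l" "\<And>l. l < k \<Longrightarrow> B l j = B' l j"
  shows "mmul k A B i j = mmul k A' B' i j"
  unfolding mmul_def by (rule sum.cong) (use assms in auto)

lemma rep_A_iff:
  "x \<in> rep_A n m d0 d1 \<longleftrightarrow> x \<in> rep_space n d0 d1 \<and> ok (d0 + d1) m {..<d0} (Mx d0 d1 x)"
proof -
  let ?M = "Mx d0 d1 x"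
  have z: "\<forall>i<d1. \<forall>j<d0. ?M (d0 + i) j = 0" by (simp add: Mx_def)
  have p0: "mpow d0 ?M b i j = mpow d0 (mat_of x Eps0) b i j" if "i < d0" "j < d0" for b i j
    by (rule mpow_cong) (use that in \<open>simp_all add: Mx_def mat_of_def\<close>)
  have p1: "mpow d1 (corner d0 ?M) b i j = mpow d1 (mat_of x Eps1) b i j" if "i < d1" "j < d1" for b i j
    by (rule mpow_cong) (use that in \<open>simp_all add: Mx_def mat_of_def corner_def\<close>)
  have pa: "?M i (d0 + j) = mat_of x (Alpha 1) i j" if "i < d0" "j < d1" for i j
    using that by (simp add: Mx_def mat_of_def)
  have pu: "ur d0 d1 ?M (\<lambda>i j. ?M i (d0 + j)) (corner d0 ?M) m r c =
      (\<Sum>i<m. mmul d1 (mmul d0 (mpow d0 (mat_of x Eps0) (m - 1 - i)) (mat_of x (Alpha 1)))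
         (mpow d1 (mat_of x Eps1) i) r c)" if "r < d0" "c < d1" for r c
    unfolding ur_def by (intro sum.cong refl mmul_cong) (use that in \<open>simp_all add: p0 p1 pa\<close>)
  show ?thesis
    unfolding ok_iff_blocks rep_A_def mzero_def using z by (auto simp: p0 p1 pu)
qed

lemma Mx_pt:
  assumes "ok (d0 + d1) m {..<d0} A" "i < d0 + d1" "j < d0 + d1"
  shows "Mx d0 d1 (pt d0 d1 A y) i j = A i j"
proof -
  have "A i j = 0" if "\<not> i < d0" "j < d0"
  proof -
    have "A (d0 + (i - d0)) j = 0" proof -
      have "\<forall>i<d1. \<forall>j<d0. A (d0 + i) j = 0" using assms(1) unfolding ok_iff_blocks by blast
      moreover have "i - d0 < d1" using that assms(2) by linarith
      ultimately show ?thesis using that by blast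
    qed
    then show ?thesis using that by simp
  qed
  then show ?thesis using assms(2,3) by (auto simp: Mx_def pt_def)
qed

lemma pt_rep:
  assumes ok: "ok (d0 + d1) m {..<d0} A" and y: "y \<in> rep_space n d0 d1" and n: "n \<ge> 1"
  shows "pt d0 d1 A y \<in> rep_A n m d0 d1"
proof -
  have "ok (d0 + d1) m {..<d0} (Mx d0 d1 (pt d0 d1 A y))"
    using ok ok_cong[of "d0 + d1" "Mx d0 d1 (pt d0 d1 A y)" A] Mx_pt[OF ok] by simp
  moreover have "pt d0 d1 A y \<in> rep_space n d0 d1"
    using y n unfolding rep_space_def pt_def arrow_of_Q_def by (auto split: arrow.splits)
  ultimately show ?thesis unfolding rep_A_iff by blast
qed

lemma pt_Mx: "x \<in> rep_space n d0 d1 \<Longrightarrow> pt d0 d1 (Mx d0 d1 x) x = x"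
  unfolding rep_space_def pt_def Mx_def arrow_of_Q_def
  by (auto simp: fun_eq_iff split: arrow.splits)

lemma pt_cong:
  assumes "\<And>i j. i < d0 + d1 \<Longrightarrow> j < d0 + d1 \<Longrightarrow> A i j = B i j" shows "pt d0 d1 A y = pt d0 d1 B y"
  unfolding pt_def using assms by (auto simp: fun_eq_iff split: arrow.splits)

lemma pt_rational:
  fixes \<delta> :: "'k::field poly"
  assumes "\<And>i j t. poly \<delta> t \<noteq> 0 \<Longrightarrow> A t i j = poly (P i j) t / poly \<delta> t"
    and "\<And>i t. y t i = poly (R i) t"
  shows "\<exists>S. \<forall>t z. poly \<delta> t \<noteq> 0 \<longrightarrow> pt d0 d1 (A t) (y t) z = poly (S z) t / poly \<delta> t"
proof -
  define S where "S z = (case z of (a, i, j) \<Rightarrow> (case a of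
       Eps0 \<Rightarrow> if i < d0 \<and> j < d0 then P i j else 0
     | Eps1 \<Rightarrow> if i < d1 \<and> j < d1 then P (d0 + i) (d0 + j) else 0
     | Alpha l \<Rightarrow> if l = 1 then (if i < d0 \<and> j < d1 then P i (d0 + j) else 0) else R (Alpha l, i, j) * \<delta>))" for z
  have "pt d0 d1 (A t) (y t) z = poly (S z) t / poly \<delta> t" if "poly \<delta> t \<noteq> 0" for t z
    unfolding pt_def S_def using assms(1)[OF that] assms(2) that
    by (cases z) (auto split: arrow.splits)
  then show ?thesis by blast
qed

text \<open>If p vanished at all points with generic operator and the free arrows of x,
  \<open>dense\<close> would carry the vanishing over to x itself.\<close>

lemma generic_avoiding:
  fixes p :: "(arrow \<times> nat \<times> nat \<Rightarrow> 'k::alg_closed_field) \<Rightarrow> 'k"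
  assumes p: "p \<in> poly_fun" and x: "x \<in> rep_A n m d0 d1" "p x \<noteq> 0" and m: "m \<ge> 1"
  obtains A where "ok (d0 + d1) m {..<d0} A" "p (pt d0 d1 A x) \<noteq> 0"
    "vs.dim (Kr (d0 + d1) A (m - 1) (V (d0 + d1))) \<le> vs.dim (NI (d0 + d1) A (V (d0 + d1))) + 1"
proof (rule ccontr)
  assume a: "\<not> thesis"
  have x': "x \<in> rep_space n d0 d1" "ok (d0 + d1) m {..<d0} (Mx d0 d1 x)" using x(1) unfolding rep_A_iff by blast+
  have "p (pt d0 d1 (Mx d0 d1 x) x) = 0"
  proof (rule dense[where Zp = "\<lambda>A. p (pt d0 d1 A x) = 0", OF _ _ m x'(2)])
    \<comment> \<open>Along a line the value of p is a polynomial in t, so vanishing for almost all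
      t forces vanishing at t = 0.\<close>
    fix A B :: "nat \<Rightarrow> nat \<Rightarrow> 'k"
    assume fin: "finite {t. \<not> p (pt d0 d1 (lnm A B t) x) = 0}"
    have "lnm A B t i j = poly [:A i j, B i j:] t / poly 1 t" for t i j by (simp add: lnm_def)
    moreover have "x z = poly [:x z:] t" for z t by simp
    ultimately obtain S where S: "\<And>t z. poly 1 t \<noteq> 0 \<Longrightarrow> pt d0 d1 (lnm A B t) x z = poly (S z) t / poly 1 t"
      using pt_rational[of 1 "lnm A B" "\<lambda>i j. [:A i j, B i j:]" "\<lambda>t. x" "\<lambda>z. [:x z:]" d0 d1] by blast
    from poly_fun_rational[where x="\<lambda>t. pt d0 d1 (lnm A B t) x" and \<delta>=1, OF p S] obtain T where
      T: "\<And>t. p (pt d0 d1 (lnm A B t) x) = poly T t" by auto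
    have "T = 0" by (rule poly_0_cofinite) (use fin in \<open>simp add: T\<close>)
    then show "p (pt d0 d1 A x) = 0" using T[of 0] by simp
  next
    fix A :: "nat \<Rightarrow> nat \<Rightarrow> 'k"
    assume "ok (d0 + d1) m {..<d0} A"
      "vs.dim (Kr (d0 + d1) A (m - 1) (V (d0 + d1))) \<le> vs.dim (NI (d0 + d1) A (V (d0 + d1))) + 1"
    then show "p (pt d0 d1 A x) = 0" using a that by blast
  qed
  then show False using x(2) pt_Mx[OF x'(1)] by simp
qed

section \<open>Irreducibility\<close>

definition mix :: "'k::field \<Rightarrow> (nat \<Rightarrow> nat \<Rightarrow> 'k) \<Rightarrow> (nat \<Rightarrow> nat \<Rightarrow> 'k) \<Rightarrow> nat \<Rightarrow> nat \<Rightarrow> 'k" where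
  "mix t A B = lnm A (\<lambda>i j. B i j - A i j) t"

lemma mix_0 [simp]: "mix 0 A B = A" by (simp add: mix_def)

lemma mix_1 [simp]: "mix 1 A B = B" by (simp add: mix_def lnm_def)

lemma pcurve_mix: "pcurve (\<lambda>t. mix t A B i)"
  unfolding pcurve_def mix_def lnm_def
  by (intro allI exI[of _ "[:A i _, B i _ - A i _:]"]) simp

lemma pcurve_mix_apow:
  assumes "pcurve c" shows "pcurve (\<lambda>t. (app d (mix t A B) ^^ b) (c t))"
proof (induction b)
  case 0 then show ?case using assms by simp
next
  case (Suc b)
  show ?case unfolding mix_def funpow.simps comp_apply
    by (rule pcurve_app) (rule Suc.IH[unfolded mix_def])
qed

lemma pcurve_mix_app: "pcurve c \<Longrightarrow> pcurve (\<lambda>t. app d (mix t A B) (c t))"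
  using pcurve_mix_apow[where c = c and d = d and A = A and B = B and b = 1] by simp

text \<open>All conditions of \<open>pdata\<close> are linear, which is the purpose of the
  prescribed flag.\<close>

lemma pdata_mix:
  assumes "pdata d0 d1 m \<epsilon> c" "pdata d0 d1 m \<epsilon>' c'" shows "pdata d0 d1 m (mix t \<epsilon> \<epsilon>') (mix t c c')"
proof -
  have "mix t \<epsilon> \<epsilon>' i j = 0" if "\<epsilon> i j = 0" "\<epsilon>' i j = 0" for i j using that by (simp add: mix_def lnm_def)
  moreover have "mix t c c' i j = 0" if "c i j = 0" "c' i j = 0" for i j using that by (simp add: mix_def lnm_def)
  ultimately show ?thesis using assms unfolding pdata_def supp_sp_def by blast
qed

lemma pcurve_hcol:
  "pcurve (\<lambda>t. hcol d0 d1 m (mix t \<epsilon> \<epsilon>') (mix t c c') (mix t \<psi> \<psi>') (mix t g g') k)"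
proof -
  have "pcurve (\<lambda>t. app d1 (mix t g g') (phi d1 m (mix t \<epsilon> \<epsilon>') (mix t c c') k))"
    unfolding phi_def by (intro pcurve_mix_app pcurve_mix_apow pcurve_mix)
  then obtain p where p: "\<And>i t. app d1 (mix t g g') (phi d1 m (mix t \<epsilon> \<epsilon>') (mix t c c') k) i = poly (p i) t"
    unfolding pcurve_def by metis
  have "hcol d0 d1 m (mix t \<epsilon> \<epsilon>') (mix t c c') (mix t \<psi> \<psi>') (mix t g g') k i =
    poly (if i < d0 then [:\<psi> i k, \<psi>' i k - \<psi> i k:] else if i < d0 + d1 then p (i - d0) else 0) t" for i t
    unfolding hcol_def p by (simp add: mix_def lnm_def)
  then show ?thesis unfolding pcurve_def by blast
qed

lemma indepf_unitv_inj:
  assumes ind: "indepf d (\<lambda>k. app d g (unitv k))" and v: "v \<in> V d" "app d g v = 0" shows "v = 0"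
proof -
  have "app d g (\<Sum>k<d. sc (v k) (unitv k)) = 0" using v V_expand[OF v(1)] by simp
  then have z: "(\<Sum>k<d. sc (v k) (app d g (unitv k))) = 0" unfolding app_sum app_sc .
  have "(\<Sum>k<d. v k * app d g (unitv k) x) = 0" for x
    using fun_cong[OF z, of x] unfolding sum_fun_apply sc_apply zero_fun_apply .
  then have "v k = 0" if "k < d" for k using indepfD[OF ind _ that] by blast
  then show ?thesis using V_out[OF v(1)] by (auto simp: fun_eq_iff zero_fun_apply)
qed

text \<open>The curve of operators is built from moving columns; this identifies its end points with
  the given operators, which have the same Jordan bases.\<close>

lemma jordan_unique:
  assumes h: "jordan_basis d m A h" "jordan_basis d m B h" and ij: "i < d" "j < d"
  shows "A i j = B i j"
proof -
  have hV: "\<And>k. k < d \<Longrightarrow> h k \<in> V d" and ind: "indepf d h"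
    and eq: "\<And>k. k < d \<Longrightarrow> app d A (h k) = app d B (h k)" using h unfolding jordan_basis_def by auto
  obtain \<alpha> where \<alpha>: "unitv j = (\<Sum>k<d. sc (\<alpha> k) (h k))"
    using indepf_expand[OF ind hV unitv_supp_sp[OF ij(2)]] by blast
  have "app d A (unitv j) = app d B (unitv j)"
    unfolding \<alpha> app_sum app_sc by (rule sum.cong) (simp_all add: eq)
  then show ?thesis using app_unitv[OF ij, of A] app_unitv[OF ij, of B] by simp
qed

text \<open>The parameters are joined by straight lines, and the columns along them define a
  rational curve of operators. It lies in the variety wherever the columns and g stay independent,
  so the product of the numerators of p1 and p2 vanishes almost everywhere. One numerator is
  therefore the zero polynomial, and it is evaluated at its own end of the curve.\<close>

lemma generic_joined:
  fixes p1 p2 :: "(arrow \<times> nat \<times> nat \<Rightarrow> 'k::alg_closed_field) \<Rightarrow> 'k"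
  assumes p: "p1 \<in> poly_fun" "p2 \<in> poly_fun" and m: "m \<ge> 1" and n: "n \<ge> 1"
    and x: "x1 \<in> rep_space n d0 d1" "x2 \<in> rep_space n d0 d1"
    and A: "ok (d0 + d1) m {..<d0} A1" "ok (d0 + d1) m {..<d0} A2"
    and gen: "vs.dim (Kr (d0 + d1) A1 (m - 1) (V (d0 + d1))) \<le> vs.dim (NI (d0 + d1) A1 (V (d0 + d1))) + 1"
      "vs.dim (Kr (d0 + d1) A2 (m - 1) (V (d0 + d1))) \<le> vs.dim (NI (d0 + d1) A2 (V (d0 + d1))) + 1"
    and cover: "\<And>y. y \<in> rep_A n m d0 d1 \<Longrightarrow> p1 y = 0 \<or> p2 y = 0"
  shows "p1 (pt d0 d1 A1 x1) = 0 \<or> p2 (pt d0 d1 A2 x2) = 0"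
proof -
  let ?d = "d0 + d1"
  obtain \<epsilon> c \<psi> g where a1: "pdata d0 d1 m \<epsilon> c" "indepf d1 (\<lambda>k. app d1 g (unitv k))"
    "jordan_basis ?d m A1 (hcol d0 d1 m \<epsilon> c \<psi> g)" by (rule param_exists[OF A(1) m gen(1)])
  obtain \<epsilon>' c' \<psi>' g' where a2: "pdata d0 d1 m \<epsilon>' c'" "indepf d1 (\<lambda>k. app d1 g' (unitv k))"
    "jordan_basis ?d m A2 (hcol d0 d1 m \<epsilon>' c' \<psi>' g')" by (rule param_exists[OF A(2) m gen(2)])
  define h where "h k t = hcol d0 d1 m (mix t \<epsilon> \<epsilon>') (mix t c c') (mix t \<psi> \<psi>') (mix t g g') k" for k t
  define J :: "nat \<Rightarrow> nat \<Rightarrow> 'k" where "J l k = (if jnext ?d m k \<and> l = Suc k then 1 else 0)" for l k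
  have hp: "\<And>k. pcurve (h k)" unfolding h_def by (rule pcurve_hcol)
  have hV: "\<And>k t. h k t \<in> V ?d" unfolding h_def by (rule hcol_V)
  obtain \<delta> P where \<delta>: "\<And>t. indepf ?d (\<lambda>k. h k t) \<Longrightarrow> poly \<delta> t \<noteq> 0"
    and P: "\<And>t k. poly \<delta> t \<noteq> 0 \<Longrightarrow> k < ?d \<Longrightarrow>
      app ?d (\<lambda>i j. poly (P i j) t / poly \<delta> t) (h k t) = (\<Sum>l<?d. sc (J l k) (h l t))"
    by (rule rational_conj[of ?d h J, OF hp hV]) blast
  define At where "At t i j = poly (P i j) t / poly \<delta> t" for t i j
  have jb: "jordan_basis ?d m (At t) (\<lambda>k. h k t)" if it: "indepf ?d (\<lambda>k. h k t)" for t
  proof -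
    have "(\<Sum>l<?d. sc (J l k) (h l t)) = (if jnext ?d m k then h (Suc k) t else 0)" for k
    proof (cases "jnext ?d m k")
      case True
      have "(\<Sum>l<?d. sc (J l k) (h l t)) = (\<Sum>l<?d. if l = Suc k then h l t else 0)"
        by (rule sum.cong) (use True in \<open>auto simp: J_def\<close>)
      then show ?thesis using True by (simp add: jnext_def)
    next
      case False
      have "(\<Sum>l<?d. sc (J l k) (h l t)) = 0"
        by (rule sum.neutral) (use False in \<open>auto simp: J_def\<close>)
      then show ?thesis using False by simp
    qed
    moreover have "app ?d (At t) (h k t) = (\<Sum>l<?d. sc (J l k) (h l t))" if k: "k < ?d" for k
      unfolding At_def by (rule P[OF \<delta>[OF it] k])
    ultimately show ?thesis unfolding jordan_basis_def using hV it by simp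
  qed
  have okt: "ok ?d m {..<d0} (At t)"
    if i: "indepf ?d (\<lambda>k. h k t)" "indepf d1 (\<lambda>k. app d1 (mix t g g') (unitv k))" for t
    by (rule param_ok[OF pdata_mix[OF a1(1) a2(1)] m indepf_unitv_inj[OF i(2)] jb[OF i(1), unfolded h_def]])
  define y where "y t z = x1 z + t * (x2 z - x1 z)" for t z
  have yr: "y t \<in> rep_space n d0 d1" for t using x unfolding rep_space_def y_def by auto
  have yp: "y t z = poly [:x1 z, x2 z - x1 z:] t" for t z by (simp add: y_def)
  obtain R where R: "\<And>t z. poly \<delta> t \<noteq> 0 \<Longrightarrow> pt d0 d1 (At t) (y t) z = poly (R z) t / poly \<delta> t"
    using pt_rational[of \<delta> At P y "\<lambda>z. [:x1 z, x2 z - x1 z:]" d0 d1] At_def yp by blast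
  obtain S1 N1 where S1: "\<And>t. poly \<delta> t \<noteq> 0 \<Longrightarrow> p1 (pt d0 d1 (At t) (y t)) * poly \<delta> t ^ N1 = poly S1 t"
    using poly_fun_rational[OF p(1), of \<delta> "\<lambda>t. pt d0 d1 (At t) (y t)" R, OF R] by blast
  obtain S2 N2 where S2: "\<And>t. poly \<delta> t \<noteq> 0 \<Longrightarrow> p2 (pt d0 d1 (At t) (y t)) * poly \<delta> t ^ N2 = poly S2 t"
    using poly_fun_rational[OF p(2), of \<delta> "\<lambda>t. pt d0 d1 (At t) (y t)" R, OF R] by blast
  have h0: "(\<lambda>k. h k 0) = hcol d0 d1 m \<epsilon> c \<psi> g" and h1: "(\<lambda>k. h k 1) = hcol d0 d1 m \<epsilon>' c' \<psi>' g'"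
    unfolding h_def by simp_all
  have i0: "indepf ?d (\<lambda>k. h k 0)" and i1: "indepf ?d (\<lambda>k. h k 1)"
    using a1(3) a2(3) unfolding h0 h1 jordan_basis_def by blast+
  have f1: "finite {t. \<not> indepf ?d (\<lambda>k. h k t)}" 
    by (rule indepf_semicont[where c = h and ?t0.0 = 0, OF _ i0]) (use hp in blast)
  have f2: "finite {t. \<not> indepf d1 (\<lambda>k. app d1 (mix t g g') (unitv k))}"
  proof (rule indepf_semicont[where ?t0.0 = 0])
    show "\<forall>k<d1. pcurve (\<lambda>t. app d1 (mix t g g') (unitv k))"
      by (intro allI impI pcurve_mix_app pcurve_const)
    show "indepf d1 (\<lambda>k. app d1 (mix 0 g g') (unitv k))" using a1(2) by simp
  qed
  have "S1 * S2 = 0"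
  proof (rule poly_0_cofinite, rule finite_subset[OF _ finite_UnI[OF f1 f2]], rule subsetI, rule ccontr)
    fix t assume t: "t \<in> {t. poly (S1 * S2) t \<noteq> 0}"
      and "t \<notin> {t. \<not> indepf ?d (\<lambda>k. h k t)} \<union> {t. \<not> indepf d1 (\<lambda>k. app d1 (mix t g g') (unitv k))}"
    then have i: "indepf ?d (\<lambda>k. h k t)" "indepf d1 (\<lambda>k. app d1 (mix t g g') (unitv k))" by blast+
    have "p1 (pt d0 d1 (At t) (y t)) = 0 \<or> p2 (pt d0 d1 (At t) (y t)) = 0"
      by (rule cover[OF pt_rep[OF okt[OF i] yr n]])
    then have "poly S1 t = 0 \<or> poly S2 t = 0" using S1[OF \<delta>[OF i(1)]] S2[OF \<delta>[OF i(1)]] by auto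
    then show False using t by auto
  qed
  then have "S1 = 0 \<or> S2 = 0" by simp
  moreover have "p1 (pt d0 d1 A1 x1) = 0" if "S1 = 0"
  proof -
    have "pt d0 d1 (At 0) (y 0) = pt d0 d1 A1 x1"
    proof -
      have "y 0 = x1" by (simp add: y_def fun_eq_iff)
      moreover have "pt d0 d1 (At 0) x1 = pt d0 d1 A1 x1"
        by (rule pt_cong) (rule jordan_unique[OF jb[OF i0] a1(3)[folded h0]])
      ultimately show ?thesis by simp
    qed
    then show ?thesis using S1[OF \<delta>[OF i0]] \<delta>[OF i0] that by simp
  qed
  moreover have "p2 (pt d0 d1 A2 x2) = 0" if "S2 = 0"
  proof -
    have "pt d0 d1 (At 1) (y 1) = pt d0 d1 A2 x2"
    proof -
      have "y 1 = x2" by (simp add: y_def fun_eq_iff)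
      moreover have "pt d0 d1 (At 1) x2 = pt d0 d1 A2 x2"
        by (rule pt_cong) (rule jordan_unique[OF jb[OF i1] a2(3)[folded h1]])
      ultimately show ?thesis by simp
    qed
    then show ?thesis using S2[OF \<delta>[OF i1]] \<delta>[OF i1] that by simp
  qed
  ultimately show ?thesis by blast
qed

lemma zero_rep: "m \<ge> 1 \<Longrightarrow> (\<lambda>z. 0 :: 'k::field) \<in> rep_A n m d0 d1"
proof -
  assume m: "m \<ge> 1"
  let ?M = "Mx d0 d1 (\<lambda>z. 0) :: nat \<Rightarrow> nat \<Rightarrow> 'k"
  have a: "app (d0 + d1) ?M v = 0" for v
  proof
    have "?M i j = 0" for i j by (simp add: Mx_def)
    then show "app (d0 + d1) ?M v i = 0 i" for i by (simp add: app_def zero_fun_apply)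
  qed
  have "(app (d0 + d1) ?M ^^ m) v = 0" for v using m a by (cases m) simp_all
  then have "ok (d0 + d1) m {..<d0} ?M" unfolding ok_def by (simp add: a vs.subspace_0)
  moreover have "(\<lambda>z. 0 :: 'k) \<in> rep_space n d0 d1" by (simp add: rep_space_def)
  ultimately show ?thesis unfolding rep_A_iff by blast
qed

theorem theorem1p2:
  fixes m n :: nat
  assumes "m \<ge> 2" and "n \<ge> 1"
  shows "geom_irreducible_A n m TYPE('k::alg_closed_field)"
  unfolding geom_irreducible_A_def zariski_irreducible_def
proof (intro allI conjI impI)
  fix d0 d1 :: nat
  let ?X = "rep_A n m d0 d1 :: (arrow \<times> nat \<times> nat \<Rightarrow> 'k) set"
  have m: "m \<ge> 1" using assms(1) by simp
  show "?X \<noteq> {}" using zero_rep[OF m] by blast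
  fix Z1 Z2 :: "(arrow \<times> nat \<times> nat \<Rightarrow> 'k) set"
  assume Z: "zariski_closed Z1" "zariski_closed Z2" "?X \<subseteq> Z1 \<union> Z2"
  show "?X \<subseteq> Z1 \<or> ?X \<subseteq> Z2"
  proof (rule ccontr)
    assume "\<not> ?thesis"
    then obtain x1 x2 where x: "x1 \<in> ?X" "x1 \<notin> Z1" "x2 \<in> ?X" "x2 \<notin> Z2" by blast
    \<comment> \<open>One equation of each closed set suffices: for every point of the variety p1 or
      p2 vanishes, yet neither does so on all of it.\<close>
    obtain p1 where p1: "p1 \<in> poly_fun" "p1 x1 \<noteq> 0" "\<And>z. z \<in> Z1 \<Longrightarrow> p1 z = 0"
      using Z(1) x(2) unfolding zariski_closed_def by auto
    obtain p2 where p2: "p2 \<in> poly_fun" "p2 x2 \<noteq> 0" "\<And>z. z \<in> Z2 \<Longrightarrow> p2 z = 0"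
      using Z(2) x(4) unfolding zariski_closed_def by auto
    obtain A1 where A1: "ok (d0 + d1) m {..<d0} A1" "p1 (pt d0 d1 A1 x1) \<noteq> 0"
      "vs.dim (Kr (d0 + d1) A1 (m - 1) (V (d0 + d1))) \<le> vs.dim (NI (d0 + d1) A1 (V (d0 + d1))) + 1"
      by (rule generic_avoiding[OF p1(1) x(1) p1(2) m])
    obtain A2 where A2: "ok (d0 + d1) m {..<d0} A2" "p2 (pt d0 d1 A2 x2) \<noteq> 0"
      "vs.dim (Kr (d0 + d1) A2 (m - 1) (V (d0 + d1))) \<le> vs.dim (NI (d0 + d1) A2 (V (d0 + d1))) + 1"
      by (rule generic_avoiding[OF p2(1) x(3) p2(2) m])
    have xs: "x1 \<in> rep_space n d0 d1" "x2 \<in> rep_space n d0 d1" using x unfolding rep_A_iff by blast+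
    have cover: "p1 y = 0 \<or> p2 y = 0" if "y \<in> ?X" for y using Z(3) that p1(3) p2(3) by blast
    show False
      using generic_joined[OF p1(1) p2(1) m assms(2) xs A1(1) A2(1) A1(3) A2(3) cover] A1(2) A2(2) by blast
  qed
qed

end
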